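(* There exists a universal constant $C_2>0$ such that the following holds in the decentralized multi-agent policy evaluation setting described in the context. Let $\{\widehat r_{i,T}\}_{i\in\mathcal N}$ be generated by SDA with $$T_0=\frac T2\ge k^*\ (T_0\text{ an integer}),\qquad \eta=\frac1{\lambda_1(L)},\qquad \zeta=\frac{\sqrt{\kappa(L)}-1}{\sqrt{\kappa(L)}+1},$$ let $\widehat P_T$ be the sample transition matrix, and let $\widehat J_{i,T}=(I-\gamma\widehat P_T)^{-1}\widehat r_{i,T}$ be the value function estimated by agent $i\in\mathcal N$. Then $$\mathbb E\left[\max_{i\in\mathcal N}\|\widehat J_{i,T}-J^*\|_\infty\right]\le C_2\Bigg\{e^{-\frac{T}{2\sqrt{\kappa(L)}}}\frac{\sqrt{\sum_{i=1}^N\|r_i-\bar r\|_2^2}}{1-\gamma}+\frac{\kappa(L)^{1/4}\sqrt{\sum_{i=1}^N\sum_{j=1}^n\sigma_{i,j}^2}}{(1-\gamma)T}$$ $$+\frac{\sqrt{\sum_{j=1}^n\max_{i\in\mathcal N}\sigma_{i,j}^2}}{(1-\gamma)\sqrt T}+\frac{\sqrt{\log n}}{(1-\gamma)^{3/2}\sqrt T}+\frac{\log n}{(1-\gamma)^2T}\Bigg\}.$$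
   Context: **Network and gossip matrix.** $\mathcal G=(\mathcal N,\mathcal E)$ is a simple, connected, undirected graph with nodes (agents) $\mathcal N=\{1,\dots,N\}$, $N\ge2$; $\mathcal N_i$ is the set of neighbors of $i$. $L=[L_{i,j}]\in\mathbb R^{N\times N}$ is a gossip matrix: symmetric positive semi-definite, $L_{i,j}\neq0$ only if $i=j$ or $(i,j)\in\mathcal E$, and its kernel is the set of all constant vectors. Its eigenvalues are $0=\lambda_N(L)<\lambda_{N-1}(L)\le\dots\le\lambda_1(L)$, and $\kappa(L)=\lambda_1(L)/\lambda_{N-1}(L)$. The integer $k^*$ is the smallest positive integer such that for all integers $k\ge k^*$, $\left(1+\frac{k}{\sqrt{\kappa(L)}+1}\right)\left(1-\frac1{\sqrt{\kappa(L)}}\right)^k\le\left(1-\frac1{2\sqrt{\kappa(L)}}\right)^k$. **Algorithm SDA.** Given local inputs $R_{i,t}\in\mathbb R^n$, parameters $\eta>0$, $\zeta\ge0$, a number of iterations $T$ and a burn-in time $T_0\in[0,T-1]$: initialize $x_{i,0}=y_{i,0}=0\in\mathbb R^n$ for all $i$; for $t=0,\dots,T-1$ each node $i$ computes $\theta_{i,t}=x_{i,t}+R_{i,t}$, $y_{i,t+1}=x_{i,t}-\eta\sum_{j\in\mathcal N_i\cup\{i\}}L_{i,j}\theta_{j,t}$, $x_{i,t+1}=y_{i,t+1}+\zeta(y_{i,t+1}-y_{i,t})$. The output at node $i$ is $\frac1{T-T_0}\sum_{t=T_0}^{T-1}\theta_{i,t}$. **Decentralized policy evaluation.** A Markov reward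 process has state space $\mathcal S=\{1,\dots,n\}$, transition matrix $P\in[0,1]^{n\times n}$, discount factor $\gamma\in[0,1)$, and reward vector $r_i\in\mathbb R^n$ for each agent $i\in\mathcal N$; $\bar r=\frac1N\sum_{i=1}^Nr_i$. The value function is $J^*=(I-\gamma P)^{-1}\bar r$, the solution of $J=\bar r+\gamma PJ$. Generative observation model: at each time $t\ge0$ and for each state $j\in\mathcal S$, all agents observe a common random next state $X_{t,j}\sim P(j,\cdot)$, and each agent $i$ observes a local random reward $R_{i,t,j}$ with mean $r_{i,j}$ (the $j$-th component of $r_i$) and variance $\sigma_{i,j}^2$. The local rewards are independent across time and agents; the transition samples $X_{t,j}$ are independent across $t$ and $j$. **Estimates.** For $t=0,\dots,T-1$ let $Z_t\in\{0,1\}^{n\times n}$ be the matrix whose row $j$ has a single non-zero entry, equal to $1$, at column $X_{t,j}$; the sample transition matrix is $\widehat P_T=\frac1T\sum_{t=0}^{T-1}Z_t$. The estimates $\{\widehat r_{i,T}\}_{i\in\mathcal N}$ of $\bar r$ are the outputs of SDA run for $T$ iterations with inputs $R_{i,t}=(R_{i,t,1},\dots,R_{i,t,n})^\top$.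
   Formalization: The formal statement adds the assumption that the mean reward satisfies ‖r̄‖_∞ ≤ 1 (without a reward scale the claim is false, since the last two terms do not scale with r̄); C_2 is formally chosen per type of sample space, and a canonical sequence space gives one for all. *)

theory Defs
  imports
    "HOL-Probability.Probability"
    "Jordan_Normal_Form.Char_Poly"
    "Jordan_Normal_Form.Matrix_Kernel"
    "Jordan_Normal_Form.Gauss_Jordan_Elimination"
begin

text \<open>Agents are \<open>0, \<dots>, N - 1\<close> and states are \<open>0, \<dots>, n - 1\<close>, matching the
  index ranges of \<^typ>\<open>real mat\<close> and \<^typ>\<open>real vec\<close>. A per-agent family of vectors of
  \<open>\<real>\<^sup>n\<close> is a function of an agent and a coordinate \<open>j < n\<close>.\<close>

definition simple_connected_graph :: "nat \<Rightarrow> (nat \<times> nat) set \<Rightarrow> bool" where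
  "simple_connected_graph N E \<longleftrightarrow>
     E \<subseteq> {..<N} \<times> {..<N} \<and> sym E \<and> irrefl E \<and> (\<forall>i<N. \<forall>j<N. (i, j) \<in> E\<^sup>*)"

definition gossip_matrix :: "nat \<Rightarrow> (nat \<times> nat) set \<Rightarrow> real mat \<Rightarrow> bool" where
  "gossip_matrix N E L \<longleftrightarrow>
     L \<in> carrier_mat N N \<and>
     transpose_mat L = L \<and>
     (\<forall>v \<in> carrier_vec N. 0 \<le> scalar_prod v (L *\<^sub>v v)) \<and>
     (\<forall>i<N. \<forall>j<N. L $$ (i, j) \<noteq> 0 \<longrightarrow> i = j \<or> (i, j) \<in> E) \<and>
     mat_kernel L = range (\<lambda>c. vec N (\<lambda>_. c))"

text \<open>\<open>eig A k\<close> is the \<open>k\<close>-th largest eigenvalue, counted from \<open>1\<close> and with multiplicity.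
  Only real eigenvalues are listed, which are all of them when \<open>A\<close> is symmetric.\<close>

definition eig :: "real mat \<Rightarrow> nat \<Rightarrow> real" where
  "eig A k = rev (sorted_list_of_multiset (proots (char_poly A))) ! (k - 1)"

definition kappa :: "real mat \<Rightarrow> real" where
  "kappa L = eig L 1 / eig L (dim_row L - 1)"

definition kstar :: "real mat \<Rightarrow> nat" where
  "kstar L = (LEAST k0. 1 \<le> k0 \<and>
     (\<forall>k\<ge>k0. (1 + real k / (sqrt (kappa L) + 1)) * (1 - 1 / sqrt (kappa L)) ^ k
               \<le> (1 - 1 / (2 * sqrt (kappa L))) ^ k))"

text \<open>Iterates of SDA; \<open>R i t j\<close> is coordinate \<open>j\<close> of the input of agent \<open>i\<close> at time \<open>t\<close>,
  and \<open>sda_state \<dots> t i j = (x\<^sub>i\<^sub>,\<^sub>t\<^sub>,\<^sub>j, y\<^sub>i\<^sub>,\<^sub>t\<^sub>,\<^sub>j)\<close>.\<close>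

primrec sda_state ::
  "(nat \<times> nat) set \<Rightarrow> real mat \<Rightarrow> real \<Rightarrow> real \<Rightarrow> (nat \<Rightarrow> nat \<Rightarrow> nat \<Rightarrow> real)
     \<Rightarrow> nat \<Rightarrow> nat \<Rightarrow> nat \<Rightarrow> real \<times> real" where
  "sda_state E L \<eta> \<zeta> R 0 = (\<lambda>i j. (0, 0))"
| "sda_state E L \<eta> \<zeta> R (Suc t) = (\<lambda>i j.
     let x = (\<lambda>i. fst (sda_state E L \<eta> \<zeta> R t i j));
         y = (\<lambda>i. snd (sda_state E L \<eta> \<zeta> R t i j));
         \<theta> = (\<lambda>i. x i + R i t j);
         y' = x i - \<eta> * (\<Sum>k \<in> E `` {i} \<union> {i}. L $$ (i, k) * \<theta> k);
         x' = y' + \<zeta> * (y' - y i)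
     in (x', y'))"

definition sda_theta ::
  "(nat \<times> nat) set \<Rightarrow> real mat \<Rightarrow> real \<Rightarrow> real \<Rightarrow> (nat \<Rightarrow> nat \<Rightarrow> nat \<Rightarrow> real)
     \<Rightarrow> nat \<Rightarrow> nat \<Rightarrow> nat \<Rightarrow> real" where
  "sda_theta E L \<eta> \<zeta> R t i j = fst (sda_state E L \<eta> \<zeta> R t i j) + R i t j"

definition sda_output ::
  "nat \<Rightarrow> (nat \<times> nat) set \<Rightarrow> real mat \<Rightarrow> real \<Rightarrow> real \<Rightarrow> nat \<Rightarrow> nat
     \<Rightarrow> (nat \<Rightarrow> nat \<Rightarrow> nat \<Rightarrow> real) \<Rightarrow> nat \<Rightarrow> real vec" where
  "sda_output n E L \<eta> \<zeta> T T0 R i =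
     vec n (\<lambda>j. (\<Sum>t = T0..<T. sda_theta E L \<eta> \<zeta> R t i j) / real (T - T0))"

definition stochastic_matrix :: "nat \<Rightarrow> real mat \<Rightarrow> bool" where
  "stochastic_matrix n P \<longleftrightarrow>
     P \<in> carrier_mat n n \<and>
     (\<forall>j<n. \<forall>k<n. 0 \<le> P $$ (j, k) \<and> P $$ (j, k) \<le> 1) \<and>
     (\<forall>j<n. (\<Sum>k<n. P $$ (j, k)) = 1)"

definition mean_reward :: "nat \<Rightarrow> nat \<Rightarrow> (nat \<Rightarrow> nat \<Rightarrow> real) \<Rightarrow> real vec" where
  "mean_reward N n r = vec n (\<lambda>j. (\<Sum>i<N. r i j) / real N)"

definition value_function :: "nat \<Rightarrow> real \<Rightarrow> real mat \<Rightarrow> real vec \<Rightarrow> real vec" where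
  "value_function n \<gamma> P v = the (mat_inverse (1\<^sub>m n - \<gamma> \<cdot>\<^sub>m P)) *\<^sub>v v"

text \<open>Generative model: \<open>X t j\<close> is the next state sampled from state \<open>j\<close> at time \<open>t\<close>, and
  \<open>R i t j\<close> the reward of agent \<open>i\<close> at time \<open>t\<close> in state \<open>j\<close>. Independence of rewards is that
  of the vectors \<open>(R i t j)\<^sub>j\<close> over all pairs \<open>(i, t)\<close>; the joint law across states, and the
  joint law of rewards and transitions, are left arbitrary.\<close>

definition generative_observations ::
  "'w measure \<Rightarrow> nat \<Rightarrow> nat \<Rightarrow> real mat \<Rightarrow> (nat \<Rightarrow> nat \<Rightarrow> real) \<Rightarrow> (nat \<Rightarrow> nat \<Rightarrow> real)
     \<Rightarrow> (nat \<Rightarrow> nat \<Rightarrow> 'w \<Rightarrow> nat) \<Rightarrow> (nat \<Rightarrow> nat \<Rightarrow> nat \<Rightarrow> 'w \<Rightarrow> real) \<Rightarrow> bool" where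
  "generative_observations M N n P r \<sigma> X R \<longleftrightarrow>
     prob_space M \<and>
     (\<forall>t. \<forall>j<n. X t j \<in> measurable M (count_space {..<n}) \<and>
        (\<forall>k<n. measure M {\<omega> \<in> space M. X t j \<omega> = k} = P $$ (j, k))) \<and>
     prob_space.indep_vars M (\<lambda>_. count_space {..<n}) (\<lambda>(t, j). X t j) (UNIV \<times> {..<n}) \<and>
     (\<forall>i<N. \<forall>t. \<forall>j<n.
        R i t j \<in> borel_measurable M \<and>
        integrable M (R i t j) \<and>
        integrable M (\<lambda>\<omega>. (R i t j \<omega>)\<^sup>2) \<and>
        prob_space.expectation M (R i t j) = r i j \<and>
        prob_space.variance M (R i t j) = (\<sigma> i j)\<^sup>2) \<and>
     prob_space.indep_vars M (\<lambda>_. Pi\<^sub>M {..<n} (\<lambda>_. borel))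
       (\<lambda>(i, t) \<omega>. \<lambda>j\<in>{..<n}. R i t j \<omega>) ({..<N} \<times> UNIV)"

definition transition_indicator :: "nat \<Rightarrow> (nat \<Rightarrow> nat) \<Rightarrow> real mat" where
  "transition_indicator n x = mat n n (\<lambda>(j, k). if x j = k then 1 else 0)"

definition sample_transition_matrix :: "nat \<Rightarrow> nat \<Rightarrow> (nat \<Rightarrow> nat \<Rightarrow> nat) \<Rightarrow> real mat" where
  "sample_transition_matrix n T x =
     mat n n (\<lambda>(j, k). (\<Sum>t<T. transition_indicator n (x t) $$ (j, k)) / real T)"

text \<open>The supremum norm, for vectors of positive dimension.\<close>

definition sup_norm :: "real vec \<Rightarrow> real" where
  "sup_norm v = Max ((\<lambda>j. \<bar>vec_index v j\<bar>) ` {..<dim_vec v})"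

text \<open>The contribution of the sampling error of \<open>P\<close> is homogeneous in the mean reward, so a
  bound in terms of \<open>n\<close>, \<open>T\<close> and \<open>\<gamma>\<close> alone holds only for a fixed reward scale; the
  normalization used is that \<^const>\<open>sup_norm\<close> of \<^const>\<open>mean_reward\<close> is at most \<open>1\<close>.\<close>

definition max_error ::
  "nat \<Rightarrow> nat \<Rightarrow> (nat \<times> nat) set \<Rightarrow> real mat \<Rightarrow> real \<Rightarrow> real \<Rightarrow> real \<Rightarrow> real mat
     \<Rightarrow> (nat \<Rightarrow> nat \<Rightarrow> real) \<Rightarrow> nat \<Rightarrow> nat
     \<Rightarrow> (nat \<Rightarrow> nat \<Rightarrow> 'w \<Rightarrow> nat) \<Rightarrow> (nat \<Rightarrow> nat \<Rightarrow> nat \<Rightarrow> 'w \<Rightarrow> real) \<Rightarrow> 'w \<Rightarrow> real" where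
  "max_error N n E L \<eta> \<zeta> \<gamma> P r T T0 X R \<omega> =
     (let P_hat = sample_transition_matrix n T (\<lambda>t j. X t j \<omega>);
          r_hat = sda_output n E L \<eta> \<zeta> T T0 (\<lambda>i t j. R i t j \<omega>);
          J_hat = (\<lambda>i. value_function n \<gamma> P_hat (r_hat i));
          J_star = value_function n \<gamma> P (mean_reward N n r)
      in Max ((\<lambda>i. sup_norm (J_hat i - J_star)) ` {..<N}))"

end

theory Submission
  imports Defs "Jordan_Normal_Form.Spectral_Radius"
begin

no_notation vec_nth (infixl "$" 90)

text \<open>
  Write \<open>H = 1 / (1 - \<gamma>)\<close> and \<open>\<kappa>\<close> for the condition number of the gossip matrix. The error of agent \<open>i\<close>
  is the sum of \<open>(I - \<gamma> P')\<^sup>-\<^sup>1 (r\<^sub>i' - r\<^sub>0)\<close> and \<open>\<Delta> = (I - \<gamma> P')\<^sup>-\<^sup>1 r\<^sub>0 - (I - \<gamma> P)\<^sup>-\<^sup>1 r\<^sub>0\<close>, where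
  \<open>P'\<close> is the sampled transition matrix, \<open>r\<^sub>i'\<close> the reward estimate and \<open>r\<^sub>0\<close> the mean reward. A
  maximum principle (\<open>resolvent_maximum_principle\<close>) shows that the resolvent of a stochastic matrix
  is monotone and expands the supremum norm by at most \<open>H\<close>. Hence the first part costs \<open>H\<close> times
  the error of the reward estimates, pointwise, and the expectations of the two parts can be bounded
  separately.

  \<^bold>\<open>Rewards.\<close> An orthonormal eigenbasis of the gossip matrix turns SDA into scalar two-step
  recursions. In the mode of eigenvalue \<open>d\<close>, the running sum of the outputs is the convolution of the
  inputs with a sequence \<open>mode_residual\<close> (\<open>sda_mode\<close>). For constant vectors this sequence
  is \<open>1\<close>, so that this mode averages all rewards exactly. In the other modes the choice of \<open>\<eta>\<close> and
  \<open>\<zeta>\<close> makes the characteristic roots complex conjugate, or equal, and of modulus at most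
  \<open>\<rho> = 1 - 1 / sqrt \<kappa>\<close>; the residual is then at most \<open>(3 + t / (sqrt \<kappa> + 1)) \<rho>\<^sup>t\<close>
  (\<open>mode_residual_bound\<close>). Its average over the window from \<open>T / 2\<close> to \<open>T\<close> multiplies the
  disagreement of the mean rewards and gives the exponential term. Its sum of squares is of order
  \<open>sqrt \<kappa>\<close> and controls the noise in these modes, which gives the factor \<open>\<kappa> powr (1/4)\<close>. Parseval's
  identity, independence and Jensen's inequality assemble \<open>reward_estimate_expectation\<close>.

  \<^bold>\<open>Transitions.\<close> Put \<open>J = (I - \<gamma> P)\<^sup>-\<^sup>1 r\<^sub>0\<close> and \<open>V = \<gamma> J\<close>, so that \<open>(I - \<gamma> P') \<Delta> = (P' - P) V\<close>. By Bernstein's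
  inequality \<open>\<bar>(P' - P) V\<bar> \<le> a Var V + Z\<close>, where \<open>Var\<close> is the vector of one-step variances under \<open>P\<close>
  and \<open>Z\<close> is a random scalar of mean of order \<open>ln n / (a T)\<close>, for \<open>a \<le> 1 / H\<close>; therefore \<open>\<bar>\<Delta>\<bar> \<le> a f + H Z\<close> with
  \<open>f = (I - \<gamma> P')\<^sup>-\<^sup>1 (Var V)\<close>. The naive bound \<open>f \<le> H\<^sup>3\<close> would lose a factor. The Bellman equation
  bounds \<open>Var V\<close> by \<open>2 H + (\<gamma> P' J\<^sup>2 - J\<^sup>2) + (P - P') V\<^sup>2\<close>; the middle term telescopes under
  the resolvent of \<open>P'\<close>. The last term is a second fluctuation, and since
  \<open>Var V\<^sup>2 \<le> 4 H\<^sup>2 Var V\<close>, Bernstein's inequality bounds it by \<open>Var V / 2\<close> plus a scalar of mean of order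
  \<open>H\<^sup>2 ln n / T\<close>. Absorbing the half gives \<open>f\<close> of order \<open>H\<^sup>2\<close> for every sample size
  (\<open>model_error_via_variance\<close>), and optimizing \<open>a\<close> gives the last two terms of the bound
  (\<open>model_error_expectation\<close>).
\<close>


section \<open>Orthonormal eigenbases of symmetric matrices\<close>

text \<open>The Householder reflection that exchanges \<open>v\<close> and the first unit vector.\<close>

lemma unit_vector_extends_to_symmetric_involution:
  fixes v :: "nat \<Rightarrow> real"
  assumes n: "0 < n" and v: "(\<Sum>i<n. v i * v i) = 1"
  obtains h :: "nat \<Rightarrow> nat \<Rightarrow> real" where
    "\<And>i j. h i j = h j i"
    "\<And>i j. i < n \<Longrightarrow> j < n \<Longrightarrow> (\<Sum>k<n. h i k * h k j) = (if i = j then 1 else 0)"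
    "\<And>i. i < n \<Longrightarrow> h i 0 = v i"
proof -
  define w where "w = (\<lambda>i. v i - (if i = 0 then 1 else 0))"
  define c where "c = 1 - v 0"
  \<comment> \<open>If \<open>v\<close> is the first unit vector, then \<open>c = 0\<close> and division by zero turns \<open>h\<close> into the identity.\<close>
  define h where "h = (\<lambda>i j. (if i = j then 1 else 0) - w i * w j / c)"
  have ww: "(\<Sum>i<n. w i * w i) = 2 * c"
  proof -
    have "(\<Sum>i<n. w i * w i) = (\<Sum>i<n. v i * v i + (if i = 0 then 1 - 2 * v i else 0))"
      unfolding w_def by (intro sum.cong) (auto simp: algebra_simps)
    also have "\<dots> = 2 * c"
      using n v by (simp add: sum.distrib c_def)
    finally show ?thesis .
  qed
  have sym: "h i j = h j i" for i j by (simp add: h_def)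
  have inv: "(\<Sum>k<n. h i k * h k j) = (if i = j then 1 else 0)" if ij: "i < n" "j < n" for i j
  proof -
    have "(\<Sum>k<n. h i k * h k j)
        = (\<Sum>k<n. (if k = i then (if i = j then 1 else 0) else 0)
             - (if k = i then w i * w j / c else 0) - (if k = j then w i * w j / c else 0)
             + (w i * w j / c\<^sup>2) * (w k * w k))"
      unfolding h_def by (intro sum.cong) (auto simp: algebra_simps power2_eq_square)
    also have "\<dots> = (if i = j then 1 else 0) - 2 * (w i * w j / c) + (w i * w j / c\<^sup>2) * (2 * c)"
      using ij by (simp add: sum.distrib sum_subtractf sum_distrib_left[symmetric] ww
          flip: sum_divide_distrib)
    also have "\<dots> = (if i = j then 1 else 0)"
      by (simp add: power2_eq_square)
    finally show ?thesis .
  qed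
  have first: "h i 0 = v i" if i: "i < n" for i
  proof (cases "c = 0")
    case True
    then have "(\<Sum>i<n. w i * w i) = 0" using ww by simp
    then have "\<forall>i<n. w i = 0" by (auto simp: sum_nonneg_eq_0_iff)
    then show ?thesis using i True by (auto simp: h_def w_def)
  next
    case False
    then show ?thesis by (simp add: h_def w_def c_def field_simps)
  qed
  show thesis using that sym inv first by blast
qed

text \<open>Over the complex numbers an eigenvector exists. Its eigenvalue is real because the quadratic form
  of a real symmetric matrix is real on complex vectors, so the real and the imaginary part both
  satisfy the eigenvalue equation, and one of them is nonzero.\<close>

lemma symmetric_has_real_eigenvector:
  fixes a :: "nat \<Rightarrow> nat \<Rightarrow> real"
  assumes n: "0 < n" and sym: "\<And>i j. i < n \<Longrightarrow> j < n \<Longrightarrow> a i j = a j i"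
  obtains e v where "(\<Sum>i<n. v i * v i) = 1"
    "\<And>i. i < n \<Longrightarrow> (\<Sum>j<n. a i j * v j) = e * v i"
proof -
  define A where "A = mat n n (\<lambda>(i, j). complex_of_real (a i j))"
  have A: "A \<in> carrier_mat n n" by (simp add: A_def)
  obtain e z where "eigenvector A z e"
    using spectrum_non_empty[OF A n] by (auto simp: spectrum_def eigenvalue_def)
  then have z: "z \<in> carrier_vec n" and z0: "z \<noteq> 0\<^sub>v n" and ev: "A *\<^sub>v z = e \<cdot>\<^sub>v z"
    using A by (auto simp: eigenvector_def)
  have evi: "(\<Sum>j<n. of_real (a i j) * z $ j) = e * z $ i" if i: "i < n" for i
  proof -
    have "(A *\<^sub>v z) $ i = (e \<cdot>\<^sub>v z) $ i" by (simp add: ev)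
    then show ?thesis
      using i z by (simp add: A_def scalar_prod_def lessThan_atLeast0)
  qed
  define q where "q = (\<Sum>i<n. (cmod (z $ i))\<^sup>2)"
  have "q \<noteq> 0"
  proof
    assume "q = 0"
    then have "\<forall>i<n. z $ i = 0" by (auto simp: q_def sum_nonneg_eq_0_iff)
    then have "z = 0\<^sub>v n" using z by (intro eq_vecI) auto
    with z0 show False by simp
  qed
  define s where "s = (\<Sum>i<n. \<Sum>j<n. cnj (z $ i) * (of_real (a i j) * z $ j))"
  have s: "s = e * of_real q"
  proof -
    have "s = (\<Sum>i<n. cnj (z $ i) * (e * z $ i))"
      unfolding s_def by (intro sum.cong) (auto simp: sum_distrib_left[symmetric] evi)
    also have "\<dots> = e * of_real q"
      unfolding q_def of_real_sum sum_distrib_left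
      by (intro sum.cong refl) (simp only: complex_norm_square mult_ac)
    finally show ?thesis .
  qed
  have "cnj s = (\<Sum>i<n. \<Sum>j<n. z $ i * (of_real (a i j) * cnj (z $ j)))"
    by (simp add: s_def)
  also have "\<dots> = (\<Sum>j<n. \<Sum>i<n. z $ i * (of_real (a i j) * cnj (z $ j)))"
    by (rule sum.swap)
  also have "\<dots> = s"
    unfolding s_def by (intro sum.cong refl) (simp add: sym mult_ac)
  finally have "cnj e = e" using \<open>q \<noteq> 0\<close> by (simp add: s)
  then obtain d where e: "e = of_real d" using Reals_cnj_iff Reals_cases by metis
  have re: "(\<Sum>j<n. a i j * Re (z $ j)) = d * Re (z $ i)" if "i < n" for i
    using arg_cong[OF evi[OF that], of Re] by (simp add: e)
  have im: "(\<Sum>j<n. a i j * Im (z $ j)) = d * Im (z $ i)" if "i < n" for i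
    using arg_cong[OF evi[OF that], of Im] by (simp add: e)
  have "\<exists>x. (\<exists>i<n. x i \<noteq> (0::real)) \<and> (\<forall>i<n. (\<Sum>j<n. a i j * x j) = d * x i)"
  proof (cases "\<exists>i<n. Re (z $ i) \<noteq> 0")
    case True
    then show ?thesis using re by (intro exI[of _ "\<lambda>i. Re (z $ i)"]) auto
  next
    case False
    have "\<exists>i<n. Im (z $ i) \<noteq> 0"
    proof (rule ccontr)
      assume "\<not> ?thesis"
      with False have "\<forall>i<n. z $ i = 0" by (auto simp: complex_eq_iff)
      then have "z = 0\<^sub>v n" using z by (intro eq_vecI) auto
      with z0 show False by simp
    qed
    then show ?thesis using im by (intro exI[of _ "\<lambda>i. Im (z $ i)"]) auto
  qed
  then obtain x k where k: "k < n" "x k \<noteq> 0" and x: "\<And>i. i < n \<Longrightarrow> (\<Sum>j<n. a i j * x j) = d * x i"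
    by auto
  define r where "r = sqrt (\<Sum>i<n. x i * x i)"
  have pos: "0 < (\<Sum>i<n. x i * x i)"
    using k by (intro sum_pos2[of _ k]) (auto simp: zero_less_mult_iff linorder_neq_iff)
  then have r: "r > 0" "r * r = (\<Sum>i<n. x i * x i)" by (auto simp: r_def)
  have "(\<Sum>i<n. (x i / r) * (x i / r)) = (\<Sum>i<n. x i * x i) / (r * r)"
    by (simp add: sum_divide_distrib)
  also have "\<dots> = 1" using r(2) pos by simp
  finally have 1: "(\<Sum>i<n. (x i / r) * (x i / r)) = 1" .
  have 2: "(\<Sum>j<n. a i j * (x j / r)) = d * (x i / r)" if "i < n" for i
    using x[OF that] by (simp add: sum_divide_distrib[symmetric])
  show thesis using that[OF 1 2] .
qed

text \<open>Deflation: conjugating with a reflection that maps the first unit vector to an eigenvector leaves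
  a block of size \<open>n\<close>, to which the induction hypothesis applies. Matrices and vectors are functions
  here because the index shift between the sizes is then a plain renaming.\<close>

lemma symmetric_orthonormal_eigenbasis:
  fixes a :: "nat \<Rightarrow> nat \<Rightarrow> real"
  assumes "\<And>i j. i < n \<Longrightarrow> j < n \<Longrightarrow> a i j = a j i"
  shows "\<exists>u d. (\<forall>k<n. \<forall>l<n. (\<Sum>i<n. u k i * u l i) = (if k = l then 1 else (0::real))) \<and>
    (\<forall>k<n. \<forall>i<n. (\<Sum>j<n. a i j * u k j) = d k * u k i)"
  using assms
proof (induction n arbitrary: a)
  case 0
  then show ?case by simp
next
  case (Suc n)
  obtain e v where v: "(\<Sum>i<Suc n. v i * v i) = 1"
    and ev: "\<And>i. i < Suc n \<Longrightarrow> (\<Sum>j<Suc n. a i j * v j) = e * v i"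
    by (rule symmetric_has_real_eigenvector[of "Suc n" a]) (use Suc.prems in auto)
  obtain h where hs: "\<And>i j. h i j = h j i"
    and hh: "\<And>i j. i < Suc n \<Longrightarrow> j < Suc n \<Longrightarrow> (\<Sum>k<Suc n. h i k * h k j) = (if i = j then 1 else (0::real))"
    and h0: "\<And>i. i < Suc n \<Longrightarrow> h i 0 = v i"
    by (rule unit_vector_extends_to_symmetric_involution[OF _ v]) auto
  have hinv: "(\<Sum>k<Suc n. h i k * (\<Sum>j<Suc n. h k j * x j)) = x i" if "i < Suc n" for i and x :: "nat \<Rightarrow> real"
  proof -
    have "(\<Sum>k<Suc n. h i k * (\<Sum>j<Suc n. h k j * x j)) = (\<Sum>k<Suc n. \<Sum>j<Suc n. h i k * h k j * x j)"
      by (intro sum.cong refl) (simp only: sum_distrib_left mult.assoc)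
    also have "\<dots> = (\<Sum>j<Suc n. (\<Sum>k<Suc n. h i k * h k j) * x j)"
      by (subst sum.swap) (simp only: sum_distrib_right)
    also have "\<dots> = (\<Sum>j<Suc n. if j = i then x i else 0)"
      using that by (intro sum.cong refl) (auto simp only: hh lessThan_iff split: if_splits)
    also have "\<dots> = x i" using that by (simp only: sum.delta finite_lessThan lessThan_iff if_True)
    finally show ?thesis .
  qed
  define c where "c = (\<lambda>i j. \<Sum>k<Suc n. h i k * (\<Sum>l<Suc n. a k l * h l j))"
  have c_apply: "(\<Sum>j<Suc n. c i j * x j)
      = (\<Sum>k<Suc n. h i k * (\<Sum>l<Suc n. a k l * (\<Sum>j<Suc n. h l j * x j)))" for i x
  proof -
    have "(\<Sum>j<Suc n. c i j * x j) = (\<Sum>j<Suc n. \<Sum>k<Suc n. h i k * ((\<Sum>l<Suc n. a k l * h l j) * x j))"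
      unfolding c_def by (simp only: sum_distrib_right mult.assoc)
    also have "\<dots> = (\<Sum>k<Suc n. h i k * (\<Sum>j<Suc n. (\<Sum>l<Suc n. a k l * h l j) * x j))"
      by (subst sum.swap) (simp only: sum_distrib_left)
    also have "(\<lambda>k. \<Sum>j<Suc n. (\<Sum>l<Suc n. a k l * h l j) * x j)
        = (\<lambda>k. \<Sum>l<Suc n. a k l * (\<Sum>j<Suc n. h l j * x j))"
      by (rule ext, simp only: sum_distrib_right, subst sum.swap)
        (simp only: sum_distrib_left mult.assoc)
    finally show ?thesis .
  qed
  have c_sym: "c i j = c j i" for i j
  proof -
    have "c i j = (\<Sum>k<Suc n. \<Sum>l<Suc n. h i k * a k l * h l j)"
      unfolding c_def by (simp only: sum_distrib_left mult.assoc)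
    also have "\<dots> = (\<Sum>l<Suc n. \<Sum>k<Suc n. h i k * a k l * h l j)"
      by (rule sum.swap)
    also have "\<dots> = (\<Sum>l<Suc n. \<Sum>k<Suc n. h j l * (a l k * h k i))"
      using Suc.prems hs by (intro sum.cong refl) (auto simp: mult_ac)
    also have "\<dots> = c j i" unfolding c_def by (simp only: sum_distrib_left)
    finally show ?thesis .
  qed
  have c0: "c i 0 = (if i = 0 then e else 0)" if i: "i < Suc n" for i
  proof -
    have "c i 0 = (\<Sum>k<Suc n. h i k * (\<Sum>l<Suc n. a k l * v l))"
      unfolding c_def using h0 by (intro sum.cong refl) simp
    also have "\<dots> = e * (\<Sum>k<Suc n. h i k * h k 0)"
      unfolding sum_distrib_left[of e] by (intro sum.cong refl) (simp only: ev h0 lessThan_iff mult.left_commute)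
    finally show ?thesis using hh[OF i, of 0] by simp
  qed
  define b where "b = (\<lambda>i j. c (Suc i) (Suc j))"
  have "\<exists>u d. (\<forall>k<n. \<forall>l<n. (\<Sum>i<n. u k i * u l i) = (if k = l then 1 else (0::real))) \<and>
    (\<forall>k<n. \<forall>i<n. (\<Sum>j<n. b i j * u k j) = d k * u k i)"
    by (rule Suc.IH) (simp add: b_def c_sym)
  then obtain u d where orth: "\<And>k l. k < n \<Longrightarrow> l < n \<Longrightarrow> (\<Sum>i<n. u k i * u l i) = (if k = l then 1 else (0::real))"
    and eig: "\<And>k i. k < n \<Longrightarrow> i < n \<Longrightarrow> (\<Sum>j<n. b i j * u k j) = d k * u k i"
    by blast
  define x where "x = (\<lambda>k i. case k of 0 \<Rightarrow> (if i = 0 then 1 else 0)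
     | Suc k \<Rightarrow> (case i of 0 \<Rightarrow> 0 | Suc i \<Rightarrow> u k i))"
  define f where "f = (\<lambda>k. case k of 0 \<Rightarrow> e | Suc k \<Rightarrow> d k)"
  define y where "y = (\<lambda>k i. \<Sum>j<Suc n. h i j * x k j)"
  have x_orth: "(\<Sum>i<Suc n. x k i * x l i) = (if k = l then 1 else 0)" if "k < Suc n" "l < Suc n" for k l
    unfolding sum.lessThan_Suc_shift x_def using that orth
    by (auto split: nat.splits)
  have x_eig: "(\<Sum>j<Suc n. c i j * x k j) = f k * x k i" if "k < Suc n" "i < Suc n" for k i
  proof (cases k)
    case 0
    then show ?thesis unfolding sum.lessThan_Suc_shift x_def f_def using that c0
      by (auto split: nat.splits)
  next
    case (Suc k')
    show ?thesis
    proof (cases i)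
      case 0
      have "c 0 (Suc j) = 0" if "j < n" for j using c_sym[of 0 "Suc j"] c0[of "Suc j"] that by simp
      then show ?thesis unfolding sum.lessThan_Suc_shift using that Suc 0
        by (simp add: x_def f_def)
    next
      case (Suc i')
      then show ?thesis unfolding sum.lessThan_Suc_shift using that \<open>k = Suc k'\<close> eig[of k' i']
        by (simp add: x_def f_def b_def)
    qed
  qed
  have y_mult: "y k i * z = (\<Sum>j<Suc n. x k j * (h j i * z))" for k i z
    unfolding y_def sum_distrib_right by (intro sum.cong refl) (simp only: hs[of i] mult_ac)
  have y_orth: "(\<Sum>i<Suc n. y k i * y l i) = (if k = l then 1 else 0)" if kl: "k < Suc n" "l < Suc n" for k l
  proof -
    have "(\<Sum>i<Suc n. y k i * y l i) = (\<Sum>i<Suc n. \<Sum>j<Suc n. x k j * (h j i * y l i))"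
      by (intro sum.cong refl y_mult)
    also have "\<dots> = (\<Sum>j<Suc n. x k j * (\<Sum>i<Suc n. h j i * y l i))"
      by (subst sum.swap) (simp only: sum_distrib_left)
    also have "\<dots> = (\<Sum>j<Suc n. x k j * x l j)"
      unfolding y_def by (intro sum.cong refl) (simp only: hinv lessThan_iff)
    also have "\<dots> = (if k = l then 1 else 0)" by (rule x_orth[OF kl])
    finally show ?thesis .
  qed
  have y_eig: "(\<Sum>j<Suc n. a i j * y k j) = f k * y k i" if k: "k < Suc n" and i: "i < Suc n" for k i
  proof -
    have "(\<Sum>j<Suc n. a i j * y k j)
        = (\<Sum>m<Suc n. h i m * (\<Sum>p<Suc n. h m p * (\<Sum>j<Suc n. a p j * y k j)))"
      by (rule hinv[OF i, symmetric])
    also have "\<dots> = (\<Sum>m<Suc n. h i m * (\<Sum>j<Suc n. c m j * x k j))"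
      by (simp only: y_def c_apply)
    also have "\<dots> = (\<Sum>m<Suc n. h i m * (f k * x k m))"
      using k by (intro sum.cong refl) (simp only: x_eig lessThan_iff)
    also have "\<dots> = f k * y k i"
      unfolding y_def sum_distrib_left by (intro sum.cong refl) (simp only: mult_ac)
    finally show ?thesis .
  qed
  show ?case using y_orth y_eig by blast
qed

section \<open>The spectrum of a gossip matrix\<close>

text \<open>A left inverse of a square matrix is a right inverse.\<close>

lemma orthonormal_rows_imp_columns:
  fixes u :: "nat \<Rightarrow> nat \<Rightarrow> real"
  assumes "\<And>k l. k < n \<Longrightarrow> l < n \<Longrightarrow> (\<Sum>i<n. u k i * u l i) = (if k = l then 1 else 0)"
    and ij: "i < n" "j < n"
  shows "(\<Sum>k<n. u k i * u k j) = (if i = j then 1 else 0)"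
proof -
  define U where "U = mat n n (\<lambda>(k, i). u k i)"
  define V where "V = mat n n (\<lambda>(i, k). u k i)"
  have c: "U \<in> carrier_mat n n" "V \<in> carrier_mat n n" by (auto simp: U_def V_def)
  have "U * V = 1\<^sub>m n"
    by (rule eq_matI) (use assms in \<open>auto simp: U_def V_def scalar_prod_def lessThan_atLeast0\<close>)
  then have "V * U = 1\<^sub>m n" by (rule mat_mult_left_right_inverse[OF c])
  then have "(V * U) $$ (i, j) = 1\<^sub>m n $$ (i, j)" by simp
  then show ?thesis
    using ij by (auto simp: U_def V_def scalar_prod_def lessThan_atLeast0)
qed

lemma proots_char_poly_eigenbasis:
  fixes u :: "nat \<Rightarrow> nat \<Rightarrow> real"
  assumes A: "A \<in> carrier_mat n n"
    and orth: "\<And>k l. k < n \<Longrightarrow> l < n \<Longrightarrow> (\<Sum>i<n. u k i * u l i) = (if k = l then 1 else 0)"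
    and ev: "\<And>k i. k < n \<Longrightarrow> i < n \<Longrightarrow> (\<Sum>j<n. A $$ (i, j) * u k j) = d k * u k i"
  shows "proots (char_poly A) = mset (map d [0..<n])"
proof -
  define U where "U = mat n n (\<lambda>(k, i). u k i)"
  define V where "V = mat n n (\<lambda>(i, k). u k i)"
  define D where "D = mat n n (\<lambda>(i, k). if i = k then d k else 0)"
  have c: "U \<in> carrier_mat n n" "V \<in> carrier_mat n n" "D \<in> carrier_mat n n"
    by (auto simp: U_def V_def D_def)
  have UV: "U * V = 1\<^sub>m n"
    by (rule eq_matI) (use orth in \<open>auto simp: U_def V_def scalar_prod_def lessThan_atLeast0\<close>)
  then have VU: "V * U = 1\<^sub>m n" by (rule mat_mult_left_right_inverse[OF c(1,2)])
  have "A * V = V * D"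
  proof (rule eq_matI)
    fix i k assume "i < dim_row (V * D)" "k < dim_col (V * D)"
    then have ik: "i < n" "k < n" using c by auto
    have "(A * V) $$ (i, k) = (\<Sum>j<n. A $$ (i, j) * u k j)"
      using ik A by (simp add: V_def scalar_prod_def lessThan_atLeast0)
    also have "\<dots> = (\<Sum>j<n. if j = k then u j i * d k else 0)"
      using ik by (simp add: ev)
    also have "\<dots> = (V * D) $$ (i, k)"
      using ik by (auto simp: V_def D_def scalar_prod_def lessThan_atLeast0
          if_distrib[of "\<lambda>y. _ * y"] cong: if_cong)
    finally show "(A * V) $$ (i, k) = (V * D) $$ (i, k)" .
  qed (use A c in auto)
  then have "A * V * U = V * D * U" by simp
  then have "A = V * D * U" using A c VU by simp
  then have "similar_mat A D"
    by (intro similar_matI[of _ _ V U n]) (use A c UV VU in auto)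
  then have "char_poly A = char_poly D" by (rule char_poly_similar)
  also have "\<dots> = (\<Prod>a\<leftarrow>diag_mat D. [:- a, 1:])"
    using c by (intro char_poly_upper_triangular) (auto simp: upper_triangular_def D_def)
  also have "diag_mat D = map d [0..<n]" by (simp add: diag_mat_def D_def)
  finally have "char_poly A = (\<Prod>a\<leftarrow>map d [0..<n]. [:- a, 1:])" .
  moreover have "proots (\<Prod>a\<leftarrow>xs. [:- a, 1:]) = mset xs" for xs :: "real list"
  proof (induction xs)
    case (Cons a xs)
    have "prod_list (map (\<lambda>a. [:- a, 1:]) xs) \<noteq> 0" by (auto simp: prod_list_zero_iff)
    then have "proots ([:- a, 1:] * prod_list (map (\<lambda>a. [:- a, 1:]) xs)) = {#a#} + mset xs"
      by (subst proots_mult) (use Cons in simp_all)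
    then show ?case by simp
  qed simp
  ultimately show ?thesis by (simp only:)
qed

text \<open>Since \<open>0\<close> occurs once among the \<open>d k\<close> and is the least of them, the decreasing list of eigenvalues
  is a list of the positive ones followed by \<open>0\<close>; its entries \<open>1\<close> and \<open>N - 1\<close> are the largest and the
  smallest positive eigenvalue.\<close>

lemma eig_extremal:
  assumes p: "proots (char_poly L) = mset (map d [0..<N])" and N: "2 \<le> N"
    and k0: "k0 < N" "d k0 = 0" and pos: "\<And>k. k < N \<Longrightarrow> k \<noteq> k0 \<Longrightarrow> 0 < d k"
  shows "0 < eig L (N - 1)" "eig L (N - 1) \<le> eig L 1"
    "\<And>k. k < N \<Longrightarrow> k \<noteq> k0 \<Longrightarrow> eig L (N - 1) \<le> d k"
    "\<And>k. k < N \<Longrightarrow> d k \<le> eig L 1"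
proof -
  define xs where "xs = sorted_list_of_multiset (mset (map d [0..<N]))"
  have eig: "eig L k = rev xs ! (k - 1)" for k by (simp add: eig_def p xs_def)
  have mset: "mset xs = mset (map d [0..<N])" by (simp add: xs_def)
  have sorted: "sorted xs" by (simp add: xs_def)
  have len: "length xs = N" using arg_cong[OF mset, of size] by simp
  have set: "set xs = d ` {..<N}" using arg_cong[OF mset, of set_mset] by auto
  obtain x ys where xs: "xs = x # ys" using len N by (cases xs) auto
  have lenys: "length ys = N - 1" using len xs by simp
  have "x = 0"
  proof (rule antisym)
    have "0 \<in> set xs" using set k0 by force
    then show "x \<le> 0" using sorted xs by auto
    have "x \<in> set xs" using xs by simp
    then show "0 \<le> x" using set pos k0 by force
  qed
  have ys: "mset ys = image_mset d (mset_set ({..<N} - {k0}))"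
  proof -
    have "mset [0..<N] = mset_set {..<N}" by (simp add: mset_upt lessThan_atLeast0)
    also have "\<dots> = add_mset k0 (mset_set ({..<N} - {k0}))"
      using k0 by (simp add: mset_set.remove)
    finally have "mset xs = add_mset 0 (image_mset d (mset_set ({..<N} - {k0})))"
      using mset k0 by simp
    then show ?thesis using xs \<open>x = 0\<close> by simp
  qed
  have setys: "set ys = d ` ({..<N} - {k0})"
    using arg_cong[OF ys, of set_mset] by simp
  have sortedys: "sorted ys" using sorted xs by simp
  have rev: "rev xs ! m = ys ! (N - 2 - m)" if "m \<le> N - 2" for m
  proof -
    have "N - Suc m = Suc (N - 2 - m)" using that N by simp
    then show ?thesis using that N len by (simp add: rev_nth xs[symmetric]) (simp add: xs)
  qed
  have e1: "eig L 1 = ys ! (N - 2)" using rev[of 0] by (simp add: eig)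
  have e2: "eig L (N - 1) = ys ! 0"
    using rev[of "N - 2"] N by (simp add: eig numeral_2_eq_2)
  have "ys ! 0 \<in> set ys" using lenys N by (intro nth_mem) simp
  then show "0 < eig L (N - 1)" using setys pos e2 by auto
  show "eig L (N - 1) \<le> eig L 1"
    unfolding e1 e2 using sortedys lenys N by (intro sorted_nth_mono) auto
  have mid: "eig L (N - 1) \<le> d k \<and> d k \<le> eig L 1" if "k < N" "k \<noteq> k0" for k
  proof -
    have "d k \<in> set ys" using setys that by auto
    then obtain m where m: "m < length ys" "ys ! m = d k" by (auto simp: in_set_conv_nth)
    have "ys ! 0 \<le> ys ! m" using sortedys m by (intro sorted_nth_mono) auto
    moreover have "ys ! m \<le> ys ! (N - 2)" using sortedys m lenys by (intro sorted_nth_mono) auto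
    ultimately show ?thesis using e1 e2 m by simp
  qed
  then show "\<And>k. k < N \<Longrightarrow> k \<noteq> k0 \<Longrightarrow> eig L (N - 1) \<le> d k" by blast
  show "d k \<le> eig L 1" if "k < N" for k
  proof (cases "k = k0")
    case True
    then show ?thesis using k0 \<open>0 < eig L (N - 1)\<close> \<open>eig L (N - 1) \<le> eig L 1\<close> by simp
  qed (use mid that in auto)
qed

text \<open>The mode \<open>k0\<close> is the consensus direction. It exists because the kernel contains the constant
  vectors, and it is unique because two constant vectors are never orthogonal.\<close>

lemma gossip_spectrum:
  assumes g: "gossip_matrix N E L" and N: "2 \<le> N"
  obtains u d k0 where
    "\<And>k l. k < N \<Longrightarrow> l < N \<Longrightarrow> (\<Sum>i<N. u k i * u l i) = (if k = l then 1 else (0::real))"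
    "\<And>i j. i < N \<Longrightarrow> j < N \<Longrightarrow> (\<Sum>k<N. u k i * u k j) = (if i = j then 1 else 0)"
    "\<And>k i. k < N \<Longrightarrow> i < N \<Longrightarrow> (\<Sum>j<N. L $$ (i, j) * u k j) = d k * u k i"
    "k0 < N" "d k0 = 0" "\<And>i. i < N \<Longrightarrow> u k0 i = u k0 0"
    "\<And>k. k < N \<Longrightarrow> k \<noteq> k0 \<Longrightarrow> eig L (N - 1) \<le> d k \<and> d k \<le> eig L 1"
    "0 < eig L (N - 1)" "eig L (N - 1) \<le> eig L 1"
proof -
  from g have L: "L \<in> carrier_mat N N" and sym: "transpose_mat L = L"
    and psd: "\<And>v. v \<in> carrier_vec N \<Longrightarrow> 0 \<le> scalar_prod v (L *\<^sub>v v)"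
    and ker: "mat_kernel L = range (\<lambda>c. vec N (\<lambda>_. c))"
    by (auto simp: gossip_matrix_def)
  have syme: "L $$ (i, j) = L $$ (j, i)" if "i < N" "j < N" for i j
    using arg_cong[OF sym, of "\<lambda>A. A $$ (i, j)"] that L by simp
  have L_apply: "(L *\<^sub>v vec N x) $ i = (\<Sum>j<N. L $$ (i, j) * x j)" if "i < N" for x i
    using that L by (simp add: scalar_prod_def lessThan_atLeast0)
  obtain u d where
    orth: "\<And>k l. k < N \<Longrightarrow> l < N \<Longrightarrow> (\<Sum>i<N. u k i * u l i) = (if k = l then 1 else (0::real))"
    and ev: "\<And>k i. k < N \<Longrightarrow> i < N \<Longrightarrow> (\<Sum>j<N. L $$ (i, j) * u k j) = d k * u k i"
    using symmetric_orthonormal_eigenbasis[of N "\<lambda>i j. L $$ (i, j)"] syme by blast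
  have cols: "(\<Sum>k<N. u k i * u k j) = (if i = j then 1 else 0)" if "i < N" "j < N" for i j
    by (rule orthonormal_rows_imp_columns[OF orth that])
  have nonneg: "0 \<le> d k" if k: "k < N" for k
  proof -
    have "scalar_prod (vec N (u k)) (L *\<^sub>v vec N (u k)) = (\<Sum>i<N. u k i * (d k * u k i))"
      unfolding scalar_prod_def[of "vec N (u k)" "L *\<^sub>v vec N (u k)"] using L k
      by (intro sum.cong) (auto simp: L_apply ev simp del: index_mult_mat_vec)
    also have "\<dots> = d k * (\<Sum>i<N. u k i * u k i)" by (simp add: sum_distrib_left mult_ac)
    also have "\<dots> = d k" using orth[OF k k] by simp
    finally show ?thesis using psd[of "vec N (u k)"] by simp
  qed
  have const: "u k i = u k 0" if k: "k < N" "d k = 0" and i: "i < N" for k i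
  proof -
    have "L *\<^sub>v vec N (u k) = 0\<^sub>v N"
      using L k by (intro eq_vecI) (simp_all add: L_apply ev del: index_mult_mat_vec)
    then have "vec N (u k) \<in> mat_kernel L" using L by (intro mat_kernelI) auto
    then obtain c where "vec N (u k) = vec N (\<lambda>_. c)" using ker by auto
    then have "vec N (u k) $ i = c" "vec N (u k) $ 0 = c" using i by auto
    then show ?thesis using i by simp
  qed
  have "\<exists>k<N. d k = 0"
  proof (rule ccontr)
    assume *: "\<not> ?thesis"
    have "vec N (\<lambda>_. 1) \<in> mat_kernel L" using ker by auto
    then have "L *\<^sub>v vec N (\<lambda>_. 1) = 0\<^sub>v N" using mat_kernelD[OF L] by auto
    then have L1: "(\<Sum>j<N. L $$ (i, j)) = 0" if "i < N" for i
      using L_apply[OF that, of "\<lambda>_. 1"] that by simp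
    have "(\<Sum>i<N. u k i) = 0" if k: "k < N" for k
    proof -
      have "d k * (\<Sum>i<N. u k i) = (\<Sum>i<N. \<Sum>j<N. L $$ (i, j) * u k j)"
        by (simp add: sum_distrib_left ev k)
      also have "\<dots> = (\<Sum>j<N. (\<Sum>i<N. L $$ (j, i)) * u k j)"
        by (subst sum.swap) (auto simp: sum_distrib_right syme intro!: sum.cong)
      also have "\<dots> = 0" by (simp add: L1)
      finally show ?thesis using * k by auto
    qed
    then have "0 = (\<Sum>k<N. u k 0 * (\<Sum>j<N. u k j))" by simp
    also have "\<dots> = (\<Sum>j<N. \<Sum>k<N. u k 0 * u k j)"
      unfolding sum_distrib_left by (rule sum.swap)
    also have "\<dots> = 1" using N by (simp add: cols)
    finally show False by simp
  qed
  then obtain k0 where k0: "k0 < N" "d k0 = 0" by blast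
  have pos: "0 < d k" if k: "k < N" "k \<noteq> k0" for k
  proof (rule ccontr)
    assume "\<not> 0 < d k"
    then have "d k = 0" using nonneg[OF k(1)] by simp
    then obtain c where c: "\<And>i. i < N \<Longrightarrow> u k i = c" using const[OF k(1)] by blast
    obtain c' where c': "\<And>i. i < N \<Longrightarrow> u k0 i = c'" using const[OF k0] by blast
    have "0 = real N * (c * c')" using orth[OF k(1) k0(1)] k by (simp add: c c')
    moreover have "1 = real N * (c * c)" using orth[OF k(1) k(1)] by (simp add: c)
    moreover have "1 = real N * (c' * c')" using orth[OF k0(1) k0(1)] by (simp add: c')
    ultimately show False using N by auto
  qed
  have p: "proots (char_poly L) = mset (map d [0..<N])"
    using L orth ev by (rule proots_char_poly_eigenbasis)
  have bnd: "eig L (N - 1) \<le> d k \<and> d k \<le> eig L 1" if "k < N" "k \<noteq> k0" for k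
    using eig_extremal(3,4)[OF p N k0] pos that by blast
  have extr: "0 < eig L (N - 1)" "eig L (N - 1) \<le> eig L 1"
    using eig_extremal(1,2)[OF p N k0] pos by blast+
  have const0: "u k0 i = u k0 0" if "i < N" for i by (rule const[OF k0 that])
  show thesis
    by (rule that[of u d k0]) (fact orth cols ev k0 const0 bnd extr)+
qed

section \<open>The accelerated recursion in one eigenmode\<close>

text \<open>The residual of the two-step iteration in a mode where plain gossip contracts by the factor \<open>a\<close>:
  for an input that is constantly \<open>1\<close>, it is the value of the local output at time \<open>t\<close> in that mode.
  The second value is what the initialization of SDA produces.\<close>

fun mode_residual :: "real \<Rightarrow> real \<Rightarrow> nat \<Rightarrow> real" where
  "mode_residual a \<zeta> 0 = 1"
| "mode_residual a \<zeta> (Suc 0) = a * (1 + \<zeta>) - \<zeta>"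
| "mode_residual a \<zeta> (Suc (Suc t)) =
     a * (1 + \<zeta>) * mode_residual a \<zeta> (Suc t) - a * \<zeta> * mode_residual a \<zeta> t"

lemma mode_residual_consensus: "mode_residual 1 \<zeta> t = 1"
  by (induction "1::real" \<zeta> t rule: mode_residual.induct) auto

text \<open>The characteristic polynomial is \<open>X\<^sup>2 - 2 q X + m\<close> with \<open>m = a \<zeta>\<close>. The upper bound on \<open>a\<close>
  gives \<open>q\<^sup>2 \<le> m\<close>, so both roots have modulus \<open>R = sqrt m\<close>, and \<open>R \<le> 1 - 1 / s\<close>. Instead of
  trigonometric functions, which degenerate at a double root, the proof uses the rotation
  invariant \<open>p\<^sup>2 + (m - q\<^sup>2) g\<^sup>2\<close> of two solutions \<open>p\<close> and \<open>g\<close>, the analogues of the Chebyshev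
  polynomials of the first and the second kind. The residual is \<open>p + (q - \<zeta>) g\<close>. The solution \<open>g\<close> grows
  like \<open>t R\<^sup>t\<close>, so \<open>\<bar>q - \<zeta>\<bar>\<close> has to be of order \<open>1 / s\<close>, or else \<open>R\<close> must be so much smaller than
  \<open>1 - 1 / s\<close> that the factor \<open>t\<close> is harmless.\<close>

lemma mode_residual_bound:
  assumes s: "1 \<le> s" and z: "\<zeta> = (s - 1) / (s + 1)" and a: "0 \<le> a" "a \<le> 1 - 1 / s\<^sup>2"
  shows "\<bar>mode_residual a \<zeta> t\<bar> \<le> (3 + real t / (s + 1)) * (1 - 1 / s) ^ t"
proof -
  define m where "m = a * \<zeta>"
  define q where "q = a * (1 + \<zeta>) / 2"
  define R where "R = sqrt m"
  define \<rho> where "\<rho> = 1 - 1 / s"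
  have z0: "0 \<le> \<zeta>" using s z by simp
  have s2: "s\<^sup>2 - 1 = (s - 1) * (s + 1)" by (simp add: power2_eq_square algebra_simps)
  have as: "a * s\<^sup>2 \<le> s\<^sup>2 - 1" using a(2) \<open>1 \<le> s\<close> by (simp add: field_simps)
  have sp: "0 < s" "s + 1 \<noteq> 0" "0 < s\<^sup>2" using s by auto
  then have "1 + \<zeta> = 2 * s / (s + 1)" unfolding z by (simp add: field_simps)
  then have "q = a * (2 * s / (s + 1)) / 2" by (simp only: q_def)
  then have q_eq: "q = a * s / (s + 1)" using sp by (simp add: field_simps)
  have q0: "0 \<le> q" using a s by (simp add: q_eq)
  have m0: "0 \<le> m" using a z0 by (simp add: m_def)
  have "q\<^sup>2 = a * (a * s\<^sup>2) / (s + 1)\<^sup>2"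
    by (simp add: q_eq power2_eq_square)
  also have "\<dots> \<le> a * (s\<^sup>2 - 1) / (s + 1)\<^sup>2"
    by (intro divide_right_mono mult_left_mono as a) simp
  also have "\<dots> = m"
    unfolding s2 m_def z using sp by (simp add: power2_eq_square)
  finally have qm: "q\<^sup>2 \<le> m" .
  have "m * s\<^sup>2 = \<zeta> * (a * s\<^sup>2)" by (simp add: m_def)
  also have "\<dots> \<le> \<zeta> * (s\<^sup>2 - 1)" by (intro mult_left_mono as z0)
  also have "\<dots> = (s - 1)\<^sup>2" unfolding s2 z using sp by (simp add: power2_eq_square)
  finally have "m \<le> (s - 1)\<^sup>2 / s\<^sup>2" using sp by (simp only: pos_le_divide_eq)
  also have "\<dots> = \<rho>\<^sup>2" unfolding power_divide[symmetric] \<rho>_def using sp by (simp add: diff_divide_distrib)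
  finally have m_rho: "m \<le> \<rho>\<^sup>2" .
  have rho: "0 \<le> \<rho>" using s by (simp add: \<rho>_def)
  have R: "0 \<le> R" "R\<^sup>2 = m" "R \<le> \<rho>"
    using m0 m_rho rho by (auto simp: R_def intro: real_le_lsqrt)
  have qR: "q \<le> R" using qm by (simp add: R_def real_le_rsqrt)
  define pg where "pg = rec_nat (1, 0) (\<lambda>_ x. (q * fst x - (m - q\<^sup>2) * snd x, fst x + q * snd x))"
  define p where "p = (\<lambda>t. fst (pg t))"
  define g where "g = (\<lambda>t. snd (pg t))"
  have rec: "p 0 = 1" "g 0 = 0" "p (Suc t) = q * p t - (m - q\<^sup>2) * g t" "g (Suc t) = p t + q * g t" for t
    by (simp_all add: p_def g_def pg_def)
  have res: "mode_residual a \<zeta> t = p t + (q - \<zeta>) * g t" for t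
  proof (induction t rule: induct_nat_012)
    case 1
    then show ?case by (simp add: rec q_def)
  next
    case (ge2 t)
    have "2 * q = a * (1 + \<zeta>)" by (simp add: q_def)
    then have "mode_residual a \<zeta> (Suc (Suc t))
        = 2 * q * (p (Suc t) + (q - \<zeta>) * g (Suc t)) - m * (p t + (q - \<zeta>) * g t)"
      using ge2 by (simp add: m_def)
    also have "\<dots> = p (Suc (Suc t)) + (q - \<zeta>) * g (Suc (Suc t))"
      by (simp add: rec algebra_simps power2_eq_square)
    finally show ?case .
  qed (simp add: rec)
  have inv: "(p t)\<^sup>2 + (m - q\<^sup>2) * (g t)\<^sup>2 = m ^ t" for t
  proof (induction t)
    case (Suc t)
    have "(p (Suc t))\<^sup>2 + (m - q\<^sup>2) * (g (Suc t))\<^sup>2 = m * ((p t)\<^sup>2 + (m - q\<^sup>2) * (g t)\<^sup>2)"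
      by (simp add: rec algebra_simps power2_eq_square)
    then show ?case by (simp add: Suc)
  qed (simp add: rec)
  have pR: "\<bar>p t\<bar> \<le> R ^ t" for t
  proof -
    have "0 \<le> (m - q\<^sup>2) * (g t)\<^sup>2" using qm by simp
    then have "(p t)\<^sup>2 \<le> m ^ t" using inv[of t] by linarith
    also have "m ^ t = (R ^ t)\<^sup>2" unfolding R(2)[symmetric] by (simp only: power_mult[symmetric] mult.commute)
    finally have "(p t)\<^sup>2 \<le> (R ^ t)\<^sup>2" .
    then show ?thesis using power2_le_iff_abs_le[of "R ^ t" "p t"] zero_le_power[OF R(1), of t] by blast
  qed
  have gR: "\<bar>g (Suc t)\<bar> \<le> real (Suc t) * R ^ t" for t
  proof (induction t)
    case (Suc t)
    have "\<bar>g (Suc (Suc t))\<bar> \<le> \<bar>p (Suc t)\<bar> + q * \<bar>g (Suc t)\<bar>"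
      using q0 by (simp add: rec(4)[of "Suc t"] abs_mult order.trans[OF abs_triangle_ineq])
    also have "\<dots> \<le> R ^ Suc t + R * (real (Suc t) * R ^ t)"
      using Suc qR q0 R(1) by (intro add_mono pR mult_mono) auto
    finally show ?case by (simp add: algebra_simps)
  qed (simp add: rec)
  show ?thesis
  proof (cases t)
    case 0
    then show ?thesis by simp
  next
    case (Suc k)
    have "\<bar>mode_residual a \<zeta> t\<bar> \<le> \<bar>p t\<bar> + \<bar>q - \<zeta>\<bar> * \<bar>g t\<bar>"
      by (simp add: res abs_mult order.trans[OF abs_triangle_ineq])
    also have "\<dots> \<le> \<rho> ^ t + \<bar>q - \<zeta>\<bar> * (real t * R ^ k)"
      using gR[of k] Suc R by (intro add_mono mult_left_mono order.trans[OF pR] power_mono) auto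
    also have "\<bar>q - \<zeta>\<bar> * (real t * R ^ k) \<le> (2 + real t / (s + 1)) * \<rho> ^ t"
    \<comment> \<open>Only for \<open>a\<close> near its maximum is \<open>q - \<zeta>\<close> nonnegative, and then it is of order \<open>1 / s\<close>.\<close>
    proof (cases "q \<ge> \<zeta>")
      case True
      have "a * s \<le> s - 1 / s" using as s by (simp add: field_simps power2_eq_square)
      then have "q - \<zeta> \<le> \<rho> / (s + 1)"
        using s by (simp add: q_eq z \<rho>_def diff_divide_distrib[symmetric] divide_right_mono)
      then have "\<bar>q - \<zeta>\<bar> * (real t * R ^ k) \<le> \<rho> / (s + 1) * (real t * \<rho> ^ k)"
        using True R rho s by (intro mult_mono power_mono) auto
      also have "\<dots> = real t / (s + 1) * \<rho> ^ t" using Suc by simp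
      also have "\<dots> \<le> (2 + real t / (s + 1)) * \<rho> ^ t"
        using rho by (intro mult_right_mono) auto
      finally show ?thesis .
    next
      case False
      then have "0 < \<zeta>" using q0 by simp
      then have s1: "1 < s" using z s by (cases "s = 1") auto
      then have rho0: "0 < \<rho>" by (simp add: \<rho>_def)
      \<comment> \<open>Here \<open>a\<close> is small and \<open>\<zeta> - q\<close> is not of order \<open>1 / s\<close>, but it is at most \<open>2 \<zeta> (1 - D)\<close>; the factor \<open>1 - D\<close> compensates \<open>t D\<^sup>t\<close>.\<close>
      define D where "D = R / \<rho>"
      have D: "0 \<le> D" "D \<le> 1" "R = D * \<rho>" using R rho0 by (auto simp: D_def)
      have "\<zeta> * D\<^sup>2 = \<zeta> * m / \<rho>\<^sup>2" by (simp add: D_def power_divide R)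
      also have "\<dots> = a * s\<^sup>2 / (s + 1)\<^sup>2"
      proof -
        have "s - 1 = \<rho> * s" using s1 by (simp add: \<rho>_def left_diff_distrib)
        then have "\<zeta> = \<rho> * (s / (s + 1))" by (simp add: z)
        then show ?thesis using rho0 by (simp add: m_def power2_eq_square)
      qed
      also have "\<dots> = q * (s / (s + 1))" by (simp add: q_eq power2_eq_square)
      also have "\<dots> \<le> q * 1" using q0 s by (intro mult_left_mono) auto
      finally have "\<zeta> - q \<le> \<zeta> * (1 - D\<^sup>2)" by (simp add: algebra_simps)
      also have "1 - D\<^sup>2 = (1 - D) * (1 + D)" by (simp add: power2_eq_square algebra_simps)
      also have "\<zeta> * ((1 - D) * (1 + D)) \<le> \<zeta> * ((1 - D) * 2)"
        using z0 D by (intro mult_left_mono) auto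
      finally have qz: "\<bar>q - \<zeta>\<bar> \<le> 2 * \<zeta> * (1 - D)" using False by (simp add: algebra_simps)
      have "real t * D ^ k = (\<Sum>i<t. D ^ k)" by simp
      also have "\<dots> \<le> (\<Sum>i<t. D ^ i)"
        using D Suc by (intro sum_mono power_decreasing) auto
      finally have "(1 - D) * (real t * D ^ k) \<le> (1 - D) * (\<Sum>i<t. D ^ i)"
        using D by (intro mult_left_mono) auto
      also have "\<dots> = 1 - D ^ t" by (simp add: one_diff_power_eq)
      also have "\<dots> \<le> 1" using D by simp
      finally have le1: "(1 - D) * (real t * D ^ k) \<le> 1" .
      have "\<bar>q - \<zeta>\<bar> * (real t * R ^ k) \<le> 2 * \<zeta> * (1 - D) * (real t * R ^ k)"
        using R by (intro mult_right_mono qz) auto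
      also have "\<dots> = 2 * \<zeta> * \<rho> ^ k * ((1 - D) * (real t * D ^ k))"
        by (simp add: D(3) power_mult_distrib)
      also have "\<dots> \<le> 2 * \<zeta> * \<rho> ^ k * 1" using le1 z0 rho by (intro mult_left_mono) auto
      also have "\<dots> \<le> 2 * \<rho> * \<rho> ^ k"
      proof -
        have "\<rho> = (s - 1) / s" using sp by (simp add: \<rho>_def diff_divide_distrib)
        then have "\<zeta> \<le> \<rho>" unfolding z using s by (auto intro: divide_left_mono)
        then show ?thesis using rho by (simp add: mult_right_mono)
      qed
      also have "\<dots> = 2 * \<rho> ^ t" using Suc by simp
      also have "\<dots> \<le> (2 + real t / (s + 1)) * \<rho> ^ t"
        using rho s by (intro mult_right_mono) auto
      finally show ?thesis .
    qed
    finally show ?thesis by (simp add: \<rho>_def algebra_simps)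
  qed
qed

lemma sum_exp_le: "0 < c \<Longrightarrow> (\<Sum>t<n. exp (- c * real t)) \<le> 1 + 1 / c"
proof -
  assume c: "0 < c"
  have lt: "exp (- c) < 1" using c by simp
  have "(\<Sum>t<n. exp (- c * real t)) = (\<Sum>t<n. exp (- c) ^ t)"
    by (simp add: exp_of_nat_mult[symmetric] mult.commute)
  also have "\<dots> = (1 - exp (- c) ^ n) / (1 - exp (- c))"
    using lt by (simp add: one_diff_power_eq)
  also have "\<dots> \<le> 1 / (1 - exp (- c))"
    using lt by (intro divide_right_mono) auto
  also have "\<dots> \<le> 1 + 1 / c"
  proof -
    have "(1 + c) * exp (- c) \<le> exp c * exp (- c)"
      by (intro mult_right_mono) (auto simp: exp_ge_add_one_self)
    then have "(1 + c) * exp (- c) \<le> 1" by (simp add: exp_minus)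
    then show ?thesis using lt c by (simp add: field_simps)
  qed
  finally show ?thesis .
qed

lemma one_minus_inverse_power_le_exp:
  assumes "1 \<le> (s::real)"
  shows "(1 - 1 / s) ^ t \<le> exp (- (real t / s))"
proof -
  have "(1 - 1 / s) ^ t \<le> exp (- (1 / s)) ^ t"
    using assms exp_ge_add_one_self[of "- (1 / s)"] by (intro power_mono) auto
  also have "\<dots> = exp (- (real t / s))" by (simp add: exp_of_nat_mult[symmetric])
  finally show ?thesis .
qed

text \<open>The linear factor of the residual costs a third of the exponential rate: the residual is at most
  \<open>3 * exp (- 2 * t / (3 * s))\<close>, and the squares form a geometric series.\<close>

lemma sum_mode_residual_square_le:
  assumes s: "1 \<le> s" and z: "\<zeta> = (s - 1) / (s + 1)" and a: "0 \<le> a" "a \<le> 1 - 1 / s\<^sup>2"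
  shows "(\<Sum>t<n. (mode_residual a \<zeta> t)\<^sup>2) \<le> 16 * s"
proof -
  have "(mode_residual a \<zeta> t)\<^sup>2 \<le> 9 * exp (- (4 / (3 * s)) * real t)" for t
  proof -
    have "3 + real t / (s + 1) \<le> 3 * (1 + real t / (3 * s))"
      using s by (auto simp: field_simps)
    also have "\<dots> \<le> 3 * exp (real t / (3 * s))"
      by (intro mult_left_mono) (auto simp: exp_ge_add_one_self)
    finally have "(3 + real t / (s + 1)) * (1 - 1 / s) ^ t \<le> 3 * exp (real t / (3 * s)) * exp (- (real t / s))"
      using s by (intro mult_mono one_minus_inverse_power_le_exp) auto
    also have "\<dots> = 3 * exp (- (2 * real t / (3 * s)))"
      using s by (simp add: mult_exp_exp field_simps)
    finally have "\<bar>mode_residual a \<zeta> t\<bar> \<le> 3 * exp (- (2 * real t / (3 * s)))"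
      using mode_residual_bound[OF s z a, of t] by linarith
    then have "\<bar>mode_residual a \<zeta> t\<bar>\<^sup>2 \<le> (3 * exp (- (2 * real t / (3 * s))))\<^sup>2"
      by (intro power_mono) auto
    also have "\<dots> = 9 * exp (- (4 / (3 * s)) * real t)"
      by (simp add: power2_eq_square mult_exp_exp field_simps)
    finally show ?thesis by simp
  qed
  then have "(\<Sum>t<n. (mode_residual a \<zeta> t)\<^sup>2) \<le> 9 * (\<Sum>t<n. exp (- (4 / (3 * s)) * real t))"
    unfolding sum_distrib_left by (intro sum_mono)
  also have "\<dots> \<le> 9 * (1 + 1 / (4 / (3 * s)))"
    using s by (intro mult_left_mono sum_exp_le) auto
  also have "\<dots> \<le> 16 * s" using s by simp
  finally show ?thesis .
qed

text \<open>Once \<open>exp (- n / s)\<close> is taken out, a term is at most a constant plus \<open>n / s\<close> times a geometric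
  weight, and the weights have a sum of order \<open>s\<close>.\<close>

lemma sum_late_mode_residual_le:
  assumes s: "1 \<le> s" and z: "\<zeta> = (s - 1) / (s + 1)" and a: "0 \<le> a" "a \<le> 1 - 1 / s\<^sup>2"
  shows "(\<Sum>t = n..<2 * n. \<bar>mode_residual a \<zeta> t\<bar>) \<le> 6 * real n * exp (- (real n / s))"
proof -
  have "(\<Sum>t = n..<2 * n. \<bar>mode_residual a \<zeta> t\<bar>) = (\<Sum>u<n. \<bar>mode_residual a \<zeta> (u + n)\<bar>)"
    using sum.shift_bounds_nat_ivl[of "\<lambda>t. \<bar>mode_residual a \<zeta> t\<bar>" 0 n n]
    by (simp add: lessThan_atLeast0 mult_2)
  also have "\<dots> \<le> (\<Sum>u<n. exp (- (real n / s)) * (4 + real n / s * exp (- (1 / s) * real u)))"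
  proof (intro sum_mono)
    fix u
    define E where "E = exp (- (1 / s) * real u)"
    have E: "0 \<le> E" "E \<le> 1" "real u / s * E \<le> 1"
    proof -
      show "0 \<le> E" by (simp add: E_def)
      show "E \<le> 1" using s by (simp add: E_def)
      have "real u / s \<le> exp (real u / s)" using exp_ge_add_one_self[of "real u / s"] by linarith
      then have "real u / s * E \<le> exp (real u / s) * E" by (intro mult_right_mono) (auto simp: E_def)
      also have "\<dots> = 1" by (simp add: E_def mult_exp_exp)
      finally show "real u / s * E \<le> 1" .
    qed
    have "\<bar>mode_residual a \<zeta> (u + n)\<bar> \<le> (3 + real (u + n) / (s + 1)) * (1 - 1 / s) ^ (u + n)"
      by (rule mode_residual_bound[OF s z a])
    also have "\<dots> \<le> (3 + real (u + n) / s) * exp (- (real (u + n) / s))"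
      using s by (intro mult_mono one_minus_inverse_power_le_exp add_left_mono divide_left_mono) auto
    also have "exp (- (real (u + n) / s)) = exp (- (real n / s)) * E"
      by (simp add: E_def mult_exp_exp add_divide_distrib)
    also have "(3 + real (u + n) / s) * (exp (- (real n / s)) * E)
        = exp (- (real n / s)) * (3 * E + real u / s * E + real n / s * E)"
      by (simp add: algebra_simps add_divide_distrib)
    also have "\<dots> \<le> exp (- (real n / s)) * (4 + real n / s * E)"
      using E by (intro mult_left_mono) auto
    finally show "\<bar>mode_residual a \<zeta> (u + n)\<bar>
        \<le> exp (- (real n / s)) * (4 + real n / s * exp (- (1 / s) * real u))" by (simp add: E_def)
  qed
  also have "\<dots> = exp (- (real n / s)) * (4 * real n + real n / s * (\<Sum>u<n. exp (- (1 / s) * real u)))"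
    unfolding sum_distrib_left[symmetric] sum.distrib by simp
  also have "\<dots> \<le> exp (- (real n / s)) * (4 * real n + real n / s * (1 + 1 / (1 / s)))"
    using s by (intro mult_left_mono add_left_mono sum_exp_le) auto
  also have "\<dots> \<le> exp (- (real n / s)) * (4 * real n + 2 * real n)"
  proof -
    have "real n / s * (1 + s) \<le> 2 * real n"
      using s mult_left_mono[OF s, of "real n"] by (simp add: field_simps)
    then show ?thesis by (intro mult_left_mono) auto
  qed
  finally show ?thesis by (simp add: algebra_simps)
qed

text \<open>The sum of the first \<open>t\<close> local outputs of a mode, as a function of the inputs \<open>R\<close> of that mode.\<close>

definition response :: "real \<Rightarrow> real \<Rightarrow> (nat \<Rightarrow> real) \<Rightarrow> nat \<Rightarrow> real" where
  "response a \<zeta> R t = (\<Sum>s<t. mode_residual a \<zeta> (t - 1 - s) * R s)"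

lemma response_0: "response a \<zeta> R 0 = 0" by (simp add: response_def)

lemma response_1: "response a \<zeta> R (Suc 0) = R 0" by (simp add: response_def)

lemma response_Suc_Suc:
  "response a \<zeta> R (Suc (Suc t))
     = R (Suc t) - \<zeta> * R t + a * (1 + \<zeta>) * response a \<zeta> R (Suc t) - a * \<zeta> * response a \<zeta> R t"
proof -
  define e where "e = mode_residual a \<zeta>"
  have "(\<Sum>s<t. e (Suc t - s) * R s)
      = (\<Sum>s<t. a * (1 + \<zeta>) * (e (t - s) * R s) - a * \<zeta> * (e (t - 1 - s) * R s))"
  proof (intro sum.cong refl)
    fix s assume "s \<in> {..<t}"
    then obtain k where k: "t = s + Suc k" by (auto simp: less_iff_Suc_add)
    have "Suc t - s = Suc (Suc k)" "t - s = Suc k" "t - 1 - s = k" using k by auto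
    then show "e (Suc t - s) * R s = a * (1 + \<zeta>) * (e (t - s) * R s) - a * \<zeta> * (e (t - 1 - s) * R s)"
      by (simp add: e_def algebra_simps)
  qed
  also have "\<dots> = a * (1 + \<zeta>) * (\<Sum>s<t. e (t - s) * R s) - a * \<zeta> * (\<Sum>s<t. e (t - 1 - s) * R s)"
    by (simp only: sum_subtractf sum_distrib_left)
  finally show ?thesis
    by (simp add: response_def e_def[symmetric]) (simp add: e_def algebra_simps)
qed

section \<open>SDA in the eigenbasis of the gossip matrix\<close>

text \<open>Projecting the iteration on an eigenvector \<open>u\<close> closes it, because \<open>L\<close> is symmetric and acts as \<open>d\<close>
  on \<open>u\<close>. The local outputs are then the increments of \<^const>\<open>response\<close>.\<close>

lemma sda_mode:
  assumes g: "gossip_matrix N E L" and G: "simple_connected_graph N E"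
    and ev: "\<And>i. i < N \<Longrightarrow> (\<Sum>j<N. L $$ (i, j) * u j) = d * u i"
  shows "(\<Sum>i<N. u i * sda_theta E L \<eta> \<zeta> R t i j)
      = response (1 - \<eta> * d) \<zeta> (\<lambda>t. \<Sum>i<N. u i * R i t j) (Suc t)
        - response (1 - \<eta> * d) \<zeta> (\<lambda>t. \<Sum>i<N. u i * R i t j) t"
proof -
  from g have L: "L \<in> carrier_mat N N" and sym: "transpose_mat L = L"
    and supp: "\<And>i j. i < N \<Longrightarrow> j < N \<Longrightarrow> L $$ (i, j) \<noteq> 0 \<Longrightarrow> i = j \<or> (i, j) \<in> E"
    by (auto simp: gossip_matrix_def)
  have E: "E \<subseteq> {..<N} \<times> {..<N}" using G by (simp add: simple_connected_graph_def)
  have syme: "L $$ (i, j) = L $$ (j, i)" if "i < N" "j < N" for i j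
    using arg_cong[OF sym, of "\<lambda>A. A $$ (i, j)"] that L by simp
  define a where "a = 1 - \<eta> * d"
  define Rm where "Rm = (\<lambda>t. \<Sum>i<N. u i * R i t j)"
  define S where "S = response a \<zeta> Rm"
  define x where "x = (\<lambda>t i. fst (sda_state E L \<eta> \<zeta> R t i j))"
  define y where "y = (\<lambda>t i. snd (sda_state E L \<eta> \<zeta> R t i j))"
  define X where "X = (\<lambda>t. \<Sum>i<N. u i * x t i)"
  define Y where "Y = (\<lambda>t. \<Sum>i<N. u i * y t i)"
  have nbh: "(\<Sum>k\<in>E `` {i} \<union> {i}. L $$ (i, k) * f k) = (\<Sum>k<N. L $$ (i, k) * f k)"
    if i: "i < N" for i f
  proof (rule sum.mono_neutral_left)
    show "E `` {i} \<union> {i} \<subseteq> {..<N}" using i E by blast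
    show "\<forall>k\<in>{..<N} - (E `` {i} \<union> {i}). L $$ (i, k) * f k = 0" using i supp[OF i] by fastforce
  qed simp
  have mix: "(\<Sum>i<N. u i * (\<Sum>k\<in>E `` {i} \<union> {i}. L $$ (i, k) * f k)) = d * (\<Sum>k<N. u k * f k)" for f
  proof -
    have "(\<Sum>i<N. u i * (\<Sum>k\<in>E `` {i} \<union> {i}. L $$ (i, k) * f k))
        = (\<Sum>i<N. \<Sum>k<N. L $$ (k, i) * u i * f k)"
    proof (intro sum.cong refl)
      fix i assume "i \<in> {..<N}"
      then show "u i * (\<Sum>k\<in>E `` {i} \<union> {i}. L $$ (i, k) * f k) = (\<Sum>k<N. L $$ (k, i) * u i * f k)"
        by (subst nbh) (auto simp: sum_distrib_left syme[of i] intro!: sum.cong)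
    qed
    also have "\<dots> = (\<Sum>k<N. (\<Sum>i<N. L $$ (k, i) * u i) * f k)"
      by (subst sum.swap) (simp only: sum_distrib_right)
    also have "\<dots> = (\<Sum>k<N. d * (u k * f k))" by (intro sum.cong refl) (simp add: ev)
    finally show ?thesis by (simp only: sum_distrib_left)
  qed
  have y_step: "y (Suc t) i = x t i - \<eta> * (\<Sum>k\<in>E `` {i} \<union> {i}. L $$ (i, k) * (x t k + R k t j))" for t i
    by (simp add: x_def y_def Let_def)
  have x_step: "x (Suc t) i = y (Suc t) i + \<zeta> * (y (Suc t) i - y t i)" for t i
    by (simp add: x_def y_def Let_def)
  have linear: "(\<Sum>i<N. u i * (f i - \<eta> * g i)) = (\<Sum>i<N. u i * f i) - \<eta> * (\<Sum>i<N. u i * g i)" for f g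
    by (simp add: algebra_simps sum_subtractf sum_distrib_left)
  have momentum: "(\<Sum>i<N. u i * (f i + \<zeta> * (f i - g i)))
      = (\<Sum>i<N. u i * f i) + \<zeta> * ((\<Sum>i<N. u i * f i) - (\<Sum>i<N. u i * g i))" for f g
    by (simp add: algebra_simps sum_subtractf sum.distrib sum_distrib_left)
  have Y_step: "Y (Suc t) = a * X t - (1 - a) * Rm t" for t
  proof -
    have "Y (Suc t) = X t - \<eta> * (\<Sum>i<N. u i * (\<Sum>k\<in>E `` {i} \<union> {i}. L $$ (i, k) * (x t k + R k t j)))"
      unfolding Y_def X_def y_step by (rule linear)
    also have "\<dots> = X t - \<eta> * (d * (X t + Rm t))"
      unfolding mix by (simp add: X_def Rm_def distrib_left sum.distrib)
    finally show ?thesis by (simp add: a_def algebra_simps)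
  qed
  have X_step: "X (Suc t) = Y (Suc t) + \<zeta> * (Y (Suc t) - Y t)" for t
    unfolding X_def Y_def x_step by (rule momentum)
  \<comment> \<open>The second conjunct eliminates the momentum variable without division by \<open>\<zeta>\<close>, which may be \<open>0\<close>.\<close>
  have "X t = S (Suc t) - S t - Rm t \<and> S (Suc t) = Rm t + a * S t + \<zeta> * Y t" for t
  proof (induction t)
    case 0
    have "X 0 = 0" "Y 0 = 0" by (simp_all add: X_def x_def Y_def y_def)
    then show ?case by (simp add: S_def response_0 response_1)
  next
    case (Suc t)
    have Y: "Y (Suc t) = a * (S (Suc t) - S t) - Rm t"
    proof -
      have "X t = S (Suc t) - S t - Rm t" using Suc by simp
      then show ?thesis unfolding Y_step \<open>X t = _\<close> by (simp add: algebra_simps)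
    qed
    have "S (Suc (Suc t)) = Rm (Suc t) - \<zeta> * Rm t + a * (1 + \<zeta>) * S (Suc t) - a * \<zeta> * S t"
      unfolding S_def by (rule response_Suc_Suc)
    also have "\<dots> = Rm (Suc t) + a * S (Suc t) + \<zeta> * Y (Suc t)"
      unfolding Y by (simp add: algebra_simps)
    finally have S: "S (Suc (Suc t)) = Rm (Suc t) + a * S (Suc t) + \<zeta> * Y (Suc t)" .
    have "X (Suc t) = Y (Suc t) + \<zeta> * Y (Suc t) - \<zeta> * Y t"
      unfolding X_step right_diff_distrib by simp
    moreover have "\<zeta> * Y t = S (Suc t) - Rm t - a * S t" using Suc by simp
    moreover have "Y (Suc t) = a * S (Suc t) - a * S t - Rm t"
      unfolding Y right_diff_distrib ..
    ultimately have "X (Suc t) = S (Suc (Suc t)) - S (Suc t) - Rm (Suc t)" using S by linarith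
    then show ?case using S by simp
  qed
  then have "X t + Rm t = S (Suc t) - S t" by simp
  moreover have "(\<Sum>i<N. u i * sda_theta E L \<eta> \<zeta> R t i j) = X t + Rm t"
    unfolding sda_theta_def X_def Rm_def x_def by (simp only: distrib_left sum.distrib)
  ultimately show ?thesis by (simp only: S_def Rm_def a_def)
qed

text \<open>An eigenbasis as provided by \<open>gossip_spectrum\<close>, with \<open>s\<close> for the square root of the condition
  number. The last assumption is what the inverse of the largest eigenvalue provides as a choice of \<open>\<eta>\<close>.\<close>

locale gossip_modes =
  fixes N :: nat and E :: "(nat \<times> nat) set" and L :: "real mat"
    and u :: "nat \<Rightarrow> nat \<Rightarrow> real" and d :: "nat \<Rightarrow> real" and k0 :: nat and \<eta> \<zeta> s :: real
  assumes gossip: "gossip_matrix N E L" and graph: "simple_connected_graph N E"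
    and orth: "\<And>k l. k < N \<Longrightarrow> l < N \<Longrightarrow> (\<Sum>i<N. u k i * u l i) = (if k = l then 1 else 0)"
    and cols: "\<And>i j. i < N \<Longrightarrow> j < N \<Longrightarrow> (\<Sum>k<N. u k i * u k j) = (if i = j then 1 else 0)"
    and ev: "\<And>k i. k < N \<Longrightarrow> i < N \<Longrightarrow> (\<Sum>j<N. L $$ (i, j) * u k j) = d k * u k i"
    and k0: "k0 < N" "d k0 = 0" and const: "\<And>i. i < N \<Longrightarrow> u k0 i = u k0 0"
    and s: "1 \<le> s" and \<zeta>: "\<zeta> = (s - 1) / (s + 1)"
    and contraction: "\<And>k. k < N \<Longrightarrow> k \<noteq> k0 \<Longrightarrow> 0 \<le> 1 - \<eta> * d k \<and> 1 - \<eta> * d k \<le> 1 - 1 / s\<^sup>2"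
begin

definition residual :: "nat \<Rightarrow> nat \<Rightarrow> real" where
  "residual k = mode_residual (1 - \<eta> * d k) \<zeta>"

text \<open>The coefficient of the input at time \<open>t\<close> in the sum of the outputs of mode \<open>k\<close> over the times
  from \<open>T0\<close> to \<open>2 * T0 - 1\<close>.\<close>

definition gain :: "nat \<Rightarrow> nat \<Rightarrow> nat \<Rightarrow> real" where
  "gain T0 k t = residual k (2 * T0 - 1 - t) - (if t < T0 then residual k (T0 - 1 - t) else 0)"

lemma expansion: "i < N \<Longrightarrow> x i = (\<Sum>k<N. u k i * (\<Sum>j<N. u k j * x j))"
proof -
  assume i: "i < N"
  have "(\<Sum>k<N. u k i * (\<Sum>j<N. u k j * x j)) = (\<Sum>j<N. (\<Sum>k<N. u k i * u k j) * x j)"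
    by (simp only: sum_distrib_left sum_distrib_right mult.assoc) (rule sum.swap)
  also have "\<dots> = (\<Sum>j<N. if i = j then x j else 0)"
    using i by (intro sum.cong refl) (simp add: cols)
  also have "\<dots> = x i" using i by simp
  finally show ?thesis by simp
qed

lemma parseval:
  assumes K: "K \<subseteq> {..<N}"
  shows "(\<Sum>i<N. (\<Sum>k\<in>K. u k i * b k)\<^sup>2) = (\<Sum>k\<in>K. (b k)\<^sup>2)"
proof -
  have fin: "finite K" using K by (rule finite_subset) simp
  have "(\<Sum>i<N. (\<Sum>k\<in>K. u k i * b k)\<^sup>2) = (\<Sum>i<N. \<Sum>k\<in>K. \<Sum>l\<in>K. b k * b l * (u k i * u l i))"
    by (simp add: power2_eq_square sum_product mult_ac)
  also have "\<dots> = (\<Sum>k\<in>K. \<Sum>l\<in>K. \<Sum>i<N. b k * b l * (u k i * u l i))"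
    by (subst sum.swap) (intro sum.cong refl sum.swap)
  also have "\<dots> = (\<Sum>k\<in>K. \<Sum>l\<in>K. if k = l then b k * b l else 0)"
    using K by (intro sum.cong refl) (auto simp: orth subset_eq simp flip: sum_distrib_left)
  also have "\<dots> = (\<Sum>k\<in>K. (b k)\<^sup>2)"
    using fin by (simp add: power2_eq_square)
  finally show ?thesis .
qed

lemma parseval_coefficients: "(\<Sum>k<N. (\<Sum>i<N. u k i * x i)\<^sup>2) = (\<Sum>i<N. (x i)\<^sup>2)"
  by (subst parseval[symmetric]) (auto simp: expansion[symmetric] intro!: sum.cong)

lemma consensus_weight: "i < N \<Longrightarrow> j < N \<Longrightarrow> u k0 i * u k0 j = 1 / real N"
proof -
  assume ij: "i < N" "j < N"
  obtain c where c: "\<And>i. i < N \<Longrightarrow> u k0 i = c" using const by blast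
  have "real N * (c * c) = 1" using orth[OF k0(1) k0(1)] by (simp add: c)
  then show ?thesis using ij by (simp add: c field_simps)
qed

text \<open>The modes other than \<open>k0\<close> are orthogonal to the constant vectors, so they see mean rewards only
  through the deviation from their average over the agents.\<close>

lemma sum_mode: "k < N \<Longrightarrow> k \<noteq> k0 \<Longrightarrow> (\<Sum>i<N. u k i) = 0"
proof -
  assume k: "k < N" "k \<noteq> k0"
  obtain c where c: "\<And>i. i < N \<Longrightarrow> u k0 i = c" using const by blast
  have "c \<noteq> 0" using orth[OF k0(1) k0(1)] by (auto simp: c)
  moreover have "(\<Sum>i<N. u k i) * c = 0" using orth[OF k(1) k0(1)] k by (simp add: c sum_distrib_right)
  ultimately show ?thesis by simp
qed

text \<open>The sum over the window telescopes to a difference of two responses.\<close>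

lemma response_window:
  "response (1 - \<eta> * d k) \<zeta> f (2 * T0) - response (1 - \<eta> * d k) \<zeta> f T0 = (\<Sum>t<2 * T0. gain T0 k t * f t)"
proof -
  have "response (1 - \<eta> * d k) \<zeta> f T0 = (\<Sum>t<2 * T0. (if t < T0 then residual k (T0 - 1 - t) else 0) * f t)"
    unfolding response_def residual_def by (rule sum.mono_neutral_cong_left) auto
  then show ?thesis
    by (simp add: response_def gain_def residual_def left_diff_distrib sum_subtractf)
qed

lemma sum_gain: "(\<Sum>t<2 * T0. gain T0 k t) = (\<Sum>m = T0..<2 * T0. residual k m)"
proof -
  have rev: "(\<Sum>t<n. residual k (n - 1 - t)) = (\<Sum>m<n. residual k m)" for n
    using sum.nat_diff_reindex[of "residual k" n] by simp
  have "(\<Sum>t<2 * T0. if t < T0 then residual k (T0 - 1 - t) else 0) = (\<Sum>t<T0. residual k (T0 - 1 - t))"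
    by (rule sum.mono_neutral_cong_right) auto
  then have "(\<Sum>t<2 * T0. gain T0 k t) = (\<Sum>m<2 * T0. residual k m) - (\<Sum>m<T0. residual k m)"
    by (simp only: gain_def sum_subtractf rev)
  also have "\<dots> = (\<Sum>m = T0..<2 * T0. residual k m)"
    using sum_diff_nat_ivl[of 0 T0 "2 * T0" "residual k"] by (simp add: lessThan_atLeast0)
  finally show ?thesis .
qed

lemma gain_consensus: "t < 2 * T0 \<Longrightarrow> gain T0 k0 t = (if t < T0 then 0 else 1)"
  by (simp add: gain_def residual_def k0 mode_residual_consensus)

lemma sum_gain_square_le:
  assumes k: "k < N" "k \<noteq> k0"
  shows "(\<Sum>t<2 * T0. (gain T0 k t)\<^sup>2) \<le> 64 * s"
proof -
  have bnd: "(\<Sum>t<n. (residual k t)\<^sup>2) \<le> 16 * s" for n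
    unfolding residual_def using contraction[OF k] by (intro sum_mode_residual_square_le s \<zeta>) auto
  have rev: "(\<Sum>t<n. (residual k (n - 1 - t))\<^sup>2) = (\<Sum>m<n. (residual k m)\<^sup>2)" for n
    using sum.nat_diff_reindex[of "\<lambda>m. (residual k m)\<^sup>2" n] by simp
  have "(\<Sum>t<2 * T0. (gain T0 k t)\<^sup>2)
      \<le> (\<Sum>t<2 * T0. 2 * (residual k (2 * T0 - 1 - t))\<^sup>2 + 2 * (if t < T0 then (residual k (T0 - 1 - t))\<^sup>2 else 0))"
  proof (intro sum_mono)
    fix t
    have "(x - y)\<^sup>2 \<le> 2 * x\<^sup>2 + 2 * y\<^sup>2" for x y :: real
      using zero_le_power2[of "x + y"] by (simp add: power2_eq_square algebra_simps)
    from this[of "residual k (2 * T0 - 1 - t)" "if t < T0 then residual k (T0 - 1 - t) else 0"]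
    show "(gain T0 k t)\<^sup>2 \<le> 2 * (residual k (2 * T0 - 1 - t))\<^sup>2 + 2 * (if t < T0 then (residual k (T0 - 1 - t))\<^sup>2 else 0)"
      by (simp add: gain_def split: if_splits)
  qed
  also have "\<dots> = 2 * (\<Sum>m<2 * T0. (residual k m)\<^sup>2) + 2 * (\<Sum>t<2 * T0. if t < T0 then (residual k (T0 - 1 - t))\<^sup>2 else 0)"
    by (simp only: sum.distrib sum_distrib_left[symmetric] rev)
  also have "(\<Sum>t<2 * T0. if t < T0 then (residual k (T0 - 1 - t))\<^sup>2 else 0) = (\<Sum>t<T0. (residual k (T0 - 1 - t))\<^sup>2)"
    by (rule sum.mono_neutral_cong_right) auto
  finally show ?thesis using bnd[of "2 * T0"] bnd[of T0] rev[of T0] by linarith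
qed

lemma sda_output_modes:
  assumes i: "i < N" and j: "j < n"
  shows "sda_output n E L \<eta> \<zeta> (2 * T0) T0 R i $ j
     = (\<Sum>k<N. u k i * ((\<Sum>t<2 * T0. gain T0 k t * (\<Sum>i<N. u k i * R i t j)) / real T0))"
proof -
  define S where "S = (\<lambda>k. response (1 - \<eta> * d k) \<zeta> (\<lambda>t. \<Sum>i<N. u k i * R i t j))"
  have theta: "sda_theta E L \<eta> \<zeta> R t i j = (\<Sum>k<N. u k i * (S k (Suc t) - S k t))" for t
  proof -
    have "sda_theta E L \<eta> \<zeta> R t i j = (\<Sum>k<N. u k i * (\<Sum>i<N. u k i * sda_theta E L \<eta> \<zeta> R t i j))"
      by (rule expansion[OF i])
    also have "\<dots> = (\<Sum>k<N. u k i * (S k (Suc t) - S k t))"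
    proof (intro sum.cong refl arg_cong2[where f = "(*)"])
      fix k assume "k \<in> {..<N}"
      then show "(\<Sum>i<N. u k i * sda_theta E L \<eta> \<zeta> R t i j) = S k (Suc t) - S k t"
        unfolding S_def using ev by (intro sda_mode[OF gossip graph]) auto
    qed
    finally show ?thesis .
  qed
  have "(\<Sum>t = T0..<2 * T0. sda_theta E L \<eta> \<zeta> R t i j)
      = (\<Sum>k<N. u k i * (\<Sum>t = T0..<2 * T0. S k (Suc t) - S k t))"
    unfolding theta sum_distrib_left by (rule sum.swap)
  also have "\<dots> = (\<Sum>k<N. u k i * (S k (2 * T0) - S k T0))"
    by (simp add: sum_Suc_diff')
  also have "\<dots> = (\<Sum>k<N. u k i * (\<Sum>t<2 * T0. gain T0 k t * (\<Sum>i<N. u k i * R i t j)))"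
    unfolding S_def response_window ..
  finally show ?thesis
    using j by (simp add: sda_output_def) (simp add: sum_divide_distrib[of _ "{..<N}"])
qed

text \<open>In the next three definitions \<open>w i t\<close> is the noise in the reward of agent \<open>i\<close> at time \<open>t\<close> and \<open>x i\<close> the
  deviation of its mean reward from the average over the agents, all for one fixed state. They are
  the three sources of error that \<open>sda_error_decomposition\<close> identifies.\<close>

definition consensus_noise :: "nat \<Rightarrow> (nat \<Rightarrow> nat \<Rightarrow> real) \<Rightarrow> real" where
  "consensus_noise T0 w = (\<Sum>t = T0..<2 * T0. \<Sum>i<N. w i t) / (real T0 * real N)"

definition mode_bias :: "nat \<Rightarrow> (nat \<Rightarrow> real) \<Rightarrow> nat \<Rightarrow> real" where
  "mode_bias T0 x k = (\<Sum>m = T0..<2 * T0. residual k m) / real T0 * (\<Sum>i<N. u k i * x i)"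

definition mode_noise :: "nat \<Rightarrow> (nat \<Rightarrow> nat \<Rightarrow> real) \<Rightarrow> nat \<Rightarrow> real" where
  "mode_noise T0 w k = (\<Sum>t<2 * T0. gain T0 k t * (\<Sum>i<N. u k i * w i t)) / real T0"

lemma sda_error_decomposition:
  assumes i: "i < N" and j: "j < n" and T0: "0 < T0"
  shows "sda_output n E L \<eta> \<zeta> (2 * T0) T0 R i $ j - (\<Sum>i<N. r i j) / real N
     = consensus_noise T0 (\<lambda>i t. R i t j - r i j)
       + (\<Sum>k\<in>{..<N} - {k0}. u k i * mode_bias T0 (\<lambda>i. r i j - (\<Sum>i<N. r i j) / real N) k)
       + (\<Sum>k\<in>{..<N} - {k0}. u k i * mode_noise T0 (\<lambda>i t. R i t j - r i j) k)"
proof -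
  define m where "m = (\<Sum>i<N. r i j) / real N"
  define w where "w = (\<lambda>i t. R i t j - r i j)"
  define f where "f = (\<lambda>k. (\<Sum>t<2 * T0. gain T0 k t * (\<Sum>i<N. u k i * R i t j)) / real T0)"
  have split: "f k = mode_noise T0 w k + (\<Sum>m = T0..<2 * T0. residual k m) / real T0 * (\<Sum>i<N. u k i * r i j)" for k
  proof -
    have "(\<Sum>i<N. u k i * R i t j) = (\<Sum>i<N. u k i * w i t) + (\<Sum>i<N. u k i * r i j)" for t
      by (simp add: w_def algebra_simps sum_subtractf)
    then show ?thesis
      by (simp add: f_def mode_noise_def distrib_left sum.distrib add_divide_distrib
          sum_gain[symmetric] sum_distrib_right)
  qed
  have bias: "(\<Sum>m = T0..<2 * T0. residual k m) / real T0 * (\<Sum>i<N. u k i * r i j) = mode_bias T0 (\<lambda>i. r i j - m) k"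
    if "k < N" "k \<noteq> k0" for k
  proof -
    have "(\<Sum>i<N. u k i * (r i j - m)) = (\<Sum>i<N. u k i * r i j) - (\<Sum>i<N. u k i) * m"
      by (simp add: right_diff_distrib sum_subtractf sum_distrib_right)
    then show ?thesis using sum_mode[OF that] by (simp add: mode_bias_def)
  qed
  have cons: "u k0 i * f k0 = consensus_noise T0 w + m"
  proof -
    have "u k0 i * f k0 = (\<Sum>t<2 * T0. gain T0 k0 t * (\<Sum>j'<N. (u k0 i * u k0 j') * R j' t j)) / real T0"
      by (simp add: f_def sum_distrib_left mult_ac)
    also have "\<dots> = (\<Sum>t<2 * T0. (if t < T0 then 0 else 1) * ((\<Sum>j'<N. R j' t j) / real N)) / real T0"
      using i by (intro arg_cong2[where f = "(/)"] sum.cong refl)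
        (simp add: gain_consensus consensus_weight sum_divide_distrib)
    also have "(\<Sum>t<2 * T0. (if t < T0 then 0 else 1) * ((\<Sum>j'<N. R j' t j) / real N))
        = (\<Sum>t = T0..<2 * T0. (\<Sum>j'<N. R j' t j) / real N)"
      by (rule sum.mono_neutral_cong_right) auto
    also have "\<dots> = (\<Sum>t = T0..<2 * T0. (\<Sum>i<N. w i t) / real N + m)"
      by (simp add: w_def m_def sum_subtractf diff_divide_distrib)
    also have "\<dots> / real T0 = consensus_noise T0 w + m"
      using T0 by (simp add: consensus_noise_def sum.distrib add_divide_distrib mult.commute
          flip: sum_divide_distrib)
    finally show ?thesis .
  qed
  have "sda_output n E L \<eta> \<zeta> (2 * T0) T0 R i $ j = (\<Sum>k<N. u k i * f k)"
    unfolding f_def by (rule sda_output_modes[OF i j])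
  also have "\<dots> = u k0 i * f k0 + (\<Sum>k\<in>{..<N} - {k0}. u k i * f k)"
    using k0 by (intro sum.remove) auto
  also have "(\<Sum>k\<in>{..<N} - {k0}. u k i * f k)
      = (\<Sum>k\<in>{..<N} - {k0}. u k i * mode_bias T0 (\<lambda>i. r i j - m) k + u k i * mode_noise T0 w k)"
  proof (intro sum.cong refl)
    fix k assume "k \<in> {..<N} - {k0}"
    then have "f k = mode_noise T0 w k + mode_bias T0 (\<lambda>i. r i j - m) k"
      unfolding split by (subst bias) auto
    then show "u k i * f k = u k i * mode_bias T0 (\<lambda>i. r i j - m) k + u k i * mode_noise T0 w k"
      by (simp add: distrib_left)
  qed
  finally show ?thesis unfolding cons by (simp add: sum.distrib m_def[symmetric] w_def)
qed

lemma mode_bias_square_sum_le: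
  assumes T0: "0 < T0"
  shows "(\<Sum>k\<in>{..<N} - {k0}. (mode_bias T0 x k)\<^sup>2) \<le> (6 * exp (- (real T0 / s)))\<^sup>2 * (\<Sum>i<N. (x i)\<^sup>2)"
proof -
  have "(\<Sum>k\<in>{..<N} - {k0}. (mode_bias T0 x k)\<^sup>2)
      \<le> (\<Sum>k\<in>{..<N} - {k0}. (6 * exp (- (real T0 / s)))\<^sup>2 * (\<Sum>i<N. u k i * x i)\<^sup>2)"
  proof (intro sum_mono)
    fix k assume "k \<in> {..<N} - {k0}"
    then have k: "k < N" "k \<noteq> k0" by auto
    have "\<bar>\<Sum>m = T0..<2 * T0. residual k m\<bar> \<le> (\<Sum>m = T0..<2 * T0. \<bar>residual k m\<bar>)" by (rule sum_abs)
    also have "\<dots> \<le> 6 * real T0 * exp (- (real T0 / s))"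
      unfolding residual_def using contraction[OF k] by (intro sum_late_mode_residual_le s \<zeta>) auto
    finally have "\<bar>(\<Sum>m = T0..<2 * T0. residual k m) / real T0\<bar> \<le> 6 * exp (- (real T0 / s))"
      using T0 by (simp add: field_simps)
    then have "((\<Sum>m = T0..<2 * T0. residual k m) / real T0)\<^sup>2 \<le> (6 * exp (- (real T0 / s)))\<^sup>2"
      by (metis abs_ge_zero power2_abs power_mono)
    then show "(mode_bias T0 x k)\<^sup>2 \<le> (6 * exp (- (real T0 / s)))\<^sup>2 * (\<Sum>i<N. u k i * x i)\<^sup>2"
      unfolding mode_bias_def power_mult_distrib[of _ "sum _ _"] by (intro mult_right_mono) auto
  qed
  also have "\<dots> \<le> (\<Sum>k<N. (6 * exp (- (real T0 / s)))\<^sup>2 * (\<Sum>i<N. u k i * x i)\<^sup>2)"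
    by (intro sum_mono2) auto
  also have "\<dots> = (6 * exp (- (real T0 / s)))\<^sup>2 * (\<Sum>i<N. (x i)\<^sup>2)"
    by (simp only: sum_distrib_left[symmetric] parseval_coefficients)
  finally show ?thesis .
qed

end

section \<open>Moments of sums of independent random variables\<close>

lemma exp_le_quadratic:
  fixes x :: real
  assumes "x \<le> 1"
  shows "exp x \<le> 1 + x + x\<^sup>2"
proof (cases "0 \<le> x")
  case True
  then show ?thesis using assms exp_bound by blast
next
  case False
  define y where "y = - x"
  have y: "0 < y" using False by (simp add: y_def)
  have pos: "0 < 1 - y + y\<^sup>2"
  proof -
    have "1 - y + y\<^sup>2 = (1 - y / 2)\<^sup>2 + 3 / 4 * y\<^sup>2" by (simp add: power2_eq_square algebra_simps)
    then show ?thesis using y by (simp add: add_nonneg_pos)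
  qed
  have "1 \<le> 1 + y * y\<^sup>2" using y by simp
  also have "\<dots> = (1 + y) * (1 - y + y\<^sup>2)" by (simp add: power2_eq_square algebra_simps)
  also have "\<dots> \<le> exp y * (1 - y + y\<^sup>2)"
    using pos by (intro mult_right_mono) (auto simp: exp_ge_add_one_self)
  finally have "exp (- y) \<le> 1 - y + y\<^sup>2" by (simp add: exp_minus field_simps)
  then show ?thesis by (simp add: y_def)
qed

text \<open>The moment form of Bernstein's inequality: the exponent contains the variance instead of the
  squared range. This is what makes the variance argument for the transition model possible.\<close>

lemma (in prob_space) exp_moment_centered_le:
  fixes Y :: "'a \<Rightarrow> real"
  assumes [measurable]: "Y \<in> borel_measurable M"
    and b: "\<And>\<omega>. \<omega> \<in> space M \<Longrightarrow> \<bar>Y \<omega>\<bar> \<le> b" and mean: "expectation Y = 0" and l: "\<bar>l\<bar> * b \<le> 1"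
  shows "integrable M (\<lambda>\<omega>. exp (l * Y \<omega>))"
    and "expectation (\<lambda>\<omega>. exp (l * Y \<omega>)) \<le> exp (l\<^sup>2 * expectation (\<lambda>\<omega>. (Y \<omega>)\<^sup>2))"
proof -
  have le1: "l * Y \<omega> \<le> 1" if "\<omega> \<in> space M" for \<omega>
  proof -
    have "l * Y \<omega> \<le> \<bar>l\<bar> * \<bar>Y \<omega>\<bar>" by (metis abs_ge_self abs_mult)
    also have "\<dots> \<le> \<bar>l\<bar> * b" using b[OF that] by (intro mult_left_mono) auto
    finally show ?thesis using l by simp
  qed
  show int: "integrable M (\<lambda>\<omega>. exp (l * Y \<omega>))"
    by (rule integrable_const_bound[where B = "exp 1"]) (auto intro!: AE_I2 le1)
  have intY: "integrable M Y"
    by (rule integrable_const_bound[where B = b]) (auto intro!: AE_I2 b)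
  have intY2: "integrable M (\<lambda>\<omega>. (Y \<omega>)\<^sup>2)"
  proof (rule integrable_const_bound[where B = "b\<^sup>2"])
    show "AE \<omega> in M. norm ((Y \<omega>)\<^sup>2) \<le> b\<^sup>2"
      using power_mono[OF b, of _ 2] by (auto intro!: AE_I2)
  qed simp
  have "expectation (\<lambda>\<omega>. exp (l * Y \<omega>)) \<le> expectation (\<lambda>\<omega>. 1 + l * Y \<omega> + l\<^sup>2 * (Y \<omega>)\<^sup>2)"
  proof (rule integral_mono[OF int])
    fix \<omega> assume "\<omega> \<in> space M"
    then show "exp (l * Y \<omega>) \<le> 1 + l * Y \<omega> + l\<^sup>2 * (Y \<omega>)\<^sup>2"
      using exp_le_quadratic[OF le1] by (simp add: power_mult_distrib)
  qed (use intY intY2 in auto)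
  also have "\<dots> = 1 + l\<^sup>2 * expectation (\<lambda>\<omega>. (Y \<omega>)\<^sup>2)"
    using intY intY2 mean by (simp add: prob_space)
  also have "\<dots> \<le> exp (l\<^sup>2 * expectation (\<lambda>\<omega>. (Y \<omega>)\<^sup>2))" by (rule exp_ge_add_one_self)
  finally show "expectation (\<lambda>\<omega>. exp (l * Y \<omega>)) \<le> exp (l\<^sup>2 * expectation (\<lambda>\<omega>. (Y \<omega>)\<^sup>2))" .
qed

lemma (in prob_space) exp_moment_indep_sum_le:
  fixes Y :: "'i \<Rightarrow> 'a \<Rightarrow> real"
  assumes I: "finite I" and ind: "indep_vars (\<lambda>_. borel) Y I"
    and b: "\<And>i \<omega>. i \<in> I \<Longrightarrow> \<omega> \<in> space M \<Longrightarrow> \<bar>Y i \<omega>\<bar> \<le> b"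
    and mean: "\<And>i. i \<in> I \<Longrightarrow> expectation (Y i) = 0"
    and var: "\<And>i. i \<in> I \<Longrightarrow> expectation (\<lambda>\<omega>. (Y i \<omega>)\<^sup>2) \<le> v" and l: "\<bar>l\<bar> * b \<le> 1"
  shows "integrable M (\<lambda>\<omega>. exp (l * (\<Sum>i\<in>I. Y i \<omega>)))"
    and "expectation (\<lambda>\<omega>. exp (l * (\<Sum>i\<in>I. Y i \<omega>))) \<le> exp (l\<^sup>2 * (real (card I) * v))"
proof -
  have meas: "Y i \<in> borel_measurable M" if "i \<in> I" for i
    using ind that by (auto simp: indep_vars_def2)
  have ind': "indep_vars (\<lambda>_. borel) (\<lambda>i \<omega>. exp (l * Y i \<omega>)) I"
    by (rule indep_vars_compose2[OF ind]) auto
  have prod: "exp (l * (\<Sum>i\<in>I. Y i \<omega>)) = (\<Prod>i\<in>I. exp (l * Y i \<omega>))" for \<omega>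
    using I by (simp add: sum_distrib_left exp_sum)
  have int: "integrable M (\<lambda>\<omega>. exp (l * Y i \<omega>))" if "i \<in> I" for i
    using that by (intro exp_moment_centered_le(1)[of _ b]) (auto simp: meas b mean l)
  show "integrable M (\<lambda>\<omega>. exp (l * (\<Sum>i\<in>I. Y i \<omega>)))"
    unfolding prod by (rule indep_vars_integrable[OF I ind' int])
  have "expectation (\<lambda>\<omega>. exp (l * (\<Sum>i\<in>I. Y i \<omega>))) = (\<Prod>i\<in>I. expectation (\<lambda>\<omega>. exp (l * Y i \<omega>)))"
    unfolding prod by (rule indep_vars_lebesgue_integral[OF I ind' int])
  also have "\<dots> \<le> (\<Prod>i\<in>I. exp (l\<^sup>2 * v))"
  proof (intro prod_mono conjI)
    fix i assume i: "i \<in> I"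
    have "expectation (\<lambda>\<omega>. exp (l * Y i \<omega>)) \<le> exp (l\<^sup>2 * expectation (\<lambda>\<omega>. (Y i \<omega>)\<^sup>2))"
      using i by (intro exp_moment_centered_le(2)[of _ b]) (auto simp: meas b mean l)
    also have "\<dots> \<le> exp (l\<^sup>2 * v)" using var[OF i] by (simp add: mult_left_mono)
    finally show "expectation (\<lambda>\<omega>. exp (l * Y i \<omega>)) \<le> exp (l\<^sup>2 * v)" .
  qed simp
  also have "\<dots> = exp (l\<^sup>2 * (real (card I) * v))"
    by (simp add: exp_of_nat_mult[symmetric] mult_ac)
  finally show "expectation (\<lambda>\<omega>. exp (l * (\<Sum>i\<in>I. Y i \<omega>))) \<le> exp (l\<^sup>2 * (real (card I) * v))" .
qed

lemma (in prob_space) second_moment_indep_sum: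
  fixes Y :: "'i \<Rightarrow> 'a \<Rightarrow> real"
  assumes I: "finite I" and ind: "indep_vars (\<lambda>_. borel) Y I"
    and int: "\<And>i. i \<in> I \<Longrightarrow> integrable M (Y i)"
    and int2: "\<And>i. i \<in> I \<Longrightarrow> integrable M (\<lambda>\<omega>. (Y i \<omega>)\<^sup>2)"
    and mean: "\<And>i. i \<in> I \<Longrightarrow> expectation (Y i) = 0"
  shows "integrable M (\<lambda>\<omega>. (\<Sum>i\<in>I. c i * Y i \<omega>)\<^sup>2)"
    and "expectation (\<lambda>\<omega>. (\<Sum>i\<in>I. c i * Y i \<omega>)\<^sup>2) = (\<Sum>i\<in>I. (c i)\<^sup>2 * expectation (\<lambda>\<omega>. (Y i \<omega>)\<^sup>2))"
proof -
  have cross: "integrable M (\<lambda>\<omega>. Y i \<omega> * Y j \<omega>) \<and>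
      expectation (\<lambda>\<omega>. Y i \<omega> * Y j \<omega>) = (if i = j then expectation (\<lambda>\<omega>. (Y i \<omega>)\<^sup>2) else 0)"
    if "i \<in> I" "j \<in> I" for i j
  proof (cases "i = j")
    case True
    then show ?thesis using int2[OF that(1)] by (simp add: power2_eq_square)
  next
    case False
    have ind2: "indep_vars (\<lambda>_. borel) Y {i, j}" by (rule indep_vars_subset[OF ind]) (use that in auto)
    have "integrable M (\<lambda>\<omega>. \<Prod>k\<in>{i, j}. Y k \<omega>)"
      by (rule indep_vars_integrable[OF _ ind2]) (use that int in auto)
    moreover have "expectation (\<lambda>\<omega>. \<Prod>k\<in>{i, j}. Y k \<omega>) = (\<Prod>k\<in>{i, j}. expectation (Y k))"
      by (rule indep_vars_lebesgue_integral[OF _ ind2]) (use that int in auto)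
    ultimately show ?thesis using False mean that by simp
  qed
  have sq: "(\<Sum>i\<in>I. c i * Y i \<omega>)\<^sup>2 = (\<Sum>i\<in>I. \<Sum>j\<in>I. c i * c j * (Y i \<omega> * Y j \<omega>))" for \<omega>
    by (simp add: power2_eq_square sum_product mult_ac)
  show "integrable M (\<lambda>\<omega>. (\<Sum>i\<in>I. c i * Y i \<omega>)\<^sup>2)"
    unfolding sq using cross by (intro Bochner_Integration.integrable_sum Bochner_Integration.integrable_mult_right) auto
  have "expectation (\<lambda>\<omega>. (\<Sum>i\<in>I. c i * Y i \<omega>)\<^sup>2)
      = (\<Sum>i\<in>I. expectation (\<lambda>\<omega>. \<Sum>j\<in>I. c i * c j * (Y i \<omega> * Y j \<omega>)))"
    unfolding sq using cross by (intro Bochner_Integration.integral_sum Bochner_Integration.integrable_sum Bochner_Integration.integrable_mult_right) auto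
  also have "\<dots> = (\<Sum>i\<in>I. \<Sum>j\<in>I. c i * c j * expectation (\<lambda>\<omega>. Y i \<omega> * Y j \<omega>))"
    using cross by (intro sum.cong refl) (subst Bochner_Integration.integral_sum; simp)
  also have "\<dots> = (\<Sum>i\<in>I. \<Sum>j\<in>I. if i = j then (c i)\<^sup>2 * expectation (\<lambda>\<omega>. (Y i \<omega>)\<^sup>2) else 0)"
  proof (intro sum.cong refl)
    fix i j assume "i \<in> I" "j \<in> I"
    then have "expectation (\<lambda>\<omega>. Y i \<omega> * Y j \<omega>) = (if i = j then expectation (\<lambda>\<omega>. (Y i \<omega>)\<^sup>2) else 0)"
      using cross by blast
    then show "c i * c j * expectation (\<lambda>\<omega>. Y i \<omega> * Y j \<omega>)
        = (if i = j then (c i)\<^sup>2 * expectation (\<lambda>\<omega>. (Y i \<omega>)\<^sup>2) else 0)"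
      by (cases "i = j") (simp_all only: simp_thms if_True if_False power2_eq_square[of "c j"] mult_zero_right)
  qed
  also have "\<dots> = (\<Sum>i\<in>I. (c i)\<^sup>2 * expectation (\<lambda>\<omega>. (Y i \<omega>)\<^sup>2))"
    using I by simp
  finally show "expectation (\<lambda>\<omega>. (\<Sum>i\<in>I. c i * Y i \<omega>)\<^sup>2) = (\<Sum>i\<in>I. (c i)\<^sup>2 * expectation (\<lambda>\<omega>. (Y i \<omega>)\<^sup>2))" .
qed

text \<open>A maximal inequality in which the bound \<open>Z\<close> is explicit, so that no tail integral is needed: the
  tangent of the exponential at \<open>ln K\<close>, with \<open>K\<close> the number of variables, bounds each \<open>l * D i\<close> by
  \<open>ln K - 1\<close> plus \<open>1 / K\<close> times the sum of the exponentials, and that sum has mean at most \<open>K\<close>.\<close>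

lemma (in prob_space) common_bound_from_exp_moments:
  fixes D :: "'i \<Rightarrow> 'a \<Rightarrow> real"
  assumes I: "finite I" "I \<noteq> {}" and l: "0 < l"
    and int: "\<And>i. i \<in> I \<Longrightarrow> integrable M (\<lambda>\<omega>. exp (l * D i \<omega>))"
    and le: "\<And>i. i \<in> I \<Longrightarrow> expectation (\<lambda>\<omega>. exp (l * D i \<omega>)) \<le> 1"
  obtains Z where "integrable M Z" "expectation Z \<le> ln (real (card I)) / l"
    "\<And>i \<omega>. i \<in> I \<Longrightarrow> D i \<omega> \<le> Z \<omega>"
proof -
  define K where "K = real (card I)"
  have K: "0 < K" using I by (simp add: K_def card_gt_0_iff)
  define Z where "Z = (\<lambda>\<omega>. (ln K - 1 + (\<Sum>i\<in>I. exp (l * D i \<omega>)) / K) / l)"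
  have intS: "integrable M (\<lambda>\<omega>. (\<Sum>i\<in>I. exp (l * D i \<omega>)) / K)"
    using int by (intro Bochner_Integration.integrable_divide Bochner_Integration.integrable_sum) auto
  have "integrable M Z" unfolding Z_def using intS by auto
  moreover have "expectation Z \<le> ln K / l"
  proof -
    have "expectation (\<lambda>\<omega>. (\<Sum>i\<in>I. exp (l * D i \<omega>)) / K) = (\<Sum>i\<in>I. expectation (\<lambda>\<omega>. exp (l * D i \<omega>))) / K"
      using int by simp
    also have "\<dots> \<le> K / K"
      using K sum_mono[of I "\<lambda>i. expectation (\<lambda>\<omega>. exp (l * D i \<omega>))" "\<lambda>_. 1"] le
      by (intro divide_right_mono) (auto simp: K_def)
    finally have "expectation (\<lambda>\<omega>. (\<Sum>i\<in>I. exp (l * D i \<omega>)) / K) \<le> 1" using K by simp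
    moreover have "expectation Z = (ln K - 1 + expectation (\<lambda>\<omega>. (\<Sum>i\<in>I. exp (l * D i \<omega>)) / K)) / l"
      unfolding Z_def using intS by (simp add: prob_space del: Bochner_Integration.integral_divide_zero)
    ultimately show ?thesis using l by (simp add: divide_right_mono)
  qed
  moreover have "D i \<omega> \<le> Z \<omega>" if i: "i \<in> I" for i \<omega>
  proof -
    have "1 + (l * D i \<omega> - ln K) \<le> exp (l * D i \<omega> - ln K)" by (rule exp_ge_add_one_self)
    also have "\<dots> = exp (l * D i \<omega>) / K" using K by (simp add: exp_diff)
    also have "\<dots> \<le> (\<Sum>i\<in>I. exp (l * D i \<omega>)) / K"
      using i I K by (intro divide_right_mono member_le_sum) auto
    finally show ?thesis using l by (simp add: Z_def field_simps)
  qed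
  ultimately show thesis using that by (simp add: K_def)
qed

text \<open>Jensen's inequality for the square root, from the nonnegativity of the variance of \<open>sqrt Y\<close>.\<close>

lemma (in prob_space) expectation_sqrt_le:
  fixes Y :: "'a \<Rightarrow> real"
  assumes int: "integrable M Y" and nonneg: "\<And>\<omega>. 0 \<le> Y \<omega>"
  shows "integrable M (\<lambda>\<omega>. sqrt (Y \<omega>))" "expectation (\<lambda>\<omega>. sqrt (Y \<omega>)) \<le> sqrt (expectation Y)"
proof -
  have [measurable]: "Y \<in> borel_measurable M" using int by simp
  show int': "integrable M (\<lambda>\<omega>. sqrt (Y \<omega>))"
  proof (rule Bochner_Integration.integrable_bound)
    show "integrable M (\<lambda>\<omega>. 1 + Y \<omega>)" using int by simp
    have "sqrt y \<le> 1 + y" if "0 \<le> y" for y :: real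
    proof (rule real_le_lsqrt)
      show "y \<le> (1 + y)\<^sup>2" using that by (simp add: power2_eq_square algebra_simps)
    qed (use that in auto)
    then show "AE \<omega> in M. norm (sqrt (Y \<omega>)) \<le> norm (1 + Y \<omega>)"
      using nonneg by (intro AE_I2) (simp add: add_nonneg_nonneg)
  qed simp
  have "0 \<le> variance (\<lambda>\<omega>. sqrt (Y \<omega>))" by (intro integral_nonneg_AE) simp
  also have "\<dots> = expectation Y - (expectation (\<lambda>\<omega>. sqrt (Y \<omega>)))\<^sup>2"
    using int int' nonneg by (subst variance_eq) simp_all
  finally show "expectation (\<lambda>\<omega>. sqrt (Y \<omega>)) \<le> sqrt (expectation Y)"
    by (intro real_le_rsqrt) simp
qed

section \<open>Expected error of the reward estimates\<close>

text \<open>The law of the rewards of one agent across states is arbitrary; independence is between pairs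
  of an agent and a time.\<close>

locale reward_sampling = gossip_modes N E L u d k0 \<eta> \<zeta> s + prob_space M
  for N E L u d k0 \<eta> \<zeta> s and M :: "'w measure" +
  fixes n T0 :: nat and r \<sigma> :: "nat \<Rightarrow> nat \<Rightarrow> real" and R :: "nat \<Rightarrow> nat \<Rightarrow> nat \<Rightarrow> 'w \<Rightarrow> real"
  assumes T0: "0 < T0"
    and R_int: "\<And>i t j. i < N \<Longrightarrow> j < n \<Longrightarrow> integrable M (R i t j)"
    and R_sq: "\<And>i t j. i < N \<Longrightarrow> j < n \<Longrightarrow> integrable M (\<lambda>\<omega>. (R i t j \<omega>)\<^sup>2)"
    and R_mean: "\<And>i t j. i < N \<Longrightarrow> j < n \<Longrightarrow> expectation (R i t j) = r i j"
    and R_var: "\<And>i t j. i < N \<Longrightarrow> j < n \<Longrightarrow> variance (R i t j) = (\<sigma> i j)\<^sup>2"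
    and R_indep: "indep_vars (\<lambda>_. Pi\<^sub>M {..<n} (\<lambda>_. borel))
       (\<lambda>(i, t) \<omega>. \<lambda>j\<in>{..<n}. R i t j \<omega>) ({..<N} \<times> UNIV)"
begin

definition reward_noise :: "nat \<Rightarrow> 'w \<Rightarrow> nat \<Rightarrow> nat \<Rightarrow> real" where
  "reward_noise j \<omega> i t = R i t j \<omega> - r i j"

lemma second_moment_weighted_noise:
  assumes j: "j < n"
  shows "integrable M (\<lambda>\<omega>. (\<Sum>t<T. \<Sum>i<N. c t i * reward_noise j \<omega> i t)\<^sup>2)"
    "expectation (\<lambda>\<omega>. (\<Sum>t<T. \<Sum>i<N. c t i * reward_noise j \<omega> i t)\<^sup>2) = (\<Sum>t<T. \<Sum>i<N. (c t i)\<^sup>2 * (\<sigma> i j)\<^sup>2)"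
proof -
  define I where "I = {..<N} \<times> {..<T}"
  define Y where "Y = (\<lambda>p \<omega>. reward_noise j \<omega> (fst p) (snd p))"
  have "indep_vars (\<lambda>_. Pi\<^sub>M {..<n} (\<lambda>_. borel)) (\<lambda>(i, t) \<omega>. \<lambda>j\<in>{..<n}. R i t j \<omega>) I"
    by (rule indep_vars_subset[OF R_indep]) (auto simp: I_def)
  then have "indep_vars (\<lambda>_. borel) (\<lambda>p \<omega>. (\<lambda>x. x j - r (fst p) j) ((\<lambda>(i, t) \<omega>. \<lambda>j\<in>{..<n}. R i t j \<omega>) p \<omega>)) I"
    by (rule indep_vars_compose2) (use j in \<open>auto intro!: borel_measurable_diff measurable_component_singleton\<close>)
  then have ind: "indep_vars (\<lambda>_. borel) Y I"
    using j by (simp add: Y_def reward_noise_def case_prod_beta)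
  have Y: "integrable M (Y p)" "expectation (Y p) = 0" "integrable M (\<lambda>\<omega>. (Y p \<omega>)\<^sup>2)"
      "expectation (\<lambda>\<omega>. (Y p \<omega>)\<^sup>2) = (\<sigma> (fst p) j)\<^sup>2" if "p \<in> I" for p
  proof -
    have i: "fst p < N" using that by (auto simp: I_def)
    note int = R_int[OF i j, of "snd p"] R_sq[OF i j, of "snd p"]
    show "integrable M (Y p)" "expectation (Y p) = 0"
      using int R_mean[OF i j] by (simp_all add: Y_def reward_noise_def prob_space)
    show "integrable M (\<lambda>\<omega>. (Y p \<omega>)\<^sup>2)"
      using int by (simp add: Y_def reward_noise_def power2_diff)
    show "expectation (\<lambda>\<omega>. (Y p \<omega>)\<^sup>2) = (\<sigma> (fst p) j)\<^sup>2"
      using R_var[OF i j, of "snd p"] by (simp add: Y_def reward_noise_def R_mean[OF i j])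
  qed
  have reorder: "(\<Sum>t<T. \<Sum>i<N. g i t) = (\<Sum>p\<in>I. g (fst p) (snd p))" for g :: "nat \<Rightarrow> nat \<Rightarrow> real"
    unfolding I_def by (subst sum.swap) (simp add: sum.cartesian_product case_prod_beta)
  note m = second_moment_indep_sum[OF _ ind Y(1,3,2), of "\<lambda>p. c (snd p) (fst p)"]
  have I: "finite I" by (simp add: I_def)
  show "integrable M (\<lambda>\<omega>. (\<Sum>t<T. \<Sum>i<N. c t i * reward_noise j \<omega> i t)\<^sup>2)"
    unfolding reorder using m(1)[OF I] by (simp add: Y_def)
  have "expectation (\<lambda>\<omega>. (\<Sum>t<T. \<Sum>i<N. c t i * reward_noise j \<omega> i t)\<^sup>2)
      = (\<Sum>p\<in>I. (c (snd p) (fst p))\<^sup>2 * expectation (\<lambda>\<omega>. (Y p \<omega>)\<^sup>2))"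
    unfolding reorder using m(2)[OF I] by (simp add: Y_def)
  also have "\<dots> = (\<Sum>p\<in>I. (c (snd p) (fst p))\<^sup>2 * (\<sigma> (fst p) j)\<^sup>2)"
    by (intro sum.cong refl) (simp add: Y(4))
  finally show "expectation (\<lambda>\<omega>. (\<Sum>t<T. \<Sum>i<N. c t i * reward_noise j \<omega> i t)\<^sup>2)
      = (\<Sum>t<T. \<Sum>i<N. (c t i)\<^sup>2 * (\<sigma> i j)\<^sup>2)"
    by (simp only: reorder)
qed

text \<open>Averaging over the window divides the variance by \<open>T0\<close>. The average over agents would gain a further
  factor \<open>N\<close>, which is given up.\<close>

lemma second_moment_consensus_noise:
  assumes j: "j < n"
  shows "integrable M (\<lambda>\<omega>. (consensus_noise T0 (reward_noise j \<omega>))\<^sup>2)"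
    "expectation (\<lambda>\<omega>. (consensus_noise T0 (reward_noise j \<omega>))\<^sup>2) \<le> Max ((\<lambda>i. (\<sigma> i j)\<^sup>2) ` {..<N}) / real T0"
proof -
  define c where "c = (\<lambda>t (i::nat). (if T0 \<le> t then 1 else 0) / (real T0 * real N))"
  define S where "S = Max ((\<lambda>i. (\<sigma> i j)\<^sup>2) ` {..<N})"
  have N: "0 < N" using k0 by simp
  have S: "(\<sigma> i j)\<^sup>2 \<le> S" if "i < N" for i unfolding S_def using that by (intro Max_ge) auto
  have S0: "0 \<le> S" using S[OF N] zero_le_power2 order.trans by blast
  have eq: "consensus_noise T0 f = (\<Sum>t<2 * T0. \<Sum>i<N. c t i * f i t)" for f
  proof -
    have "(\<Sum>t<2 * T0. \<Sum>i<N. c t i * f i t) = (\<Sum>t = T0..<2 * T0. (\<Sum>i<N. f i t) / (real T0 * real N))"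
      by (rule sum.mono_neutral_cong_right) (auto simp: c_def sum_divide_distrib)
    then show ?thesis by (simp add: consensus_noise_def sum_divide_distrib)
  qed
  show "integrable M (\<lambda>\<omega>. (consensus_noise T0 (reward_noise j \<omega>))\<^sup>2)"
    unfolding eq by (rule second_moment_weighted_noise[OF j])
  have "expectation (\<lambda>\<omega>. (consensus_noise T0 (reward_noise j \<omega>))\<^sup>2) = (\<Sum>t<2 * T0. \<Sum>i<N. (c t i)\<^sup>2 * (\<sigma> i j)\<^sup>2)"
    unfolding eq by (rule second_moment_weighted_noise[OF j])
  also have "\<dots> \<le> (\<Sum>t<2 * T0. \<Sum>i<N. (c t i)\<^sup>2 * S)"
    using S by (intro sum_mono mult_left_mono) auto
  also have "\<dots> = (\<Sum>t = T0..<2 * T0. S / ((real T0)\<^sup>2 * real N))"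
    using N by (intro sum.mono_neutral_cong_right) (auto simp: c_def power_divide power_mult_distrib power2_eq_square)
  also have "\<dots> = S / real T0 / real N"
    using T0 by (simp add: power2_eq_square)
  also have "\<dots> \<le> S / real T0 / 1"
    using S0 N T0 by (intro divide_left_mono) auto
  finally show "expectation (\<lambda>\<omega>. (consensus_noise T0 (reward_noise j \<omega>))\<^sup>2) \<le> S / real T0" by simp
qed

lemma second_moment_mode_noise:
  assumes j: "j < n" and k: "k < N" "k \<noteq> k0"
  shows "integrable M (\<lambda>\<omega>. (mode_noise T0 (reward_noise j \<omega>) k)\<^sup>2)"
    "expectation (\<lambda>\<omega>. (mode_noise T0 (reward_noise j \<omega>) k)\<^sup>2)
       \<le> 64 * s / (real T0)\<^sup>2 * (\<Sum>i<N. (u k i)\<^sup>2 * (\<sigma> i j)\<^sup>2)"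
proof -
  define c where "c = (\<lambda>t i. gain T0 k t * u k i / real T0)"
  have eq: "mode_noise T0 f k = (\<Sum>t<2 * T0. \<Sum>i<N. c t i * f i t)" for f
    by (simp add: mode_noise_def c_def sum_divide_distrib sum_distrib_left mult.assoc)
  show "integrable M (\<lambda>\<omega>. (mode_noise T0 (reward_noise j \<omega>) k)\<^sup>2)"
    unfolding eq by (rule second_moment_weighted_noise[OF j])
  have "expectation (\<lambda>\<omega>. (mode_noise T0 (reward_noise j \<omega>) k)\<^sup>2) = (\<Sum>t<2 * T0. \<Sum>i<N. (c t i)\<^sup>2 * (\<sigma> i j)\<^sup>2)"
    unfolding eq by (rule second_moment_weighted_noise[OF j])
  also have "\<dots> = (\<Sum>t<2 * T0. (gain T0 k t)\<^sup>2 * ((\<Sum>i<N. (u k i)\<^sup>2 * (\<sigma> i j)\<^sup>2) / (real T0)\<^sup>2))"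
    by (simp add: c_def power_divide power_mult_distrib sum_divide_distrib sum_distrib_left mult_ac)
  also have "\<dots> = (\<Sum>t<2 * T0. (gain T0 k t)\<^sup>2) * ((\<Sum>i<N. (u k i)\<^sup>2 * (\<sigma> i j)\<^sup>2) / (real T0)\<^sup>2)"
    by (simp only: sum_distrib_right)
  also have "\<dots> \<le> 64 * s * ((\<Sum>i<N. (u k i)\<^sup>2 * (\<sigma> i j)\<^sup>2) / (real T0)\<^sup>2)"
    by (intro mult_right_mono sum_gain_square_le k divide_nonneg_nonneg sum_nonneg) auto
  finally show "expectation (\<lambda>\<omega>. (mode_noise T0 (reward_noise j \<omega>) k)\<^sup>2)
       \<le> 64 * s / (real T0)\<^sup>2 * (\<Sum>i<N. (u k i)\<^sup>2 * (\<sigma> i j)\<^sup>2)" by simp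
qed

text \<open>One random variable bounds the error of all agents in all states: the contribution of the modes
  other than \<open>k0\<close> to one entry is at most its Euclidean norm over all agents and states, to which
  Parseval's identity applies.\<close>

lemma reward_estimate_expectation:
  obtains U where "integrable M U"
    "expectation U \<le> 6 * exp (- (real T0 / s)) * sqrt (\<Sum>i<N. \<Sum>j<n. (r i j - (\<Sum>i<N. r i j) / real N)\<^sup>2)
       + 8 * sqrt s * sqrt (\<Sum>i<N. \<Sum>j<n. (\<sigma> i j)\<^sup>2) / real T0
       + sqrt (\<Sum>j<n. Max ((\<lambda>i. (\<sigma> i j)\<^sup>2) ` {..<N})) / sqrt (real T0)"
    "\<And>i j \<omega>. i < N \<Longrightarrow> j < n \<Longrightarrow>
       \<bar>sda_output n E L \<eta> \<zeta> (2 * T0) T0 (\<lambda>i t j. R i t j \<omega>) i $ j - (\<Sum>i<N. r i j) / real N\<bar> \<le> U \<omega>"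
proof -
  define K where "K = {..<N} - {k0}"
  have K: "K \<subseteq> {..<N}" by (auto simp: K_def)
  define x where "x = (\<lambda>j i. r i j - (\<Sum>i<N. r i j) / real N)"
  define A where "A = (\<lambda>\<omega>. \<Sum>j<n. (consensus_noise T0 (reward_noise j \<omega>))\<^sup>2)"
  define B where "B = (\<Sum>j<n. \<Sum>k\<in>K. (mode_bias T0 (x j) k)\<^sup>2)"
  define C where "C = (\<lambda>\<omega>. \<Sum>j<n. \<Sum>k\<in>K. (mode_noise T0 (reward_noise j \<omega>) k)\<^sup>2)"
  define U where "U = (\<lambda>\<omega>. sqrt (A \<omega>) + sqrt B + sqrt (C \<omega>))"
  have mode: "\<bar>\<Sum>k\<in>K. u k i * b j k\<bar> \<le> sqrt (\<Sum>j<n. \<Sum>k\<in>K. (b j k)\<^sup>2)" if "i < N" "j < n" for i j and b :: "nat \<Rightarrow> nat \<Rightarrow> real"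
  proof (rule real_le_rsqrt)
    have "\<bar>\<Sum>k\<in>K. u k i * b j k\<bar>\<^sup>2 \<le> (\<Sum>i<N. (\<Sum>k\<in>K. u k i * b j k)\<^sup>2)"
      using that(1) by (subst power2_abs, intro member_le_sum) auto
    also have "\<dots> = (\<Sum>k\<in>K. (b j k)\<^sup>2)" by (rule parseval[OF K])
    also have "\<dots> \<le> (\<Sum>j<n. \<Sum>k\<in>K. (b j k)\<^sup>2)"
      using that(2) by (intro member_le_sum[of j "{..<n}" "\<lambda>j. \<Sum>k\<in>K. (b j k)\<^sup>2"]) (auto intro: sum_nonneg)
    finally show "\<bar>\<Sum>k\<in>K. u k i * b j k\<bar>\<^sup>2 \<le> (\<Sum>j<n. \<Sum>k\<in>K. (b j k)\<^sup>2)" .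
  qed
  have bound: "\<bar>sda_output n E L \<eta> \<zeta> (2 * T0) T0 (\<lambda>i t j. R i t j \<omega>) i $ j - (\<Sum>i<N. r i j) / real N\<bar> \<le> U \<omega>"
    if ij: "i < N" "j < n" for i j \<omega>
  proof -
    have cons: "\<bar>consensus_noise T0 (reward_noise j \<omega>)\<bar> \<le> sqrt (A \<omega>)"
    proof (rule real_le_rsqrt)
      show "\<bar>consensus_noise T0 (reward_noise j \<omega>)\<bar>\<^sup>2 \<le> A \<omega>"
        unfolding A_def power2_abs using ij(2) by (intro member_le_sum) auto
    qed
    have "sda_output n E L \<eta> \<zeta> (2 * T0) T0 (\<lambda>i t j. R i t j \<omega>) i $ j - (\<Sum>i<N. r i j) / real N
        = consensus_noise T0 (reward_noise j \<omega>) + (\<Sum>k\<in>K. u k i * mode_bias T0 (x j) k) + (\<Sum>k\<in>K. u k i * mode_noise T0 (reward_noise j \<omega>) k)"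
      using sda_error_decomposition[OF ij T0, of "\<lambda>i t j. R i t j \<omega>" r] unfolding K_def x_def reward_noise_def[abs_def] by simp
    then show ?thesis
      using cons mode[OF ij, of "\<lambda>j. mode_bias T0 (x j)"] mode[OF ij, of "\<lambda>j. mode_noise T0 (reward_noise j \<omega>)"]
      unfolding U_def B_def C_def by linarith
  qed
  have intA: "integrable M A" unfolding A_def
    by (intro Bochner_Integration.integrable_sum second_moment_consensus_noise) auto
  have intC: "integrable M C" unfolding C_def
    by (intro Bochner_Integration.integrable_sum second_moment_mode_noise) (auto simp: K_def)
  have A0: "0 \<le> A \<omega>" and C0: "0 \<le> C \<omega>" for \<omega> by (auto simp: A_def C_def intro!: sum_nonneg)
  note sA = expectation_sqrt_le[OF intA A0] and sC = expectation_sqrt_le[OF intC C0]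
  have EA: "expectation A \<le> (\<Sum>j<n. Max ((\<lambda>i. (\<sigma> i j)\<^sup>2) ` {..<N})) / real T0"
    unfolding A_def sum_divide_distrib
    by (subst Bochner_Integration.integral_sum) (auto intro!: sum_mono second_moment_consensus_noise)
  have EC: "expectation C \<le> 64 * s / (real T0)\<^sup>2 * (\<Sum>i<N. \<Sum>j<n. (\<sigma> i j)\<^sup>2)"
  proof -
    have total: "(\<Sum>j<n. \<Sum>k<N. \<Sum>i<N. (u k i)\<^sup>2 * (\<sigma> i j)\<^sup>2) = (\<Sum>i<N. \<Sum>j<n. (\<sigma> i j)\<^sup>2)"
    proof -
      have "(\<Sum>k<N. \<Sum>i<N. (u k i)\<^sup>2 * (\<sigma> i j)\<^sup>2) = (\<Sum>i<N. (\<sigma> i j)\<^sup>2)" for j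
      proof -
        have "(\<Sum>k<N. \<Sum>i<N. (u k i)\<^sup>2 * (\<sigma> i j)\<^sup>2) = (\<Sum>i<N. (\<Sum>k<N. u k i * u k i) * (\<sigma> i j)\<^sup>2)"
          by (subst sum.swap) (simp add: sum_distrib_right power2_eq_square)
        also have "\<dots> = (\<Sum>i<N. (\<sigma> i j)\<^sup>2)" by (intro sum.cong refl) (simp add: cols)
        finally show ?thesis .
      qed
      then show ?thesis by (simp only: sum.swap[of _ "{..<n}" "{..<N}"])
    qed
    have "expectation C = (\<Sum>j<n. \<Sum>k\<in>K. expectation (\<lambda>\<omega>. (mode_noise T0 (reward_noise j \<omega>) k)\<^sup>2))"
      unfolding C_def
      by (subst Bochner_Integration.integral_sum, (intro Bochner_Integration.integrable_sum second_moment_mode_noise; auto simp: K_def),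
          intro sum.cong refl, subst Bochner_Integration.integral_sum, (intro second_moment_mode_noise; auto simp: K_def)) simp
    also have "\<dots> \<le> (\<Sum>j<n. \<Sum>k\<in>K. 64 * s / (real T0)\<^sup>2 * (\<Sum>i<N. (u k i)\<^sup>2 * (\<sigma> i j)\<^sup>2))"
      by (intro sum_mono second_moment_mode_noise) (auto simp: K_def)
    also have "\<dots> \<le> (\<Sum>j<n. \<Sum>k<N. 64 * s / (real T0)\<^sup>2 * (\<Sum>i<N. (u k i)\<^sup>2 * (\<sigma> i j)\<^sup>2))"
      using s by (intro sum_mono sum_mono2) (auto simp: K_def intro!: divide_nonneg_nonneg mult_nonneg_nonneg sum_nonneg)
    also have "\<dots> = 64 * s / (real T0)\<^sup>2 * (\<Sum>j<n. \<Sum>k<N. \<Sum>i<N. (u k i)\<^sup>2 * (\<sigma> i j)\<^sup>2)"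
      by (simp only: sum_distrib_left)
    finally show ?thesis by (simp only: total)
  qed
  have B: "B \<le> (6 * exp (- (real T0 / s)))\<^sup>2 * (\<Sum>i<N. \<Sum>j<n. (x j i)\<^sup>2)"
  proof -
    have "B \<le> (\<Sum>j<n. (6 * exp (- (real T0 / s)))\<^sup>2 * (\<Sum>i<N. (x j i)\<^sup>2))"
      unfolding B_def K_def by (intro sum_mono mode_bias_square_sum_le T0)
    moreover have "(\<Sum>j<n. \<Sum>i<N. (x j i)\<^sup>2) = (\<Sum>i<N. \<Sum>j<n. (x j i)\<^sup>2)" by (rule sum.swap)
    ultimately show ?thesis by (simp only: sum_distrib_left[symmetric])
  qed
  have "integrable M U" unfolding U_def using sA(1) sC(1) by simp
  moreover have "expectation U \<le> 6 * exp (- (real T0 / s)) * sqrt (\<Sum>i<N. \<Sum>j<n. (r i j - (\<Sum>i<N. r i j) / real N)\<^sup>2)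
       + 8 * sqrt s * sqrt (\<Sum>i<N. \<Sum>j<n. (\<sigma> i j)\<^sup>2) / real T0
       + sqrt (\<Sum>j<n. Max ((\<lambda>i. (\<sigma> i j)\<^sup>2) ` {..<N})) / sqrt (real T0)"
  proof -
    have "expectation U = expectation (\<lambda>\<omega>. sqrt (A \<omega>)) + sqrt B + expectation (\<lambda>\<omega>. sqrt (C \<omega>))"
      unfolding U_def using sA(1) sC(1) by (simp add: prob_space)
    moreover have "expectation (\<lambda>\<omega>. sqrt (A \<omega>)) \<le> sqrt (\<Sum>j<n. Max ((\<lambda>i. (\<sigma> i j)\<^sup>2) ` {..<N})) / sqrt (real T0)"
      using order.trans[OF sA(2) real_sqrt_le_mono[OF EA]] by (simp add: real_sqrt_divide)
    moreover have "sqrt B \<le> 6 * exp (- (real T0 / s)) * sqrt (\<Sum>i<N. \<Sum>j<n. (x j i)\<^sup>2)"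
      using real_sqrt_le_mono[OF B] by (simp add: real_sqrt_mult)
    moreover have "expectation (\<lambda>\<omega>. sqrt (C \<omega>)) \<le> 8 * sqrt s * sqrt (\<Sum>i<N. \<Sum>j<n. (\<sigma> i j)\<^sup>2) / real T0"
    proof -
      have "sqrt 64 = (8::real)" by (rule real_sqrt_unique) auto
      then show ?thesis
        using order.trans[OF sC(2) real_sqrt_le_mono[OF EC]] by (simp add: real_sqrt_mult real_sqrt_divide)
    qed
    ultimately show ?thesis by (simp add: x_def)
  qed
  ultimately show thesis using that bound by blast
qed

lemma measurable_sda_output:
  assumes "i < N" "j < n"
  shows "(\<lambda>\<omega>. sda_output n E L \<eta> \<zeta> (2 * T0) T0 (\<lambda>i t j. R i t j \<omega>) i $ j) \<in> borel_measurable M"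
proof -
  have [measurable]: "R i t j \<in> borel_measurable M" if "i < N" for i t
    using R_int[OF that assms(2)] by simp
  show ?thesis
    unfolding sda_output_modes[OF assms]
    by (intro borel_measurable_sum borel_measurable_times borel_measurable_divide borel_measurable_const) auto
qed

end

section \<open>Resolvents of stochastic matrices\<close>

lemma stochastic_matrixD:
  assumes "stochastic_matrix n P"
  shows "P \<in> carrier_mat n n" "\<And>j k. j < n \<Longrightarrow> k < n \<Longrightarrow> 0 \<le> P $$ (j, k)"
    "\<And>j. j < n \<Longrightarrow> (\<Sum>k<n. P $$ (j, k)) = 1"
  using assms by (auto simp: stochastic_matrix_def)

text \<open>At an index where \<open>x\<close> is maximal, the average of \<open>x\<close> is at most \<open>x\<close>. Applied to differences, this
  replaces both the monotonicity of the resolvent and its bound in the supremum norm.\<close>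

lemma resolvent_maximum_principle:
  fixes x :: "nat \<Rightarrow> real"
  assumes P: "stochastic_matrix n P" and \<gamma>: "0 \<le> \<gamma>" "\<gamma> < 1"
    and x: "\<And>j. j < n \<Longrightarrow> x j - \<gamma> * (\<Sum>k<n. P $$ (j, k) * x k) \<le> c"
    and j: "j < n"
  shows "x j \<le> c / (1 - \<gamma>)"
proof -
  define m where "m = Max (x ` {..<n})"
  have "m \<in> x ` {..<n}" unfolding m_def using j by (intro Max_in) auto
  then obtain i where i: "i < n" "x i = m" by auto
  have le: "x k \<le> m" if "k < n" for k unfolding m_def using that by (intro Max_ge) auto
  have "(\<Sum>k<n. P $$ (i, k) * x k) \<le> (\<Sum>k<n. P $$ (i, k) * m)"
    using stochastic_matrixD(2)[OF P] i le by (intro sum_mono mult_left_mono) auto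
  also have "\<dots> = m"
    using stochastic_matrixD(3)[OF P i(1)] by (simp add: sum_distrib_right[symmetric])
  finally have "\<gamma> * (\<Sum>k<n. P $$ (i, k) * x k) \<le> \<gamma> * m" using \<gamma> by (intro mult_left_mono)
  then have "m * (1 - \<gamma>) \<le> c" using x[OF i(1)] i(2) by (simp add: algebra_simps)
  then have "m \<le> c / (1 - \<gamma>)" using \<gamma> by (simp add: pos_le_divide_eq)
  then show ?thesis using le[OF j] by simp
qed

lemma resolvent_bound:
  fixes x :: "nat \<Rightarrow> real"
  assumes P: "stochastic_matrix n P" and \<gamma>: "0 \<le> \<gamma>" "\<gamma> < 1"
    and x: "\<And>j. j < n \<Longrightarrow> \<bar>x j - \<gamma> * (\<Sum>k<n. P $$ (j, k) * x k)\<bar> \<le> c"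
    and j: "j < n"
  shows "\<bar>x j\<bar> \<le> c / (1 - \<gamma>)"
proof -
  have "x j \<le> c / (1 - \<gamma>)"
    by (rule resolvent_maximum_principle[OF P \<gamma> _ j]) (use x in \<open>auto simp: abs_le_iff\<close>)
  moreover have "- x j \<le> c / (1 - \<gamma>)"
  proof (rule resolvent_maximum_principle[OF P \<gamma> _ j])
    fix i assume "i < n"
    then show "- x i - \<gamma> * (\<Sum>k<n. P $$ (i, k) * - x k) \<le> c"
      using x[of i] by (simp add: sum_negf abs_le_iff)
  qed
  ultimately show ?thesis by (simp add: abs_le_iff)
qed

text \<open>The maximum principle makes \<open>I - \<gamma> P\<close> injective, hence invertible. The last part shows that
  value functions are linear in the rewards, with coefficients that depend on the transition matrix
  alone.\<close>

lemma value_function_solves: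
  assumes P: "stochastic_matrix n P" and \<gamma>: "0 \<le> \<gamma>" "\<gamma> < 1" and v: "v \<in> carrier_vec n"
  shows "value_function n \<gamma> P v \<in> carrier_vec n"
    "\<And>j. j < n \<Longrightarrow> value_function n \<gamma> P v $ j
        - \<gamma> * (\<Sum>k<n. P $$ (j, k) * value_function n \<gamma> P v $ k) = v $ j"
    "\<And>j. j < n \<Longrightarrow> value_function n \<gamma> P v $ j
        = (\<Sum>k<n. the (mat_inverse (1\<^sub>m n - \<gamma> \<cdot>\<^sub>m P)) $$ (j, k) * v $ k)"
proof -
  define A where "A = 1\<^sub>m n - \<gamma> \<cdot>\<^sub>m P"
  have cP: "P \<in> carrier_mat n n" using P by (rule stochastic_matrixD)
  then have A: "A \<in> carrier_mat n n" by (auto simp: A_def)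
  have A_apply: "(A *\<^sub>v x) $ j = x $ j - \<gamma> * (\<Sum>k<n. P $$ (j, k) * x $ k)"
    if "x \<in> carrier_vec n" "j < n" for x j
  proof -
    have "(A *\<^sub>v x) $ j = (\<Sum>k<n. A $$ (j, k) * x $ k)"
      using that A by (simp add: scalar_prod_def lessThan_atLeast0)
    also have "\<dots> = (\<Sum>k<n. (if k = j then x $ k else 0) - \<gamma> * (P $$ (j, k) * x $ k))"
      using that cP by (intro sum.cong) (auto simp: A_def algebra_simps)
    finally show ?thesis using that by (simp add: sum_subtractf sum_distrib_left)
  qed
  have "det A \<noteq> 0"
  proof
    assume "det A = 0"
    then obtain x where x: "x \<in> carrier_vec n" "x \<noteq> 0\<^sub>v n" "A *\<^sub>v x = 0\<^sub>v n"
      using det_0_iff_vec_prod_zero_field[OF A] by auto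
    have "\<bar>x $ j\<bar> \<le> 0 / (1 - \<gamma>)" if "j < n" for j
    proof (rule resolvent_bound[OF P \<gamma> _ that])
      fix i assume "i < n"
      then show "\<bar>x $ i - \<gamma> * (\<Sum>k<n. P $$ (i, k) * x $ k)\<bar> \<le> 0"
        using A_apply[OF x(1), of i] x(3) by simp
    qed
    then have "x = 0\<^sub>v n" using x(1) by (intro eq_vecI) auto
    with x(2) show False by simp
  qed
  then have "A \<in> Units (ring_mat TYPE(real) n ())"
    by (rule det_non_zero_imp_unit[OF A])
  then obtain B where B: "mat_inverse A = Some B"
    using mat_inverse(1)[OF A, of "()"] by (cases "mat_inverse A") auto
  then have AB: "A * B = 1\<^sub>m n" and cB: "B \<in> carrier_mat n n"
    using mat_inverse(2)[OF A] by auto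
  have vf: "value_function n \<gamma> P v = B *\<^sub>v v"
    by (simp add: value_function_def A_def[symmetric] B)
  show c: "value_function n \<gamma> P v \<in> carrier_vec n" using cB v by (simp add: vf)
  have "A *\<^sub>v (B *\<^sub>v v) = (A * B) *\<^sub>v v" using A cB v by simp
  then have "A *\<^sub>v value_function n \<gamma> P v = v" using v by (simp add: AB vf)
  then show "value_function n \<gamma> P v $ j
        - \<gamma> * (\<Sum>k<n. P $$ (j, k) * value_function n \<gamma> P v $ k) = v $ j" if "j < n" for j
    using A_apply[OF c that] by simp
  show "value_function n \<gamma> P v $ j
        = (\<Sum>k<n. the (mat_inverse (1\<^sub>m n - \<gamma> \<cdot>\<^sub>m P)) $$ (j, k) * v $ k)" if "j < n" for j
    using that cB v by (simp add: vf A_def[symmetric] B scalar_prod_def lessThan_atLeast0)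
qed

definition transition_variance :: "nat \<Rightarrow> real mat \<Rightarrow> (nat \<Rightarrow> real) \<Rightarrow> nat \<Rightarrow> real" where
  "transition_variance n P V j
     = (\<Sum>k<n. P $$ (j, k) * (V k)\<^sup>2) - (\<Sum>k<n. P $$ (j, k) * V k)\<^sup>2"

text \<open>The total-variance argument, carried out with the resolvent of the sampled matrix \<open>Q\<close>, where \<open>f\<close> is
  the discounted sum of the one-step variances of \<open>V\<close>. The quantity \<open>f / 2 + J\<^sup>2\<close> is a subsolution:
  the Bellman equation for \<open>J\<close> expresses the variance by \<open>J\<^sup>2\<close> and the rewards, up to the fluctuation
  of the second moments of \<open>V\<close>, half of which is absorbed into \<open>f\<close>.\<close>

lemma model_error_via_variance:
  fixes J K V f r :: "nat \<Rightarrow> real"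
  assumes P: "stochastic_matrix n P" and Q: "stochastic_matrix n Q" and \<gamma>: "0 \<le> \<gamma>" "\<gamma> < 1"
    and r: "\<And>j. j < n \<Longrightarrow> \<bar>r j\<bar> \<le> 1"
    and J: "\<And>j. j < n \<Longrightarrow> J j - \<gamma> * (\<Sum>k<n. P $$ (j, k) * J k) = r j"
    and K: "\<And>j. j < n \<Longrightarrow> K j - \<gamma> * (\<Sum>k<n. Q $$ (j, k) * K k) = r j"
    and V: "V = (\<lambda>k. \<gamma> * J k)"
    and f: "\<And>j. j < n \<Longrightarrow> f j - \<gamma> * (\<Sum>k<n. Q $$ (j, k) * f k) = transition_variance n P V j"
    and first: "\<And>j. j < n \<Longrightarrow> \<bar>(\<Sum>k<n. Q $$ (j, k) * V k) - (\<Sum>k<n. P $$ (j, k) * V k)\<bar>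
        \<le> a * transition_variance n P V j + Z"
    and second: "\<And>j. j < n \<Longrightarrow> \<bar>(\<Sum>k<n. Q $$ (j, k) * (V k)\<^sup>2) - (\<Sum>k<n. P $$ (j, k) * (V k)\<^sup>2)\<bar>
        \<le> transition_variance n P V j / 2 + Z2"
    and a: "0 \<le> a" and j: "j < n"
  shows "\<bar>K j - J j\<bar> \<le> 2 * a * ((Z2 + 2 / (1 - \<gamma>)) / (1 - \<gamma>)) + Z / (1 - \<gamma>)"
proof -
  define H where "H = 1 / (1 - \<gamma>)"
  define w where "w = transition_variance n P V"
  have JH: "\<bar>J i\<bar> \<le> H" if "i < n" for i
    unfolding H_def by (rule resolvent_bound[OF P \<gamma> _ that]) (simp add: J r)
  have PV: "(\<Sum>k<n. P $$ (i, k) * V k) = J i - r i" if "i < n" for i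
  proof -
    have "(\<Sum>k<n. P $$ (i, k) * V k) = \<gamma> * (\<Sum>k<n. P $$ (i, k) * J k)"
      by (simp add: V sum_distrib_left mult_ac)
    then show ?thesis using J[OF that] by simp
  qed
  have f_le: "f i / 2 + (J i)\<^sup>2 \<le> (Z2 + 2 * H) / (1 - \<gamma>)" if i: "i < n" for i
  proof (rule resolvent_maximum_principle[OF Q \<gamma> _ i])
    fix i assume i: "i < n"
    have "(\<Sum>k<n. Q $$ (i, k) * (V k)\<^sup>2) = \<gamma>\<^sup>2 * (\<Sum>k<n. Q $$ (i, k) * (J k)\<^sup>2)"
      by (simp add: V sum_distrib_left power_mult_distrib mult_ac)
    also have "\<dots> \<le> \<gamma> * (\<Sum>k<n. Q $$ (i, k) * (J k)\<^sup>2)"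
      using \<gamma> stochastic_matrixD(2)[OF Q i] mult_left_mono[of \<gamma> 1 \<gamma>]
      by (intro mult_right_mono sum_nonneg) (auto simp: power2_eq_square)
    \<comment> \<open>One factor \<open>\<gamma>\<close> is given up here so that the bound fits the resolvent of \<open>Q\<close>.\<close>
    finally have "(\<Sum>k<n. P $$ (i, k) * (V k)\<^sup>2) \<le> \<gamma> * (\<Sum>k<n. Q $$ (i, k) * (J k)\<^sup>2) + w i / 2 + Z2"
      using second[OF i] by (simp add: w_def abs_le_iff)
    moreover have "w i = (\<Sum>k<n. P $$ (i, k) * (V k)\<^sup>2) - (J i - r i)\<^sup>2"
      by (simp add: w_def transition_variance_def PV[OF i])
    moreover have "(J i - r i)\<^sup>2 \<ge> (J i)\<^sup>2 - 2 * H"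
    proof -
      have "J i * r i \<le> \<bar>J i\<bar> * \<bar>r i\<bar>" by (metis abs_ge_self abs_mult)
      also have "\<dots> \<le> H * 1" using JH[OF i] r[OF i] by (intro mult_mono) auto
      finally have "J i * r i \<le> H" by simp
      moreover have "(J i - r i)\<^sup>2 = (J i)\<^sup>2 - 2 * (J i * r i) + (r i)\<^sup>2" by (simp add: power2_diff)
      ultimately show ?thesis using zero_le_power2[of "r i"] by linarith
    qed
    ultimately have "w i / 2 \<le> \<gamma> * (\<Sum>k<n. Q $$ (i, k) * (J k)\<^sup>2) - (J i)\<^sup>2 + Z2 + 2 * H" by linarith
    moreover have "(\<Sum>k<n. Q $$ (i, k) * (f k / 2 + (J k)\<^sup>2))
        = (\<Sum>k<n. Q $$ (i, k) * f k) / 2 + (\<Sum>k<n. Q $$ (i, k) * (J k)\<^sup>2)"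
      by (simp add: distrib_left sum.distrib flip: sum_divide_distrib)
    moreover have "w i / 2 = f i / 2 - \<gamma> * (\<Sum>k<n. Q $$ (i, k) * f k) / 2"
      using f[OF i] by (simp add: w_def diff_divide_distrib)
    ultimately show "f i / 2 + (J i)\<^sup>2 - \<gamma> * (\<Sum>k<n. Q $$ (i, k) * (f k / 2 + (J k)\<^sup>2)) \<le> Z2 + 2 * H"
      by (simp only: distrib_left)
  qed
  have bell: "(K i - J i) - \<gamma> * (\<Sum>k<n. Q $$ (i, k) * (K k - J k))
      = (\<Sum>k<n. Q $$ (i, k) * V k) - (\<Sum>k<n. P $$ (i, k) * V k)" if i: "i < n" for i
  proof -
    have "(\<Sum>k<n. Q $$ (i, k) * V k) = \<gamma> * (\<Sum>k<n. Q $$ (i, k) * J k)"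
      by (simp add: V sum_distrib_left mult_ac)
    then show ?thesis
      using K[OF i] PV[OF i] by (simp add: right_diff_distrib sum_subtractf)
  qed
  have dev: "\<sigma> * (K i - J i) - a * f i \<le> Z / (1 - \<gamma>)" if \<sigma>: "\<bar>\<sigma>\<bar> = 1" and i: "i < n" for \<sigma> :: real and i
  proof (rule resolvent_maximum_principle[OF Q \<gamma> _ i])
    fix i assume i: "i < n"
    have "(\<Sum>k<n. Q $$ (i, k) * (\<sigma> * (K k - J k) - a * f k))
        = (\<Sum>k<n. \<sigma> * (Q $$ (i, k) * (K k - J k)) - a * (Q $$ (i, k) * f k))"
      by (intro sum.cong refl) (simp add: algebra_simps)
    then have "(\<Sum>k<n. Q $$ (i, k) * (\<sigma> * (K k - J k) - a * f k))
        = \<sigma> * (\<Sum>k<n. Q $$ (i, k) * (K k - J k)) - a * (\<Sum>k<n. Q $$ (i, k) * f k)"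
      by (simp only: sum_subtractf sum_distrib_left)
    then have "\<sigma> * (K i - J i) - a * f i - \<gamma> * (\<Sum>k<n. Q $$ (i, k) * (\<sigma> * (K k - J k) - a * f k))
       = \<sigma> * ((K i - J i) - \<gamma> * (\<Sum>k<n. Q $$ (i, k) * (K k - J k)))
         - a * (f i - \<gamma> * (\<Sum>k<n. Q $$ (i, k) * f k))"
      by (simp only:) (simp add: algebra_simps)
    also have "\<dots> = \<sigma> * ((\<Sum>k<n. Q $$ (i, k) * V k) - (\<Sum>k<n. P $$ (i, k) * V k)) - a * w i"
      by (simp only: bell[OF i] f[OF i] w_def)
    also have "\<dots> \<le> \<bar>\<sigma> * ((\<Sum>k<n. Q $$ (i, k) * V k) - (\<Sum>k<n. P $$ (i, k) * V k))\<bar> - a * w i"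
      by simp
    also have "\<dots> \<le> Z" using first[OF i] \<sigma> by (simp add: abs_mult w_def)
    finally show "\<sigma> * (K i - J i) - a * f i - \<gamma> * (\<Sum>k<n. Q $$ (i, k) * (\<sigma> * (K k - J k) - a * f k)) \<le> Z" .
  qed
  have "\<bar>K j - J j\<bar> \<le> a * f j + Z / (1 - \<gamma>)"
    using dev[of 1, OF _ j] dev[of "-1", OF _ j] by (simp add: abs_le_iff)
  also have "f j \<le> 2 * ((Z2 + 2 * H) / (1 - \<gamma>))"
  proof -
    have "0 \<le> (J j)\<^sup>2" by simp
    then show ?thesis using f_le[OF j] by linarith
  qed
  then have "a * f j \<le> a * (2 * ((Z2 + 2 * H) / (1 - \<gamma>)))" using a by (rule mult_left_mono)
  finally have "\<bar>K j - J j\<bar> \<le> a * (2 * ((Z2 + 2 * H) / (1 - \<gamma>))) + Z / (1 - \<gamma>)" by simp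
  moreover have "2 * H = 2 / (1 - \<gamma>)" by (simp add: H_def)
  ultimately show ?thesis by (simp only: mult.assoc mult.left_commute[of a 2])
qed

section \<open>Expected error of the sampled transition model\<close>

lemma transition_variance_alt:
  assumes P: "stochastic_matrix n P" and j: "j < n"
  shows "(\<Sum>k<n. P $$ (j, k) * (v k - c)\<^sup>2)
      = transition_variance n P v j + ((\<Sum>k<n. P $$ (j, k) * v k) - c)\<^sup>2"
proof -
  have "(\<Sum>k<n. P $$ (j, k) * (v k - c)\<^sup>2)
      = (\<Sum>k<n. P $$ (j, k) * (v k)\<^sup>2 - 2 * c * (P $$ (j, k) * v k) + c\<^sup>2 * P $$ (j, k))"
    by (intro sum.cong refl) (simp add: power2_eq_square algebra_simps)
  also have "\<dots> = (\<Sum>k<n. P $$ (j, k) * (v k)\<^sup>2) - 2 * c * (\<Sum>k<n. P $$ (j, k) * v k) + c\<^sup>2 * (\<Sum>k<n. P $$ (j, k))"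
    by (simp only: sum.distrib sum_subtractf sum_distrib_left)
  finally show ?thesis
    using stochastic_matrixD(3)[OF P j] by (simp add: transition_variance_def power2_diff algebra_simps)
qed

lemma transition_variance_nonneg:
  assumes P: "stochastic_matrix n P" and j: "j < n"
  shows "0 \<le> transition_variance n P v j"
proof -
  have "0 \<le> (\<Sum>k<n. P $$ (j, k) * (v k - (\<Sum>k<n. P $$ (j, k) * v k))\<^sup>2)"
    using stochastic_matrixD(2)[OF P j] by (intro sum_nonneg) auto
  then show ?thesis by (simp add: transition_variance_alt[OF P j])
qed

lemma stochastic_average_bound:
  assumes P: "stochastic_matrix n P" and j: "j < n" and v: "\<And>k. k < n \<Longrightarrow> \<bar>v k\<bar> \<le> b"
  shows "\<bar>\<Sum>k<n. P $$ (j, k) * v k\<bar> \<le> b"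
proof -
  have "\<bar>\<Sum>k<n. P $$ (j, k) * v k\<bar> \<le> (\<Sum>k<n. P $$ (j, k) * b)"
    using stochastic_matrixD(2)[OF P j] v
    by (intro order.trans[OF sum_abs] sum_mono) (auto simp: abs_mult intro!: mult_left_mono)
  also have "\<dots> = b" using stochastic_matrixD(3)[OF P j] by (simp flip: sum_distrib_right)
  finally show ?thesis .
qed

text \<open>Squaring is Lipschitz with constant \<open>2 H\<close> on the interval from \<open>- H\<close> to \<open>H\<close>, and the variance is the
  least mean square deviation from a constant.\<close>

lemma transition_variance_square_le:
  assumes P: "stochastic_matrix n P" and j: "j < n" and v: "\<And>k. k < n \<Longrightarrow> \<bar>v k\<bar> \<le> H"
  shows "transition_variance n P (\<lambda>k. (v k)\<^sup>2) j \<le> 4 * H\<^sup>2 * transition_variance n P v j"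
proof -
  define c where "c = (\<Sum>k<n. P $$ (j, k) * v k)"
  have c: "\<bar>c\<bar> \<le> H" unfolding c_def by (rule stochastic_average_bound[OF P j v])
  have "transition_variance n P (\<lambda>k. (v k)\<^sup>2) j \<le> (\<Sum>k<n. P $$ (j, k) * ((v k)\<^sup>2 - c\<^sup>2)\<^sup>2)"
    by (simp add: transition_variance_alt[OF P j])
  also have "\<dots> \<le> (\<Sum>k<n. 4 * H\<^sup>2 * (P $$ (j, k) * (v k - c)\<^sup>2))"
  proof (intro sum_mono)
    fix k assume k: "k \<in> {..<n}"
    have "\<bar>v k + c\<bar> \<le> 2 * H" using v[of k] c k by auto
    then have "\<bar>v k + c\<bar>\<^sup>2 \<le> (2 * H)\<^sup>2" by (intro power_mono) auto
    then have "(v k - c)\<^sup>2 * (v k + c)\<^sup>2 \<le> (v k - c)\<^sup>2 * (4 * H\<^sup>2)"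
      by (intro mult_left_mono) (auto simp: power_mult_distrib)
    moreover have "((v k)\<^sup>2 - c\<^sup>2)\<^sup>2 = (v k - c)\<^sup>2 * (v k + c)\<^sup>2"
      by (simp add: power_mult_distrib[symmetric] power2_eq_square algebra_simps)
    ultimately have "((v k)\<^sup>2 - c\<^sup>2)\<^sup>2 \<le> 4 * H\<^sup>2 * (v k - c)\<^sup>2" by (simp add: mult_ac)
    then have "P $$ (j, k) * ((v k)\<^sup>2 - c\<^sup>2)\<^sup>2 \<le> P $$ (j, k) * (4 * H\<^sup>2 * (v k - c)\<^sup>2)"
      using stochastic_matrixD(2)[OF P j] k by (intro mult_left_mono) auto
    then show "P $$ (j, k) * ((v k)\<^sup>2 - c\<^sup>2)\<^sup>2 \<le> 4 * H\<^sup>2 * (P $$ (j, k) * (v k - c)\<^sup>2)"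
      by (simp only: mult_ac)
  qed
  also have "\<dots> = 4 * H\<^sup>2 * transition_variance n P v j"
    by (simp only: sum_distrib_left[symmetric] transition_variance_alt[OF P j] c_def[symmetric]) simp
  finally show ?thesis .
qed

lemma sample_transition_matrix_average:
  assumes j: "j < n" and x: "\<And>t. t < T \<Longrightarrow> x t j < n"
  shows "(\<Sum>k<n. sample_transition_matrix n T x $$ (j, k) * v k) = (\<Sum>t<T. v (x t j)) / real T"
proof -
  have "(\<Sum>k<n. sample_transition_matrix n T x $$ (j, k) * v k)
      = (\<Sum>k<n. \<Sum>t<T. (if k = x t j then v k else 0) / real T)"
    using j by (intro sum.cong refl)
      (auto simp: sample_transition_matrix_def transition_indicator_def sum_distrib_right
        sum_divide_distrib intro!: sum.cong)
  also have "\<dots> = (\<Sum>t<T. \<Sum>k<n. (if k = x t j then v k / real T else 0))"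
    by (subst sum.swap) (auto intro!: sum.cong)
  also have "\<dots> = (\<Sum>t<T. v (x t j) / real T)"
    using x by (intro sum.cong refl) simp
  finally show ?thesis by (simp add: sum_divide_distrib)
qed

lemma stochastic_sample_transition_matrix:
  assumes T: "0 < T" and x: "\<And>t j. t < T \<Longrightarrow> j < n \<Longrightarrow> x t j < n"
  shows "stochastic_matrix n (sample_transition_matrix n T x)"
proof -
  have ent: "sample_transition_matrix n T x $$ (j, k) = (\<Sum>t<T. if x t j = k then 1 else 0) / real T"
    if "j < n" "k < n" for j k
    using that by (simp add: sample_transition_matrix_def transition_indicator_def)
  have row: "(\<Sum>k<n. sample_transition_matrix n T x $$ (j, k)) = 1" if j: "j < n" for j
    using sample_transition_matrix_average[of j n T x "\<lambda>_. 1"] x j T by simp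
  have le: "(\<Sum>t<T. if x t j = k then 1 else (0::real)) \<le> real T" for j k
    using sum_mono[of "{..<T}" "\<lambda>t. if x t j = k then 1 else (0::real)" "\<lambda>_. 1"] by simp
  show ?thesis
    unfolding stochastic_matrix_def using row le T
    by (auto simp: ent sum_nonneg) (simp add: sample_transition_matrix_def)
qed

locale transition_sampling = prob_space M for M :: "'w measure" +
  fixes n :: nat and P :: "real mat" and X :: "nat \<Rightarrow> nat \<Rightarrow> 'w \<Rightarrow> nat" and T :: nat
  assumes P: "stochastic_matrix n P" and T: "0 < T" and n: "0 < n"
    and X_meas: "\<And>t j. j < n \<Longrightarrow> X t j \<in> measurable M (count_space {..<n})"
    and X_dist: "\<And>t j k. j < n \<Longrightarrow> k < n \<Longrightarrow> measure M {\<omega> \<in> space M. X t j \<omega> = k} = P $$ (j, k)"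
    and X_indep: "indep_vars (\<lambda>_. count_space {..<n}) (\<lambda>(t, j). X t j) (UNIV \<times> {..<n})"
begin

abbreviation P_hat :: "'w \<Rightarrow> real mat" where
  "P_hat \<omega> \<equiv> sample_transition_matrix n T (\<lambda>t j. X t j \<omega>)"

definition P_dev :: "(nat \<Rightarrow> real) \<Rightarrow> nat \<Rightarrow> 'w \<Rightarrow> real" where
  "P_dev v j \<omega> = (\<Sum>k<n. P_hat \<omega> $$ (j, k) * v k) - (\<Sum>k<n. P $$ (j, k) * v k)"

lemma X_less: "j < n \<Longrightarrow> \<omega> \<in> space M \<Longrightarrow> X t j \<omega> < n"
  using measurable_space[OF X_meas] by auto

lemma stochastic_P_hat: "\<omega> \<in> space M \<Longrightarrow> stochastic_matrix n (P_hat \<omega>)"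
  by (rule stochastic_sample_transition_matrix) (auto simp: T X_less)

lemma expectation_transition:
  assumes j: "j < n"
  shows "integrable M (\<lambda>\<omega>. v (X t j \<omega>))" "expectation (\<lambda>\<omega>. v (X t j \<omega>)) = (\<Sum>k<n. P $$ (j, k) * (v k :: real))"
proof -
  have ev: "{\<omega> \<in> space M. X t j \<omega> = k} \<in> events" for k
    using measurable_sets[OF X_meas[OF j], of "{k} \<inter> {..<n}" t] X_less[OF j]
    by (auto simp: vimage_def elim!: back_subst[of "\<lambda>A. A \<in> events"])
  have int: "integrable M (\<lambda>\<omega>. v k * indicator {\<omega> \<in> space M. X t j \<omega> = k} \<omega>)" for k
    using ev[of k] by (intro Bochner_Integration.integrable_mult_right integrable_real_indicator) (auto simp: emeasure_eq_measure)
  have eq: "v (X t j \<omega>) = (\<Sum>k<n. v k * indicator {\<omega> \<in> space M. X t j \<omega> = k} \<omega>)" if "\<omega> \<in> space M" for \<omega>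
  proof -
    have "(\<Sum>k<n. v k * indicator {\<omega> \<in> space M. X t j \<omega> = k} \<omega>) = (\<Sum>k<n. if k = X t j \<omega> then v k else 0)"
      using that by (intro sum.cong) (auto simp: indicator_def)
    then show ?thesis using X_less[OF j that] by simp
  qed
  show "integrable M (\<lambda>\<omega>. v (X t j \<omega>))"
    by (rule Bochner_Integration.integrable_cong[THEN iffD2, OF refl eq])
      (assumption, intro Bochner_Integration.integrable_sum int)
  have "expectation (\<lambda>\<omega>. v (X t j \<omega>)) = expectation (\<lambda>\<omega>. \<Sum>k<n. v k * indicator {\<omega> \<in> space M. X t j \<omega> = k} \<omega>)"
    by (intro Bochner_Integration.integral_cong refl eq)
  also have "\<dots> = (\<Sum>k<n. v k * measure M {\<omega> \<in> space M. X t j \<omega> = k})"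
    using ev by (subst Bochner_Integration.integral_sum[OF int]) (simp add: Int_absorb2 subset_eq)
  also have "\<dots> = (\<Sum>k<n. P $$ (j, k) * v k)"
    using X_dist[OF j] by (intro sum.cong) (auto simp: mult_ac)
  finally show "expectation (\<lambda>\<omega>. v (X t j \<omega>)) = (\<Sum>k<n. P $$ (j, k) * v k)" .
qed

text \<open>The deviation in row \<open>j\<close> is an average of \<open>T\<close> independent centered variables with variance
  \<^term>\<open>transition_variance n P v j\<close>.\<close>

lemma exp_moment_P_dev:
  assumes j: "j < n" and b: "\<And>k. k < n \<Longrightarrow> \<bar>v k - (\<Sum>k<n. P $$ (j, k) * v k)\<bar> \<le> b"
    and l: "\<bar>l\<bar> * b \<le> real T"
  shows "integrable M (\<lambda>\<omega>. exp (l * P_dev v j \<omega>))"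
    "expectation (\<lambda>\<omega>. exp (l * P_dev v j \<omega>)) \<le> exp (l\<^sup>2 * transition_variance n P v j / real T)"
proof -
  define \<mu> where "\<mu> = (\<Sum>k<n. P $$ (j, k) * v k)"
  define Y where "Y = (\<lambda>p \<omega>. v (X (fst p) (snd p) \<omega>) - \<mu>)"
  define I where "I = (\<lambda>t. (t, j)) ` {..<T}"
  have inj: "inj_on (\<lambda>t. (t, j)) {..<T}" by (auto intro: inj_onI)
  have I: "finite I" "card I = T" by (auto simp: I_def card_image[OF inj])
  have "indep_vars (\<lambda>_. count_space {..<n}) (\<lambda>(t, j). X t j) I"
    by (rule indep_vars_subset[OF X_indep]) (use j in \<open>auto simp: I_def\<close>)
  then have "indep_vars (\<lambda>_. borel) (\<lambda>p \<omega>. v ((\<lambda>(t, j). X t j) p \<omega>) - \<mu>) I"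
    by (rule indep_vars_compose2) auto
  then have ind: "indep_vars (\<lambda>_. borel) Y I"
    by (simp add: Y_def case_prod_beta)
  have bY: "\<bar>Y p \<omega>\<bar> \<le> b" if "p \<in> I" "\<omega> \<in> space M" for p \<omega>
    using that b[OF X_less[OF j that(2)]] by (auto simp: Y_def I_def \<mu>_def)
  have mean: "expectation (Y p) = 0" if "p \<in> I" for p
    using that expectation_transition[OF j, of v] by (auto simp: Y_def I_def \<mu>_def prob_space)
  have var: "expectation (\<lambda>\<omega>. (Y p \<omega>)\<^sup>2) \<le> transition_variance n P v j" if "p \<in> I" for p
    using that expectation_transition(2)[OF j, of "\<lambda>k. (v k - \<mu>)\<^sup>2"] transition_variance_alt[OF P j, of v \<mu>]
    by (auto simp: Y_def I_def \<mu>_def)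
  have l': "\<bar>l / real T\<bar> * b \<le> 1" using l T by (simp add: abs_divide field_simps)
  have dev: "l * P_dev v j \<omega> = l / real T * (\<Sum>p\<in>I. Y p \<omega>)" if "\<omega> \<in> space M" for \<omega>
  proof -
    have "(\<Sum>p\<in>I. Y p \<omega>) = (\<Sum>t<T. v (X t j \<omega>)) - real T * \<mu>"
      by (simp add: I_def Y_def sum_subtractf sum.reindex[OF inj] card_image[OF inj])
    moreover have "P_dev v j \<omega> = (\<Sum>t<T. v (X t j \<omega>)) / real T - \<mu>"
      unfolding P_dev_def \<mu>_def
      using sample_transition_matrix_average[of j n T "\<lambda>t j. X t j \<omega>" v] X_less[OF j that] j by simp
    ultimately show ?thesis using T by (simp add: field_simps)
  qed
  note mom = exp_moment_indep_sum_le[OF I(1) ind bY mean var l']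
  show "integrable M (\<lambda>\<omega>. exp (l * P_dev v j \<omega>))"
    by (subst Bochner_Integration.integrable_cong[OF refl arg_cong[OF dev]]) (use mom(1) in auto)
  have "expectation (\<lambda>\<omega>. exp (l * P_dev v j \<omega>)) = expectation (\<lambda>\<omega>. exp (l / real T * (\<Sum>p\<in>I. Y p \<omega>)))"
    by (intro Bochner_Integration.integral_cong refl arg_cong[OF dev])
  also have "\<dots> \<le> exp ((l / real T)\<^sup>2 * (real (card I) * transition_variance n P v j))" by (rule mom(2))
  also have "\<dots> = exp (l\<^sup>2 * transition_variance n P v j / real T)"
    using T by (simp add: I power2_eq_square)
  finally show "expectation (\<lambda>\<omega>. exp (l * P_dev v j \<omega>)) \<le> exp (l\<^sup>2 * transition_variance n P v j / real T)" .
qed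

text \<open>Subtracting the slack \<open>A j\<close> before taking exponential moments makes each of the \<open>2 n\<close> moments at most
  \<open>1\<close>, so that a single \<open>Z\<close> serves rows of very different variance.\<close>

lemma P_dev_concentration:
  assumes l: "0 < l" and b: "\<And>j k. j < n \<Longrightarrow> k < n \<Longrightarrow> \<bar>v k - (\<Sum>k<n. P $$ (j, k) * v k)\<bar> \<le> b"
    and lb: "l * b \<le> real T"
    and A: "\<And>j. j < n \<Longrightarrow> l * transition_variance n P v j \<le> real T * A j"
  obtains Z where "integrable M Z" "expectation Z \<le> ln (2 * real n) / l"
    "\<And>j \<omega>. j < n \<Longrightarrow> \<bar>P_dev v j \<omega>\<bar> \<le> A j + Z \<omega>"
proof -
  define I where "I = {1, -1 :: real} \<times> {..<n}"
  define D where "D = (\<lambda>p \<omega>. fst p * P_dev v (snd p) \<omega> - A (snd p))"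
  have mom: "integrable M (\<lambda>\<omega>. exp (l * D p \<omega>)) \<and> expectation (\<lambda>\<omega>. exp (l * D p \<omega>)) \<le> 1" if "p \<in> I" for p
  proof -
    obtain s j where sj: "p = (s, j)" by (cases p)
    with that have "s = 1 \<or> s = -1" "j < n" by (auto simp: I_def)
    with sj have p: "p = (s, j)" "\<bar>s\<bar> = 1" "j < n" "s\<^sup>2 = 1" by auto
    have ls: "\<bar>l * s\<bar> * b \<le> real T" using p l lb by (simp add: abs_mult)
    have e: "exp (l * D p \<omega>) = exp (- (l * A j)) * exp (l * s * P_dev v j \<omega>)" for \<omega>
      by (simp add: D_def p algebra_simps mult_exp_exp)
    note m = exp_moment_P_dev[OF p(3) b[OF p(3)] ls]
    have "l * (l * transition_variance n P v j) \<le> l * (real T * A j)" using A[OF p(3)] l by (intro mult_left_mono) auto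
    then have "(l * s)\<^sup>2 * transition_variance n P v j / real T \<le> l * A j"
      using T p by (simp add: power_mult_distrib power2_eq_square[of l] field_simps)
    then have "expectation (\<lambda>\<omega>. exp (l * s * P_dev v j \<omega>)) \<le> exp (l * A j)"
      using m(2) by (meson exp_le_cancel_iff order.trans)
    then have "exp (- (l * A j)) * expectation (\<lambda>\<omega>. exp (l * s * P_dev v j \<omega>)) \<le> exp (- (l * A j)) * exp (l * A j)"
      by (intro mult_left_mono) auto
    also have "\<dots> = 1" by (simp add: exp_minus)
    finally show ?thesis unfolding e using m(1) by (simp only: integral_mult_right_zero simp_thms
        Bochner_Integration.integrable_mult_right)
  qed
  have I: "finite I" "I \<noteq> {}" "real (card I) = 2 * real n" using n by (auto simp: I_def card_cartesian_product)
  obtain Z where Z: "integrable M Z" "expectation Z \<le> ln (real (card I)) / l" "\<And>p \<omega>. p \<in> I \<Longrightarrow> D p \<omega> \<le> Z \<omega>"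
    using common_bound_from_exp_moments[OF I(1,2) l, of D] mom by blast
  have "\<bar>P_dev v j \<omega>\<bar> \<le> A j + Z \<omega>" if "j < n" for j \<omega>
    using Z(3)[of "(1, j)" \<omega>] Z(3)[of "(-1, j)" \<omega>] that by (auto simp: I_def D_def)
  then show thesis using that Z I by simp
qed


text \<open>With \<open>L = ln n / T\<close> and \<open>H = 1 / (1 - \<gamma>)\<close> the bound is of the form \<open>H * q + H\<^sup>2 * L\<close> for
  \<open>q = sqrt (H * L)\<close>. If \<open>q \<ge> 1\<close>, then the second term exceeds the trivial bound \<open>2 H\<close>. Otherwise
  the slack \<open>a = q / H\<close> balances the two contributions \<open>a * H\<^sup>2\<close> and \<open>H * L / a\<close> of the variance
  argument. For \<open>n = 1\<close> the bound is zero and there is nothing to estimate.\<close>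

lemma model_error_expectation:
  fixes v :: "real vec" and \<gamma> :: real
  assumes \<gamma>: "0 \<le> \<gamma>" "\<gamma> < 1" and v: "v \<in> carrier_vec n" "\<And>j. j < n \<Longrightarrow> \<bar>v $ j\<bar> \<le> 1"
  obtains U where "integrable M U"
    "expectation U \<le> 40 * (sqrt (ln (real n)) / ((1 - \<gamma>) powr (3/2) * sqrt (real T))
        + ln (real n) / ((1 - \<gamma>)\<^sup>2 * real T))"
    "\<And>j \<omega>. j < n \<Longrightarrow> \<omega> \<in> space M \<Longrightarrow>
        \<bar>value_function n \<gamma> (P_hat \<omega>) v $ j - value_function n \<gamma> P v $ j\<bar> \<le> U \<omega>"
proof -
  define H where "H = 1 / (1 - \<gamma>)"
  define L where "L = ln (real n) / real T"
  define q where "q = sqrt (H * L)"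
  define J where "J = (\<lambda>k. value_function n \<gamma> P v $ k)"
  define K where "K = (\<lambda>\<omega> k. value_function n \<gamma> (P_hat \<omega>) v $ k)"
  define B where "B = 40 * (sqrt (ln (real n)) / ((1 - \<gamma>) powr (3/2) * sqrt (real T))
        + ln (real n) / ((1 - \<gamma>)\<^sup>2 * real T))"
  have H: "1 \<le> H" using \<gamma> by (simp add: H_def)
  have l0: "0 \<le> L" using n by (simp add: L_def)
  have B: "B = 40 * (H * q + H\<^sup>2 * L)"
  proof -
    have "(1 - \<gamma>) powr (3/2) = (1 - \<gamma>) * sqrt (1 - \<gamma>)"
      using \<gamma> powr_add[of "1 - \<gamma>" 1 "1/2"] by (simp add: powr_half_sqrt)
    then show ?thesis
      by (simp add: B_def H_def q_def L_def real_sqrt_mult real_sqrt_divide power_divide)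
  qed
  have q: "0 \<le> q" "q\<^sup>2 = H * L" using H l0 by (auto simp: q_def)
  have J: "J j - \<gamma> * (\<Sum>k<n. P $$ (j, k) * J k) = v $ j" if "j < n" for j
    unfolding J_def by (rule value_function_solves(2)[OF P \<gamma> v(1) that])
  have K: "K \<omega> j - \<gamma> * (\<Sum>k<n. P_hat \<omega> $$ (j, k) * K \<omega> k) = v $ j" if "j < n" "\<omega> \<in> space M" for j \<omega>
    unfolding K_def by (rule value_function_solves(2)[OF stochastic_P_hat[OF that(2)] \<gamma> v(1) that(1)])
  have JH: "\<bar>J j\<bar> \<le> H" if "j < n" for j
    unfolding H_def by (rule resolvent_bound[OF P \<gamma> _ that]) (simp add: J v)
  have KH: "\<bar>K \<omega> j\<bar> \<le> H" if "j < n" "\<omega> \<in> space M" for j \<omega>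
    unfolding H_def by (rule resolvent_bound[OF stochastic_P_hat[OF that(2)] \<gamma> _ that(1)]) (simp add: K v that(2))
  have "\<exists>U. integrable M U \<and> expectation U \<le> B \<and> (\<forall>j<n. \<forall>\<omega>\<in>space M. \<bar>K \<omega> j - J j\<bar> \<le> U \<omega>)"
  proof (cases "n = 1")
    case True
    have "K \<omega> 0 = J 0" if w: "\<omega> \<in> space M" for \<omega>
    proof -
      have "P $$ (0, 0) = 1" "P_hat \<omega> $$ (0, 0) = 1"
        using stochastic_matrixD(3)[OF P, of 0] stochastic_matrixD(3)[OF stochastic_P_hat[OF w], of 0] True by auto
      then have "(1 - \<gamma>) * K \<omega> 0 = (1 - \<gamma>) * J 0"
        using J[of 0] K[of 0 \<omega>] w True by (simp add: algebra_simps)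
      then show ?thesis using \<gamma> by simp
    qed
    then show ?thesis using True B H q l0 by (intro exI[of _ "\<lambda>_. 0"]) auto
  next
    case False
    then have n2: "2 \<le> n" using n by simp
    have lpos: "0 < L" using n2 T by (simp add: L_def)
    have ln2: "ln (2 * real n) \<le> 2 * ln (real n)"
      using n2 by (simp add: ln_mult)
    show ?thesis
    proof (cases "1 \<le> H * L")
      case True
      have "\<bar>K \<omega> j - J j\<bar> \<le> 2 * H" if "j < n" "\<omega> \<in> space M" for j \<omega>
        using JH[OF that(1)] KH[OF that] by linarith
      moreover have "2 * H \<le> B"
      proof -
        have "H * 1 \<le> H * (H * L)" using True H by (intro mult_left_mono) auto
        moreover have "0 \<le> H * q" using H q by simp
        moreover have "B = 40 * (H * q) + 40 * (H * (H * L))" by (simp add: B power2_eq_square)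
        ultimately show ?thesis using H by linarith
      qed
      ultimately show ?thesis by (intro exI[of _ "\<lambda>_. 2 * H"]) (simp add: prob_space)
    next
      case False
      then have q1: "q \<le> 1" by (simp add: q_def)
      have qpos: "0 < q" using H lpos by (simp add: q_def)
      define V where "V = (\<lambda>k. \<gamma> * J k)"
      define a where "a = q / H"
      define w where "w = transition_variance n P V"
      have apos: "0 < a" using qpos H by (simp add: a_def)
      have w0: "0 \<le> w j" if "j < n" for j unfolding w_def by (rule transition_variance_nonneg[OF P that])
      have VH: "\<bar>V k\<bar> \<le> H" if "k < n" for k
      proof -
        have "\<bar>V k\<bar> = \<gamma> * \<bar>J k\<bar>" using \<gamma> by (simp add: V_def abs_mult)
        also have "\<dots> \<le> 1 * H" using \<gamma> JH[OF that] by (intro mult_mono) auto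
        finally show ?thesis by simp
      qed
      have V2H: "\<bar>(V k)\<^sup>2\<bar> \<le> H\<^sup>2" if "k < n" for k
        using power_mono[OF VH[OF that], of 2] by simp
      obtain Z where Z: "integrable M Z" "expectation Z \<le> ln (2 * real n) / (real T * a / 2)"
        "\<And>j \<omega>. j < n \<Longrightarrow> \<bar>P_dev V j \<omega>\<bar> \<le> a * w j + Z \<omega>"
      proof (rule P_dev_concentration[of "real T * a / 2" V "2 * H" "\<lambda>j. a * w j"])
        show "0 < real T * a / 2" using T apos by simp
        show "\<bar>V k - (\<Sum>k<n. P $$ (j, k) * V k)\<bar> \<le> 2 * H" if "j < n" "k < n" for j k
        proof -
          have "\<bar>\<Sum>k<n. P $$ (j, k) * V k\<bar> \<le> H"
            by (rule stochastic_average_bound[OF P that(1)]) (rule VH)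
          then show ?thesis using VH[OF that(2)] by linarith
        qed
        have "a * H \<le> 1" using q1 H by (simp add: a_def)
        then have "real T * (a * H) \<le> real T * 1" by (intro mult_left_mono) auto
        then show "real T * a / 2 * (2 * H) \<le> real T" by (simp add: mult_ac)
        show "real T * a / 2 * transition_variance n P V j \<le> real T * (a * w j)" if "j < n" for j
          using w0[OF that] apos T by (simp add: w_def)
        fix Z assume "integrable M Z" "expectation Z \<le> ln (2 * real n) / (real T * a / 2)"
          "\<And>j \<omega>. j < n \<Longrightarrow> \<bar>P_dev V j \<omega>\<bar> \<le> a * w j + Z \<omega>"
        then show thesis by (rule that)
      qed
      obtain Z2 where Z2: "integrable M Z2" "expectation Z2 \<le> ln (2 * real n) / (real T / (8 * H\<^sup>2))"
        "\<And>j \<omega>. j < n \<Longrightarrow> \<bar>P_dev (\<lambda>k. (V k)\<^sup>2) j \<omega>\<bar> \<le> w j / 2 + Z2 \<omega>"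
      proof (rule P_dev_concentration[of "real T / (8 * H\<^sup>2)" "\<lambda>k. (V k)\<^sup>2" "2 * H\<^sup>2" "\<lambda>j. w j / 2"])
        show "0 < real T / (8 * H\<^sup>2)" using T H by simp
        show "\<bar>(V k)\<^sup>2 - (\<Sum>k<n. P $$ (j, k) * (V k)\<^sup>2)\<bar> \<le> 2 * H\<^sup>2" if "j < n" "k < n" for j k
        proof -
          have "\<bar>\<Sum>k<n. P $$ (j, k) * (V k)\<^sup>2\<bar> \<le> H\<^sup>2"
            by (rule stochastic_average_bound[OF P that(1)]) (rule V2H)
          then show ?thesis using V2H[OF that(2)] by linarith
        qed
        show "real T / (8 * H\<^sup>2) * (2 * H\<^sup>2) \<le> real T" using H by simp
        fix j assume j: "j < n"
        have "real T / (8 * H\<^sup>2) * transition_variance n P (\<lambda>k. (V k)\<^sup>2) j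
            \<le> real T / (8 * H\<^sup>2) * (4 * H\<^sup>2 * w j)"
          unfolding w_def using H by (intro mult_left_mono transition_variance_square_le[OF P j VH]) auto
        also have "\<dots> = real T * (w j / 2)" using H by simp
        finally show "real T / (8 * H\<^sup>2) * transition_variance n P (\<lambda>k. (V k)\<^sup>2) j \<le> real T * (w j / 2)" .
      next
        fix Z assume "integrable M Z" "expectation Z \<le> ln (2 * real n) / (real T / (8 * H\<^sup>2))"
          "\<And>j \<omega>. j < n \<Longrightarrow> \<bar>P_dev (\<lambda>k. (V k)\<^sup>2) j \<omega>\<bar> \<le> w j / 2 + Z \<omega>"
        then show thesis by (rule that)
      qed
      define U where "U = (\<lambda>\<omega>. 2 * a * ((Z2 \<omega> + 2 / (1 - \<gamma>)) / (1 - \<gamma>)) + Z \<omega> / (1 - \<gamma>))"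
      have U_alt: "U \<omega> = 2 * q * (Z2 \<omega> + 2 * H) + H * Z \<omega>" for \<omega>
        using \<gamma> by (simp add: U_def a_def H_def)
      have "integrable M U" unfolding U_alt[abs_def] using Z(1) Z2(1) by simp
      moreover have "expectation U \<le> B"
      proof -
        have Tl: "real T * L = ln (real n)" using T by (simp add: L_def)
        have "expectation Z \<le> 2 * ln (real n) / (real T * a / 2)"
          using T apos by (intro order.trans[OF Z(2)] divide_right_mono ln2) auto
        also have "\<dots> = 4 * (H * L) / q"
          using T H qpos by (simp add: Tl[symmetric] a_def)
        also have "\<dots> = 4 * q"
          using qpos by (simp add: q(2)[symmetric] power2_eq_square)
        finally have EZ: "expectation Z \<le> 4 * q" .
        have "expectation Z2 \<le> 2 * ln (real n) / (real T / (8 * H\<^sup>2))"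
          using T H by (intro order.trans[OF Z2(2)] divide_right_mono ln2) auto
        also have "\<dots> = 16 * H * q\<^sup>2"
          using T H by (simp add: Tl[symmetric] q(2) power2_eq_square[of H])
        also have "\<dots> \<le> 16 * H * 1" using q q1 H by (intro mult_left_mono power_le_one) auto
        finally have EZ2: "expectation Z2 \<le> 16 * H" by simp
        have "expectation U = 2 * q * (expectation Z2 + 2 * H) + H * expectation Z"
          unfolding U_alt[abs_def] using Z(1) Z2(1) by (simp add: prob_space)
        also have "\<dots> \<le> 2 * q * (16 * H + 2 * H) + H * (4 * q)"
          using q H EZ EZ2 by (intro add_mono mult_left_mono) auto
        also have "\<dots> = 40 * (H * q)" by simp
        also have "\<dots> \<le> B" using H l0 by (simp add: B)
        finally show ?thesis .
      qed
      moreover have "\<bar>K \<omega> j - J j\<bar> \<le> U \<omega>" if j: "j < n" and \<omega>: "\<omega> \<in> space M" for j \<omega>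
      proof -
        define f where "f = (\<lambda>k. value_function n \<gamma> (P_hat \<omega>) (vec n w) $ k)"
        note Q = stochastic_P_hat[OF \<omega>]
        show ?thesis
          unfolding U_def
        proof (rule model_error_via_variance[OF P Q \<gamma> v(2) J K[OF _ \<omega>] V_def _ _ _ _ j, of f a "Z \<omega>" "Z2 \<omega>"])
          show "f i - \<gamma> * (\<Sum>k<n. P_hat \<omega> $$ (i, k) * f k) = transition_variance n P V i" if "i < n" for i
            unfolding f_def using value_function_solves(2)[OF Q \<gamma>, of "vec n w" i] that by (simp add: w_def)
          show "\<bar>(\<Sum>k<n. P_hat \<omega> $$ (i, k) * V k) - (\<Sum>k<n. P $$ (i, k) * V k)\<bar>
              \<le> a * transition_variance n P V i + Z \<omega>" if "i < n" for i
            using Z(3)[OF that, of \<omega>] by (simp add: P_dev_def w_def)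
          show "\<bar>(\<Sum>k<n. P_hat \<omega> $$ (i, k) * (V k)\<^sup>2) - (\<Sum>k<n. P $$ (i, k) * (V k)\<^sup>2)\<bar>
              \<le> transition_variance n P V i / 2 + Z2 \<omega>" if "i < n" for i
            using Z2(3)[OF that, of \<omega>] by (simp add: P_dev_def w_def)
        qed (use apos in auto)
      qed
      ultimately show ?thesis by blast
    qed
  qed
  then show thesis using that unfolding B_def K_def J_def by blast
qed

text \<open>The sampled matrix is a function of finitely many discrete variables, so every function of it is
  measurable. This applies to the entries of the matrix inverse.\<close>

lemma measurable_P_hat: "(\<lambda>\<omega>. f (P_hat \<omega>) :: real) \<in> borel_measurable M"
proof -
  define I where "I = {..<T} \<times> {..<n}"
  define c where "c = (\<lambda>\<omega>. \<lambda>p\<in>I. X (fst p) (snd p) \<omega>)"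
  have "c \<in> measurable M (PiM I (\<lambda>_. count_space {..<n}))"
    unfolding c_def by (intro measurable_restrict X_meas) (auto simp: I_def)
  also have "PiM I (\<lambda>_. count_space {..<n}) = count_space (I \<rightarrow>\<^sub>E {..<n})"
    by (rule count_space_PiM_finite) (auto simp: I_def)
  finally have c: "c \<in> measurable M (count_space (I \<rightarrow>\<^sub>E {..<n}))" .
  have "P_hat \<omega> = sample_transition_matrix n T (\<lambda>t j. c \<omega> (t, j))" for \<omega>
    by (rule eq_matI) (auto simp: sample_transition_matrix_def transition_indicator_def c_def I_def
        intro!: sum.cong arg_cong2[where f = "(/)"])
  then have "(\<lambda>\<omega>. f (P_hat \<omega>)) = (\<lambda>x. f (sample_transition_matrix n T (\<lambda>t j. x (t, j)))) \<circ> c"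
    by auto
  then show ?thesis by (simp add: measurable_comp[OF c])
qed

end

section \<open>The error bound for value functions\<close>

text \<open>The condition that defines \<^const>\<open>kstar\<close> holds eventually, since a geometric sequence beats a linear
  one; hence the least index exists and is positive. This excludes a run of length \<open>0\<close>.\<close>

lemma kstar_pos:
  assumes "1 \<le> kappa L"
  shows "1 \<le> kstar L"
proof -
  define s where "s = sqrt (kappa L)"
  define Q where "Q = (\<lambda>k. (1 + real k / (s + 1)) * (1 - 1 / s) ^ k \<le> (1 - 1 / (2 * s)) ^ k)"
  have s: "1 \<le> s" using assms by (simp add: s_def)
  have "\<exists>k0\<ge>1. \<forall>k\<ge>k0. Q k"
  proof (cases "s = 1")
    case True
    then show ?thesis by (intro exI[of _ 1]) (auto simp: Q_def power_0_left)
  next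
    case False
    define b where "b = 1 - 1 / (2 * s)"
    define x where "x = (1 - 1 / s) / b"
    have b: "0 < b" "1 - 1 / s < b" using s False by (auto simp: b_def field_simps)
    have x: "0 \<le> x" "x < 1" using b s by (auto simp: x_def)
    have "(\<lambda>k. real k * x ^ k) \<longlonglongrightarrow> 0" by (rule powser_times_n_limit_0) (use x in auto)
    moreover have "(\<lambda>k. x ^ k) \<longlonglongrightarrow> 0" by (rule LIMSEQ_power_zero) (use x in auto)
    ultimately have "(\<lambda>k. x ^ k + real k * x ^ k / (s + 1)) \<longlonglongrightarrow> 0 + 0 / (s + 1)"
      using s by (intro tendsto_add tendsto_divide tendsto_const) auto
    then have "(\<lambda>k. x ^ k + real k * x ^ k / (s + 1)) \<longlonglongrightarrow> 0" by simp
    then have "eventually (\<lambda>k. x ^ k + real k * x ^ k / (s + 1) < 1) sequentially"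
      by (rule order_tendstoD) simp
    then obtain k1 where k1: "\<And>k. k1 \<le> k \<Longrightarrow> x ^ k + real k * x ^ k / (s + 1) < 1"
      unfolding eventually_sequentially by blast
    have "Q k" if "k1 \<le> k" for k
    proof -
      have "(1 + real k / (s + 1)) * (1 - 1 / s) ^ k = (x ^ k + real k * x ^ k / (s + 1)) * b ^ k"
        using b by (simp add: x_def power_divide distrib_right)
      also have "\<dots> \<le> 1 * b ^ k" using k1[OF that] b by (intro mult_right_mono) auto
      finally show ?thesis by (simp add: Q_def b_def)
    qed
    then show ?thesis by (intro exI[of _ "max 1 k1"]) auto
  qed
  then have "1 \<le> (LEAST k0. 1 \<le> k0 \<and> (\<forall>k\<ge>k0. Q k))"
    using LeastI_ex[of "\<lambda>k0. 1 \<le> k0 \<and> (\<forall>k\<ge>k0. Q k)"] by blast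
  then show ?thesis unfolding kstar_def Q_def s_def .
qed

lemma sup_norm_ge: "j < dim_vec v \<Longrightarrow> \<bar>v $ j\<bar> \<le> sup_norm v"
  unfolding sup_norm_def by (intro Max_ge) auto

text \<open>The value function computed from the sampled matrix and the true mean rewards serves as the
  intermediate point: the reward error is propagated by the resolvent of the sampled matrix, and
  the rest is the model error.\<close>

lemma max_error_bound:
  fixes M :: "'w measure" and P :: "real mat"
  assumes N: "2 \<le> N" and n: "1 \<le> n" and graph: "simple_connected_graph N E"
    and gossip: "gossip_matrix N E L" and P: "stochastic_matrix n P" and \<gamma>: "0 \<le> \<gamma>" "\<gamma> < 1"
    and obs: "generative_observations M N n P r \<sigma> X R"
    and scale: "sup_norm (mean_reward N n r) \<le> 1" and T: "T = 2 * T0" and kstar: "kstar L \<le> T0"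
    and \<eta>: "\<eta> = 1 / eig L 1" and \<zeta>: "\<zeta> = (sqrt (kappa L) - 1) / (sqrt (kappa L) + 1)"
  shows "integrable M (max_error N n E L \<eta> \<zeta> \<gamma> P r T T0 X R)" (is ?int)
    and "prob_space.expectation M (max_error N n E L \<eta> \<zeta> \<gamma> P r T T0 X R)
       \<le> 40 *
         ( exp (- (real T / (2 * sqrt (kappa L))))
             * (sqrt (\<Sum>i<N. \<Sum>j<n. (r i j - mean_reward N n r $ j)\<^sup>2) / (1 - \<gamma>))
         + kappa L powr (1/4) * sqrt (\<Sum>i<N. \<Sum>j<n. (\<sigma> i j)\<^sup>2) / ((1 - \<gamma>) * real T)
         + sqrt (\<Sum>j<n. Max ((\<lambda>i. (\<sigma> i j)\<^sup>2) ` {..<N})) / ((1 - \<gamma>) * sqrt (real T))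
         + sqrt (ln (real n)) / ((1 - \<gamma>) powr (3/2) * sqrt (real T))
         + ln (real n) / ((1 - \<gamma>)\<^sup>2 * real T))" (is ?bound)
proof -
  obtain u d k0 where orth: "\<And>k l. k < N \<Longrightarrow> l < N \<Longrightarrow> (\<Sum>i<N. u k i * u l i) = (if k = l then 1 else (0::real))"
    and cols: "\<And>i j. i < N \<Longrightarrow> j < N \<Longrightarrow> (\<Sum>k<N. u k i * u k j) = (if i = j then 1 else 0)"
    and ev: "\<And>k i. k < N \<Longrightarrow> i < N \<Longrightarrow> (\<Sum>j<N. L $$ (i, j) * u k j) = d k * u k i"
    and k0: "k0 < N" "d k0 = 0" and const: "\<And>i. i < N \<Longrightarrow> u k0 i = u k0 0"
    and d: "\<And>k. k < N \<Longrightarrow> k \<noteq> k0 \<Longrightarrow> eig L (N - 1) \<le> d k \<and> d k \<le> eig L 1"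
    and pos: "0 < eig L (N - 1)" and le: "eig L (N - 1) \<le> eig L 1"
    by (rule gossip_spectrum[OF gossip N]) blast
  define s where "s = sqrt (kappa L)"
  have "dim_row L = N" using gossip by (auto simp: gossip_matrix_def)
  then have kappa: "kappa L = eig L 1 / eig L (N - 1)" by (simp add: kappa_def)
  have kappa1: "1 \<le> kappa L" using pos le by (simp add: kappa)
  have s: "1 \<le> s" and s2: "s\<^sup>2 = kappa L" using kappa1 by (auto simp: s_def)
  have T0: "0 < T0" using kstar_pos[OF kappa1] kstar by simp
  have contraction: "0 \<le> 1 - \<eta> * d k \<and> 1 - \<eta> * d k \<le> 1 - 1 / s\<^sup>2" if "k < N" "k \<noteq> k0" for k
  proof -
    have l1: "0 < eig L 1" using pos le by simp
    have "d k / eig L 1 \<le> 1" "eig L (N - 1) / eig L 1 \<le> d k / eig L 1"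
      using d[OF that] l1 by (auto intro: divide_right_mono)
    then show ?thesis by (simp add: \<eta> s2 kappa)
  qed
  interpret prob_space M using obs by (simp add: generative_observations_def)
  have obs_R: "integrable M (R i t j)" "integrable M (\<lambda>\<omega>. (R i t j \<omega>)\<^sup>2)"
      "expectation (R i t j) = r i j" "variance (R i t j) = (\<sigma> i j)\<^sup>2" if "i < N" "j < n" for i t j
    using obs that unfolding generative_observations_def by blast+
  have obs_R_indep: "indep_vars (\<lambda>_. Pi\<^sub>M {..<n} (\<lambda>_. borel))
       (\<lambda>(i, t) \<omega>. \<lambda>j\<in>{..<n}. R i t j \<omega>) ({..<N} \<times> UNIV)"
    using obs unfolding generative_observations_def by blast
  have obs_X: "X t j \<in> measurable M (count_space {..<n})"
      "k < n \<Longrightarrow> measure M {\<omega> \<in> space M. X t j \<omega> = k} = P $$ (j, k)" if "j < n" for t j k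
    using obs that unfolding generative_observations_def by blast+
  have obs_X_indep: "indep_vars (\<lambda>_. count_space {..<n}) (\<lambda>(t, j). X t j) (UNIV \<times> {..<n})"
    using obs unfolding generative_observations_def by blast
  have pos_T: "0 < T" and pos_n: "0 < n" using T T0 n by auto
  have \<zeta>s: "\<zeta> = (s - 1) / (s + 1)" by (simp add: \<zeta> s_def)
  interpret rew: reward_sampling N E L u d k0 \<eta> \<zeta> s M n T0 r \<sigma> R
    by unfold_locales (fact gossip graph orth cols ev k0 const s \<zeta>s contraction T0 obs_R obs_R_indep)+
  interpret tr: transition_sampling M n P X T
    by unfold_locales (fact P pos_T pos_n obs_X obs_X_indep)+
  define rb where "rb = mean_reward N n r"
  have rb: "rb $ j = (\<Sum>i<N. r i j) / real N" if "j < n" for j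
    using that by (simp add: rb_def mean_reward_def)
  have rbc: "rb \<in> carrier_vec n" by (simp add: rb_def mean_reward_def)
  have rb1: "\<bar>rb $ j\<bar> \<le> 1" if "j < n" for j
    using sup_norm_ge[of j rb] scale that rbc by (simp add: rb_def)
  define rh where "rh = (\<lambda>\<omega>. sda_output n E L \<eta> \<zeta> T T0 (\<lambda>i t j. R i t j \<omega>))"
  have rh: "rh \<omega> i \<in> carrier_vec n" for \<omega> i by (simp add: rh_def sda_output_def)
  define J where "J = value_function n \<gamma> P rb"
  define K where "K = (\<lambda>\<omega> i. value_function n \<gamma> (tr.P_hat \<omega>) (rh \<omega> i))"
  have J: "J \<in> carrier_vec n" unfolding J_def by (rule value_function_solves[OF P \<gamma> rbc])
  have K: "K \<omega> i \<in> carrier_vec n" if "\<omega> \<in> space M" for \<omega> i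
    unfolding K_def by (rule value_function_solves(1)[OF tr.stochastic_P_hat[OF that] \<gamma> rh])
  define err where "err = (\<lambda>\<omega>. Max ((\<lambda>i. Max ((\<lambda>j. \<bar>K \<omega> i $ j - J $ j\<bar>) ` {..<n})) ` {..<N}))"
  have err_eq: "max_error N n E L \<eta> \<zeta> \<gamma> P r T T0 X R \<omega> = err \<omega>" if "\<omega> \<in> space M" for \<omega>
  proof -
    have "sup_norm (K \<omega> i - J) = Max ((\<lambda>j. \<bar>K \<omega> i $ j - J $ j\<bar>) ` {..<n})" for i
      unfolding sup_norm_def using J by (intro arg_cong[of _ _ Max] image_cong) auto
    then show ?thesis
      by (simp add: max_error_def Let_def err_def K_def J_def rh_def rb_def)
  qed
  obtain U where U: "integrable M U"
    "expectation U \<le> 6 * exp (- (real T0 / s)) * sqrt (\<Sum>i<N. \<Sum>j<n. (r i j - (\<Sum>i<N. r i j) / real N)\<^sup>2)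
       + 8 * sqrt s * sqrt (\<Sum>i<N. \<Sum>j<n. (\<sigma> i j)\<^sup>2) / real T0
       + sqrt (\<Sum>j<n. Max ((\<lambda>i. (\<sigma> i j)\<^sup>2) ` {..<N})) / sqrt (real T0)"
    "\<And>i j \<omega>. i < N \<Longrightarrow> j < n \<Longrightarrow> \<bar>rh \<omega> i $ j - (\<Sum>i<N. r i j) / real N\<bar> \<le> U \<omega>"
    using rew.reward_estimate_expectation unfolding rh_def T by blast
  obtain V where V: "integrable M V"
    "expectation V \<le> 40 * (sqrt (ln (real n)) / ((1 - \<gamma>) powr (3/2) * sqrt (real T))
        + ln (real n) / ((1 - \<gamma>)\<^sup>2 * real T))"
    "\<And>j \<omega>. j < n \<Longrightarrow> \<omega> \<in> space M \<Longrightarrow>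
        \<bar>value_function n \<gamma> (tr.P_hat \<omega>) rb $ j - J $ j\<bar> \<le> V \<omega>"
    using tr.model_error_expectation[OF \<gamma> rbc rb1] unfolding J_def by blast
  have entry: "\<bar>K \<omega> i $ j - J $ j\<bar> \<le> U \<omega> / (1 - \<gamma>) + V \<omega>" if i: "i < N" and j: "j < n" and w: "\<omega> \<in> space M" for i j \<omega>
  proof -
    note Q = tr.stochastic_P_hat[OF w]
    define K0 where "K0 = value_function n \<gamma> (tr.P_hat \<omega>) rb"
    have "\<bar>K \<omega> i $ j - K0 $ j\<bar> \<le> U \<omega> / (1 - \<gamma>)"
    proof (rule resolvent_bound[OF Q \<gamma> _ j])
      fix l assume l: "l < n"
      have "K \<omega> i $ l - K0 $ l - \<gamma> * (\<Sum>k<n. tr.P_hat \<omega> $$ (l, k) * (K \<omega> i $ k - K0 $ k))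
          = (K \<omega> i $ l - \<gamma> * (\<Sum>k<n. tr.P_hat \<omega> $$ (l, k) * K \<omega> i $ k))
            - (K0 $ l - \<gamma> * (\<Sum>k<n. tr.P_hat \<omega> $$ (l, k) * K0 $ k))"
        by (simp add: right_diff_distrib sum_subtractf)
      also have "\<dots> = rh \<omega> i $ l - rb $ l"
        unfolding K_def K0_def by (simp only: value_function_solves(2)[OF Q \<gamma> rh l] value_function_solves(2)[OF Q \<gamma> rbc l])
      finally show "\<bar>K \<omega> i $ l - K0 $ l - \<gamma> * (\<Sum>k<n. tr.P_hat \<omega> $$ (l, k) * (K \<omega> i $ k - K0 $ k))\<bar> \<le> U \<omega>"
        using U(3)[OF i l, of \<omega>] rb[OF l] by simp
    qed
    moreover have "\<bar>K0 $ j - J $ j\<bar> \<le> V \<omega>" unfolding K0_def by (rule V(3)[OF j w])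
    ultimately show ?thesis by linarith
  qed
  have err_le: "err \<omega> \<le> U \<omega> / (1 - \<gamma>) + V \<omega>" if "\<omega> \<in> space M" for \<omega>
  proof -
    have ne: "{..<N} \<noteq> {}" "{..<n} \<noteq> {}" using N n by (auto simp: lessThan_empty_iff)
    have "Max ((\<lambda>j. \<bar>K \<omega> i $ j - J $ j\<bar>) ` {..<n}) \<le> U \<omega> / (1 - \<gamma>) + V \<omega>" if "i < N" for i
      by (rule Max.boundedI) (use ne entry[OF that _ \<open>\<omega> \<in> space M\<close>] in blast)+
    then show ?thesis
      unfolding err_def using ne by (intro Max.boundedI) blast+
  qed
  have err_ge: "0 \<le> err \<omega>" for \<omega>
  proof -
    have "0 \<le> \<bar>K \<omega> 0 $ 0 - J $ 0\<bar>" by simp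
    also have "\<dots> \<le> Max ((\<lambda>j. \<bar>K \<omega> 0 $ j - J $ j\<bar>) ` {..<n})" using n by (intro Max_ge) auto
    also have "\<dots> \<le> err \<omega>" unfolding err_def using N by (intro Max_ge) auto
    finally show ?thesis .
  qed
  have rh_meas: "(\<lambda>\<omega>. rh \<omega> i $ k) \<in> borel_measurable M" if "i < N" "k < n" for i k
    unfolding rh_def T by (rule rew.measurable_sda_output[OF that])
  have K_meas: "(\<lambda>\<omega>. K \<omega> i $ j) \<in> borel_measurable M" if ij: "i < N" "j < n" for i j
  proof -
    have "K \<omega> i $ j = (\<Sum>k<n. the (mat_inverse (1\<^sub>m n - \<gamma> \<cdot>\<^sub>m tr.P_hat \<omega>)) $$ (j, k) * rh \<omega> i $ k)"
      if "\<omega> \<in> space M" for \<omega>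
      unfolding K_def by (rule value_function_solves(3)[OF tr.stochastic_P_hat[OF that] \<gamma> rh ij(2)])
    moreover have "(\<lambda>\<omega>. \<Sum>k<n. the (mat_inverse (1\<^sub>m n - \<gamma> \<cdot>\<^sub>m tr.P_hat \<omega>)) $$ (j, k) * rh \<omega> i $ k) \<in> borel_measurable M"
      using ij(1) by (intro borel_measurable_sum borel_measurable_times rh_meas
          tr.measurable_P_hat[of "\<lambda>Q. the (mat_inverse (1\<^sub>m n - \<gamma> \<cdot>\<^sub>m Q)) $$ (j, _)"]) auto
    ultimately show ?thesis by (simp cong: measurable_cong)
  qed
  have err_meas: "err \<in> borel_measurable M"
    unfolding err_def using K_meas
    by (intro borel_measurable_Max borel_measurable_abs borel_measurable_diff) auto
  have intUV: "integrable M (\<lambda>\<omega>. U \<omega> / (1 - \<gamma>) + V \<omega>)" using U(1) V(1) by simp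
  have int_err: "integrable M err"
  proof (rule Bochner_Integration.integrable_bound[OF intUV err_meas])
    have "norm (err \<omega>) \<le> norm (U \<omega> / (1 - \<gamma>) + V \<omega>)" if "\<omega> \<in> space M" for \<omega>
      using err_le[OF that] err_ge[of \<omega>] by simp
    then show "AE \<omega> in M. norm (err \<omega>) \<le> norm (U \<omega> / (1 - \<gamma>) + V \<omega>)" by (intro AE_I2)
  qed
  show ?int by (rule Bochner_Integration.integrable_cong[THEN iffD2, OF refl err_eq int_err])
  define a where "a = exp (- (real T / (2 * sqrt (kappa L)))) * sqrt (\<Sum>i<N. \<Sum>j<n. (r i j - mean_reward N n r $ j)\<^sup>2)"
  define b where "b = kappa L powr (1/4) * sqrt (\<Sum>i<N. \<Sum>j<n. (\<sigma> i j)\<^sup>2) / real T"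
  define c where "c = sqrt (\<Sum>j<n. Max ((\<lambda>i. (\<sigma> i j)\<^sup>2) ` {..<N})) / sqrt (real T)"
  have nonneg: "0 \<le> a" "0 \<le> b" "0 \<le> c"
  proof -
    have "0 \<le> Max ((\<lambda>i. (\<sigma> i j)\<^sup>2) ` {..<N})" for j
      using N by (intro order.trans[OF zero_le_power2[of "\<sigma> 0 j"]] Max_ge) auto
    then show "0 \<le> c" by (auto simp: c_def intro!: divide_nonneg_nonneg sum_nonneg)
  qed (auto simp: a_def b_def intro!: mult_nonneg_nonneg divide_nonneg_nonneg sum_nonneg)
  have EU: "expectation U \<le> 40 * (a + b + c)"
  proof -
    have sum_eq: "(\<Sum>i<N. \<Sum>j<n. (r i j - (\<Sum>i<N. r i j) / real N)\<^sup>2) = (\<Sum>i<N. \<Sum>j<n. (r i j - mean_reward N n r $ j)\<^sup>2)"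
      by (intro sum.cong refl) (simp add: mean_reward_def)
    have "exp (- (real T0 / s)) = exp (- (real T / (2 * sqrt (kappa L))))" by (simp add: T s_def)
    then have 1: "6 * exp (- (real T0 / s)) * sqrt (\<Sum>i<N. \<Sum>j<n. (r i j - (\<Sum>i<N. r i j) / real N)\<^sup>2) = 6 * a"
      by (simp add: a_def sum_eq)
    have "sqrt s = kappa L powr (1/4)"
      using kappa1 by (simp add: s_def powr_half_sqrt[symmetric] powr_powr)
    then have 2: "8 * sqrt s * sqrt (\<Sum>i<N. \<Sum>j<n. (\<sigma> i j)\<^sup>2) / real T0 = 16 * b"
      by (simp add: b_def T)
    have "sqrt (real T) = sqrt 2 * sqrt (real T0)" by (simp add: T real_sqrt_mult)
    then have "sqrt (\<Sum>j<n. Max ((\<lambda>i. (\<sigma> i j)\<^sup>2) ` {..<N})) / sqrt (real T0) = sqrt 2 * c"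
      using T0 by (simp add: c_def)
    also have "\<dots> \<le> 2 * c" using nonneg by (intro mult_right_mono real_le_lsqrt) auto
    finally show ?thesis using U(2) 1 2 nonneg by simp
  qed
  have "expectation (max_error N n E L \<eta> \<zeta> \<gamma> P r T T0 X R) = expectation err"
    by (intro Bochner_Integration.integral_cong refl err_eq)
  also have "\<dots> \<le> expectation (\<lambda>\<omega>. U \<omega> / (1 - \<gamma>) + V \<omega>)"
    by (intro integral_mono int_err intUV err_le)
  also have "\<dots> = expectation U / (1 - \<gamma>) + expectation V" using U(1) V(1) by simp
  also have "\<dots> \<le> 40 * (a + b + c) / (1 - \<gamma>)
      + 40 * (sqrt (ln (real n)) / ((1 - \<gamma>) powr (3/2) * sqrt (real T)) + ln (real n) / ((1 - \<gamma>)\<^sup>2 * real T))"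
    using \<gamma> EU V(2) by (intro add_mono divide_right_mono) auto
  also have "40 * (a + b + c) / (1 - \<gamma>) = 40 * (a / (1 - \<gamma>) + b / (1 - \<gamma>) + c / (1 - \<gamma>))"
    by (simp add: add_divide_distrib)
  finally show ?bound
    by (simp add: a_def b_def c_def algebra_simps)
qed

theorem corollary2:
  "\<exists>C2>0. \<forall>(N::nat) (n::nat) E L P \<gamma> r \<sigma> (M::'w measure) X R (T::nat) (T0::nat) \<eta> \<zeta>.
     2 \<le> N \<longrightarrow> 1 \<le> n \<longrightarrow>
     simple_connected_graph N E \<longrightarrow> gossip_matrix N E L \<longrightarrow>
     stochastic_matrix n P \<longrightarrow> 0 \<le> \<gamma> \<longrightarrow> \<gamma> < 1 \<longrightarrow>
     generative_observations M N n P r \<sigma> X R \<longrightarrow>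
     sup_norm (mean_reward N n r) \<le> 1 \<longrightarrow>
     T = 2 * T0 \<longrightarrow> kstar L \<le> T0 \<longrightarrow>
     \<eta> = 1 / eig L 1 \<longrightarrow>
     \<zeta> = (sqrt (kappa L) - 1) / (sqrt (kappa L) + 1) \<longrightarrow>
     integrable M (max_error N n E L \<eta> \<zeta> \<gamma> P r T T0 X R) \<and>
     prob_space.expectation M (max_error N n E L \<eta> \<zeta> \<gamma> P r T T0 X R)
       \<le> C2 *
         ( exp (- (real T / (2 * sqrt (kappa L))))
             * (sqrt (\<Sum>i<N. \<Sum>j<n. (r i j - vec_index (mean_reward N n r) j)\<^sup>2) / (1 - \<gamma>))
         + kappa L powr (1/4) * sqrt (\<Sum>i<N. \<Sum>j<n. (\<sigma> i j)\<^sup>2) / ((1 - \<gamma>) * real T)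
         + sqrt (\<Sum>j<n. Max ((\<lambda>i. (\<sigma> i j)\<^sup>2) ` {..<N})) / ((1 - \<gamma>) * sqrt (real T))
         + sqrt (ln (real n)) / ((1 - \<gamma>) powr (3/2) * sqrt (real T))
         + ln (real n) / ((1 - \<gamma>)\<^sup>2 * real T))"
proof (intro exI[of _ "40 :: real"] conjI allI impI)
  show "(0::real) < 40" by simp
qed (rule max_error_bound; assumption)+

end
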